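(* Let $p=\lfloor\frac{n-3-2l}{l+1}\rfloor$. Then the poset $(\mathcal{U}_{n,l}^{3},\preceq)$ has exactly $p+1$ minimal elements, namely $U_{n,l}^{3,0},U_{n,l}^{3,1},\dots,U_{n,l}^{3,p}$.
   Context: For a graph $G$ on $n$ vertices with Laplacian matrix $L(G)=D(G)-A(G)$, write $\det(\lambda I_n-L(G))=\sum_{k=0}^n(-1)^k c_k(G)\lambda^{n-k}$. For graphs $G,H$ of order $n$, $G\preceq H$ means $c_k(G)\le c_k(H)$ for all $0\le k\le n$, and $G\prec H$ means $G\preceq H$ and $c_k(G)<c_k(H)$ for some $k$. A minimal element of a set of graphs (up to isomorphism) is a graph $G$ in it with no $H$ in the set satisfying $H\prec G$. A leaf is a vertex of degree $1$. $\mathcal{U}_{n,l}^g$ is the set of connected unicyclic graphs with $n$ vertices, exactly $l$ leaves and girth $g$. The balanced starlike tree $BST_{m,l}$ is the tree of order $m$ with $l$ leaves obtained by identifying one end of each of $l$ paths, each of order $\lfloor\frac{m-1}{l}\rfloor+1$ or $\lceil\frac{m-1}{l}\rceil+1$, into a single vertex (its center). $U_{n,l}^{g,q}$ ($q\ge0$) is obtained from the cycle $C_g$ and a path $w_0w_1\cdots w_q$ by identifying $w_0$ with a cycle vertex and $w_q$ with the center of $BST_{n-q-g+1,l}$ (for $q=0$ the center is identified with the cycle vertex).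
   Formalization: Assumes l ≥ 2 and p ≥ 0 (n ≥ 2l+3): for l+3 ≤ n ≤ 2l+2 the formula gives p = -1 although the nonempty finite set has a minimal element, and for l = 1 all the graphs U^{3,q} coincide (no BST has one leaf), so the count p+1 fails for n ≥ 7. *)

theory Defs
  imports "Graph_Theory.Graph_Theory" "Jordan_Normal_Form.Char_Poly"
begin

text \<open>
  A finite simple graph of order \<open>n\<close> is a symmetric loop-free digraph without parallel arcs
  (locale \<open>pair_graph\<close>) on the vertex set \<open>{0..<n}\<close>, so that its vertices index the rows and columns
  of its matrices directly. Every undirected edge is a pair of opposite arcs.
\<close>

definition graph_of_order :: "nat \<Rightarrow> nat pair_pre_digraph \<Rightarrow> bool" where
  "graph_of_order n G \<longleftrightarrow> pair_graph G \<and> pverts G = {0..<n}"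

definition degree_of :: "nat pair_pre_digraph \<Rightarrow> nat \<Rightarrow> nat" where
  "degree_of G v = out_degree (with_proj G) v"

definition graph_iso :: "nat pair_pre_digraph rel" where
  "graph_iso = {(G, H). digraph_iso (with_proj G) (with_proj H)}"


subsection \<open>Laplacian coefficients\<close>

definition degree_mat :: "nat pair_pre_digraph \<Rightarrow> int mat" where
  "degree_mat G = (let n = card (pverts G) in
     mat n n (\<lambda>(i, j). if i = j then int (degree_of G i) else 0))"

definition adjacency_mat :: "nat pair_pre_digraph \<Rightarrow> int mat" where
  "adjacency_mat G = (let n = card (pverts G) in
     mat n n (\<lambda>(i, j). if (i, j) \<in> parcs G then 1 else 0))"

definition laplacian_mat :: "nat pair_pre_digraph \<Rightarrow> int mat" where
  "laplacian_mat G = degree_mat G - adjacency_mat G"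

text \<open>
  \<open>char_poly L\<close> is \<open>det (\<lambda> I - L)\<close>, which is to be \<open>\<Sum>k\<le>n. (-1)^k * c k * \<lambda>^(n - k)\<close>.
  Meaningful for \<open>k \<le> n\<close> only, as the subtraction truncates.
\<close>

definition lap_coeff :: "nat pair_pre_digraph \<Rightarrow> nat \<Rightarrow> int" where
  "lap_coeff G k = (- 1) ^ k * coeff (char_poly (laplacian_mat G)) (card (pverts G) - k)"

definition lap_le :: "nat pair_pre_digraph \<Rightarrow> nat pair_pre_digraph \<Rightarrow> bool" where
  "lap_le G H \<longleftrightarrow> card (pverts G) = card (pverts H) \<and>
     (\<forall>k\<le>card (pverts G). lap_coeff G k \<le> lap_coeff H k)"

definition lap_less :: "nat pair_pre_digraph \<Rightarrow> nat pair_pre_digraph \<Rightarrow> bool" where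
  "lap_less G H \<longleftrightarrow> lap_le G H \<and> (\<exists>k\<le>card (pverts G). lap_coeff G k < lap_coeff H k)"

definition minimal_graphs :: "nat pair_pre_digraph set \<Rightarrow> nat pair_pre_digraph set" where
  "minimal_graphs S = {G \<in> S. \<not> (\<exists>H\<in>S. lap_less H G)}"


subsection \<open>Unicyclic graphs\<close>

text \<open>
  In a symmetric digraph the library's directed cycles include \<open>u \<rightarrow> v \<rightarrow> u\<close>; the cycles of the
  undirected graph are those of length at least 3. Such a cycle is traversed by several arc lists
  (choice of starting point and direction), which all have the same symmetrised arc set.
\<close>

definition graph_cycle :: "nat pair_pre_digraph \<Rightarrow> (nat \<times> nat) list \<Rightarrow> bool" where
  "graph_cycle G p \<longleftrightarrow> pre_digraph.cycle (with_proj G) p \<and> 3 \<le> length p"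

definition unicyclic :: "nat pair_pre_digraph \<Rightarrow> bool" where
  "unicyclic G \<longleftrightarrow> (\<exists>!C. \<exists>p. graph_cycle G p \<and> C = set p \<union> (set p)\<inverse>)"

definition girth :: "nat pair_pre_digraph \<Rightarrow> nat" where
  "girth G = (LEAST k. \<exists>p. graph_cycle G p \<and> length p = k)"

definition leaves :: "nat pair_pre_digraph \<Rightarrow> nat set" where
  "leaves G = {v \<in> pverts G. degree_of G v = 1}"

definition unicyclic_graphs :: "nat \<Rightarrow> nat \<Rightarrow> nat \<Rightarrow> nat pair_pre_digraph set" where
  "unicyclic_graphs n l g = {G. graph_of_order n G \<and> Digraph_Component.connected (with_proj G) \<and>
     unicyclic G \<and> card (leaves G) = l \<and> girth G = g}"


subsection \<open>The graphs \<open>U\<^sub>n\<^sub>,\<^sub>l\<^sup>g\<^sup>,\<^sup>q\<close>\<close>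

text \<open>The following edge sets list every edge in one direction only; \<open>U_graph\<close> symmetrises.\<close>

definition cycle_edges :: "nat \<Rightarrow> nat rel" where
  "cycle_edges g = {(i, (i + 1) mod g) | i. i < g}"

definition path_edges :: "nat \<Rightarrow> nat rel" where
  "path_edges q = {(i, i + 1) | i. i < q}"

text \<open>
  The balanced starlike tree \<open>BST m l\<close> (for \<open>l \<ge> 1\<close>) on \<open>{0..<m}\<close> with centre \<open>0\<close>. The vertices
  \<open>1, \<dots>, m - 1\<close> are dealt out to the \<open>l\<close> paths in turn, so that the \<open>i\<close>-th path (\<open>1 \<le> i \<le> l\<close>) is
  \<open>0, i, i + l, i + 2 * l, \<dots>\<close>, and its order is \<open>1\<close> plus the floor or the ceiling of
  \<open>(m - 1) / l\<close>. The predecessor of \<open>j\<close> on its path is \<open>j - l\<close>: the truncated subtraction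
  attaches the vertices \<open>1, \<dots>, l\<close> to the centre.
\<close>

definition bst_edges :: "nat \<Rightarrow> nat \<Rightarrow> nat rel" where
  "bst_edges m l = {(j - l, j) | j. 1 \<le> j \<and> j < m}"

text \<open>
  The cycle occupies \<open>0, \<dots>, g - 1\<close>; \<open>w 0\<close> is the cycle vertex \<open>0\<close>, and \<open>w 1, \<dots>, w q\<close> are
  \<open>g, \<dots>, g + q - 1\<close>. The centre of the balanced starlike tree of order \<open>n - q - g + 1\<close> is \<open>w q\<close>,
  and its other vertices are \<open>g + q, \<dots>, n - 1\<close>.
\<close>

definition path_vertex :: "nat \<Rightarrow> nat \<Rightarrow> nat" where
  "path_vertex g i = (if i = 0 then 0 else g + i - 1)"

definition bst_vertex :: "nat \<Rightarrow> nat \<Rightarrow> nat \<Rightarrow> nat" where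
  "bst_vertex g q j = (if j = 0 then path_vertex g q else g + q + j - 1)"

definition U_edges :: "nat \<Rightarrow> nat \<Rightarrow> nat \<Rightarrow> nat \<Rightarrow> nat rel" where
  "U_edges n l g q = cycle_edges g
     \<union> map_prod (path_vertex g) (path_vertex g) ` path_edges q
     \<union> map_prod (bst_vertex g q) (bst_vertex g q) ` bst_edges (n + 1 - q - g) l"

definition U_graph :: "nat \<Rightarrow> nat \<Rightarrow> nat \<Rightarrow> nat \<Rightarrow> nat pair_pre_digraph" where
  "U_graph n l g q = \<lparr> pverts = {0..<n}, parcs = U_edges n l g q \<union> (U_edges n l g q)\<inverse> \<rparr>"

end

theory Submission
  imports Defs
begin

text \<open>
  The coefficients of \<open>det (I + x L(G))\<close> are the Laplacian coefficients. Eliminating the pendant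
  trees vertex by vertex expresses this determinant by two polynomials \<open>A\<close>, \<open>B\<close> with nonnegative
  coefficients for every rooted subtree. Moving a branch \<open>S\<close> from a vertex \<open>u\<close> to a vertex \<open>v\<close>
  changes the determinant by a nonnegative multiple of \<open>B\<^sub>S (A\<^sub>Y B\<^sub>X - A\<^sub>X B\<^sub>Y)\<close>, where \<open>X\<close> and \<open>Y\<close>
  are the remaining parts at \<open>u\<close> and \<open>v\<close>; so branches should be moved towards the heavier end.
  With this, all trees at the triangle are first gathered at one corner, then into a single
  branching vertex at some distance \<open>s\<close> from the triangle, then its legs are balanced. A triangle
  on a stem of length \<open>s\<close> is heavier than a path of length \<open>b\<close> iff \<open>b \<le> s + 2\<close> and incomparable to
  it otherwise; hence the branching vertex can be shifted towards the triangle as long as some leg is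
  shorter than \<open>s + 2\<close>, which is the case iff \<open>s > p\<close>. For \<open>s < p\<close> the difference between the
  candidates \<open>s + 1\<close> and \<open>s\<close> has a positive lowest coefficient, in degree \<open>2 s + 2\<close>, and a
  negative highest one, in degree \<open>n - 2\<close>; so no two candidates are comparable.
\<close>

section \<open>Polynomials with nonnegative coefficients\<close>

text \<open>With A and B counting rooted spanning forests, heaviness compares the ratios B / A after
  clearing denominators, coefficient by coefficient. This is only a partial order, and its gaps are
  what lets several minimal graphs survive: where a leg and the triangle on its stem are
  incomparable, no move applies. The difficulty is to show that a second branching vertex never gets
  caught in such a gap. The remedy is a dichotomy at height \<open>s + 2\<close>: a tree at least
  that high with a second branch at its root is heavier than the triangle on a stem of length
  \<open>s\<close>, and in a lower one every path is lighter than what lies above, so that a branch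
  can be lifted. The constant 2 comes from the triangle having 3 spanning trees with 2 edges each:
  the highest coefficient in the comparison with a path of length \<open>b\<close> is
  \<open>3 * (s + 2 - b)\<close>. The elimination takes place at positive numbers, where all pivots
  are positive; polynomial identities follow from infinitely many such points.\<close>

definition nonneg_poly :: "real poly \<Rightarrow> bool" where
  "nonneg_poly p \<longleftrightarrow> (\<forall>i. 0 \<le> coeff p i)"

definition positive_poly :: "real poly \<Rightarrow> bool" where
  "positive_poly p \<longleftrightarrow> nonneg_poly p \<and> p \<noteq> 0"

lemma nonneg_poly_0 [simp]: "nonneg_poly 0"
  by (simp add: nonneg_poly_def)

lemma nonneg_poly_1 [simp]: "nonneg_poly 1"
  by (simp add: nonneg_poly_def coeff_1)

lemma nonneg_poly_add: "nonneg_poly p \<Longrightarrow> nonneg_poly q \<Longrightarrow> nonneg_poly (p + q)"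
  by (simp add: nonneg_poly_def)

lemma nonneg_poly_mult: "nonneg_poly p \<Longrightarrow> nonneg_poly q \<Longrightarrow> nonneg_poly (p * q)"
  by (simp add: nonneg_poly_def coeff_mult sum_nonneg)

lemma nonneg_poly_numeral [simp]: "nonneg_poly (numeral n)"
  by (simp add: nonneg_poly_def numeral_poly coeff_pCons split: nat.splits)

lemma positive_poly_numeral [simp]: "positive_poly (numeral n)"
  by (simp add: positive_poly_def)

lemma positive_poly_imp_nonneg: "positive_poly p \<Longrightarrow> nonneg_poly p"
  by (simp add: positive_poly_def)

lemma positive_poly_1 [simp]: "positive_poly 1"
  by (simp add: positive_poly_def)

lemma positive_poly_mult: "positive_poly p \<Longrightarrow> positive_poly q \<Longrightarrow> positive_poly (p * q)"
  by (simp add: positive_poly_def nonneg_poly_mult)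

lemma nonneg_poly_add_eq_0:
  assumes "nonneg_poly p" "nonneg_poly q" "p + q = 0"
  shows "p = 0"
proof (rule poly_eqI)
  fix i
  have "coeff p i + coeff q i = 0"
    using assms(3) by (metis coeff_0 coeff_add)
  then show "coeff p i = coeff 0 i"
    using assms(1,2) unfolding nonneg_poly_def
    by (metis add_nonneg_eq_0_iff coeff_0)
qed

lemma positive_poly_add1: "positive_poly p \<Longrightarrow> nonneg_poly q \<Longrightarrow> positive_poly (p + q)"
  using nonneg_poly_add_eq_0 by (auto simp: positive_poly_def nonneg_poly_add)

lemma positive_poly_add2: "nonneg_poly p \<Longrightarrow> positive_poly q \<Longrightarrow> positive_poly (p + q)"
  using positive_poly_add1[of q p] by (simp add: add.commute)

text \<open>The indeterminate, kept opaque so that the simplifier treats it as an atom.\<close>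

definition tt :: "real poly" where "tt = [:0, 1:]"

lemma positive_poly_tt [simp]: "positive_poly tt"
  by (auto simp: positive_poly_def nonneg_poly_def tt_def coeff_pCons split: nat.splits)

lemma nonneg_poly_tt [simp]: "nonneg_poly tt"
  by (rule positive_poly_imp_nonneg) simp

lemma poly_tt [simp]: "poly tt x = x"
  by (simp add: tt_def)


section \<open>Rooted graphs and their forest polynomials\<close>

text \<open>
  A rooted graph enters the computations through the generating functions, by number of edges, of
  its rooted spanning forests: \<open>fst\<close> counts those in which the distinguished vertex is the root of
  its component, \<open>snd\<close> the others.
\<close>

type_synonym ppair = "real poly \<times> real poly"

definition glue :: "ppair \<Rightarrow> ppair \<Rightarrow> ppair" where
  "glue X Y = (fst X * fst Y, fst X * snd Y + snd X * fst Y)"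

definition hang :: "ppair \<Rightarrow> ppair" where
  "hang X = ((1 + tt) * fst X + snd X, tt * fst X + tt * snd X)"

definition tot :: "ppair \<Rightarrow> real poly" where
  "tot X = fst X + snd X"

text \<open>The numerator of \<open>snd X / fst X - snd Y / fst Y\<close>, so that
  \<open>heavier\<close> compares these two ratios.\<close>

definition cross :: "ppair \<Rightarrow> ppair \<Rightarrow> real poly" where
  "cross X Y = fst Y * snd X - fst X * snd Y"

abbreviation heavier :: "ppair \<Rightarrow> ppair \<Rightarrow> bool" where
  "heavier X Y \<equiv> positive_poly (cross X Y)"

definition good :: "ppair \<Rightarrow> bool" where
  "good X \<longleftrightarrow> positive_poly (fst X) \<and> nonneg_poly (snd X)"

text \<open>A single vertex has second component 0 and is only \<open>good\<close>. Excluding it is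
  what makes the transfer of a branch a strict decrease.\<close>

definition proper :: "ppair \<Rightarrow> bool" where
  "proper X \<longleftrightarrow> positive_poly (fst X) \<and> positive_poly (snd X)"

lemma proper_imp_good: "proper X \<Longrightarrow> good X"
  by (simp add: proper_def good_def positive_poly_imp_nonneg)

lemma good_unit [simp]: "good (1, 0)"
  by (simp add: good_def)

lemma glue_unit [simp]: "glue (1, 0) X = X" "glue X (1, 0) = X"
  by (simp_all add: glue_def)

lemma glue_assoc: "glue (glue X Y) Z = glue X (glue Y Z)"
  by (simp add: glue_def algebra_simps)

lemma glue_commute: "glue X Y = glue Y X"
  by (simp add: glue_def algebra_simps)

lemma glue_left_commute: "glue X (glue Y Z) = glue Y (glue X Z)"
  by (simp add: glue_def algebra_simps)

lemmas glue_ac = glue_assoc glue_commute glue_left_commute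

lemma good_glue: "good X \<Longrightarrow> good Y \<Longrightarrow> good (glue X Y)"
  by (auto simp: good_def glue_def intro!: positive_poly_mult nonneg_poly_add nonneg_poly_mult
      intro: positive_poly_imp_nonneg)

lemma proper_glue1: "proper X \<Longrightarrow> good Y \<Longrightarrow> proper (glue X Y)"
  by (auto simp: good_def proper_def glue_def intro!: positive_poly_mult positive_poly_add2 nonneg_poly_mult
      intro: positive_poly_imp_nonneg)

lemma proper_glue2: "good X \<Longrightarrow> proper Y \<Longrightarrow> proper (glue X Y)"
  using proper_glue1 glue_commute by metis

lemma proper_hang: "good X \<Longrightarrow> proper (hang X)"
  unfolding good_def proper_def hang_def
  by (auto intro!: positive_poly_mult positive_poly_add1 nonneg_poly_mult nonneg_poly_add
      simp: positive_poly_imp_nonneg)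

lemma good_hang: "good X \<Longrightarrow> good (hang X)"
  by (rule proper_imp_good) (rule proper_hang)

text \<open>Both sides count the rooted spanning forests of two rooted graphs joined by an edge.\<close>

lemma tot_glue_hang: "tot (glue X (hang Y)) = tot (glue (hang X) Y)"
  by (simp add: tot_def glue_def hang_def algebra_simps)

lemma tot_glue_hang_pow: "tot (glue X ((hang ^^ d) Y)) = tot (glue ((hang ^^ d) X) Y)"
proof (induction d arbitrary: X)
  case (Suc d)
  show ?case
    using tot_glue_hang[of X "(hang ^^ d) Y"] Suc.IH[of "hang X"]
    by (simp add: funpow_swap1 del: funpow.simps) (simp add: funpow_swap1)
qed simp

lemma cross_hang: "cross (hang X) (hang Y) = tt * tt * cross X Y"
  by (simp add: cross_def hang_def algebra_simps)

lemma cross_glue: "cross (glue X Z) Y = fst Z * cross X Y + fst X * fst Y * snd Z"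
  by (simp add: cross_def glue_def algebra_simps)

lemma cross_unit: "cross X (1, 0) = snd X"
  by (simp add: cross_def)

lemma heavier_hang: "heavier X Y \<Longrightarrow> heavier (hang X) (hang Y)"
  by (simp add: cross_hang positive_poly_mult)

lemma heavier_glue:
  assumes "heavier X Y" "good X" "good Y" "good Z"
  shows "heavier (glue X Z) Y"
  using assms unfolding cross_glue good_def
  by (intro positive_poly_add1 positive_poly_mult nonneg_poly_mult) (auto intro: positive_poly_imp_nonneg)

lemma heavier_glue':
  "heavier X Y \<Longrightarrow> good X \<Longrightarrow> good Y \<Longrightarrow> good Z \<Longrightarrow> heavier (glue Z X) Y"
  using heavier_glue glue_commute by metis

text \<open>
  The form is symmetric in \<open>X\<close> and \<open>Y\<close>, so the effect of moving a branch from one end of the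
  path to the other only depends on the sign of \<open>cross X Y\<close>.
\<close>

lemma path_join_form:
  obtains q r where "nonneg_poly q" "positive_poly r"
    "\<And>X Y. tot (glue X ((hang ^^ Suc d) Y)) =
       (q + r * tt) * fst X * fst Y + q * (fst X * snd Y + snd X * fst Y) + r * snd X * snd Y"
proof -
  have "\<exists>q r. nonneg_poly q \<and> positive_poly r \<and> (\<forall>X Y. tot (glue X ((hang ^^ Suc d) Y)) =
       (q + r * tt) * fst X * fst Y + q * (fst X * snd Y + snd X * fst Y) + r * snd X * snd Y)"
  proof (induction d)
    case 0
    show ?case
      by (rule exI[of _ "1 + tt"], rule exI[of _ 1])
        (simp add: tot_def glue_def hang_def algebra_simps nonneg_poly_add)
  next
    case (Suc d)
    then obtain q r where qr: "nonneg_poly q" "positive_poly r"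
      and eq: "\<And>X Y. tot (glue X ((hang ^^ Suc d) Y)) =
       (q + r * tt) * fst X * fst Y + q * (fst X * snd Y + snd X * fst Y) + r * snd X * snd Y"
      by blast
    have step: "tot (glue X ((hang ^^ Suc (Suc d)) Y)) = tot (glue (hang X) ((hang ^^ Suc d) Y))" for X Y
      using tot_glue_hang[of X "(hang ^^ Suc d) Y"] by simp
    \<comment> \<open>Substituting \<open>hang X\<close> for \<open>X\<close> gives the new
      coefficients \<open>q * (1 + tt) + r * tt\<close> and \<open>q + r * tt\<close>; the
      coefficient of \<open>fst X * fst Y\<close> keeps the form \<open>q + r * tt\<close>.\<close>
    have "\<forall>X Y. tot (glue X ((hang ^^ Suc (Suc d)) Y)) =
       (q * (1 + tt) + r * tt + (q + r * tt) * tt) * fst X * fst Y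
         + (q * (1 + tt) + r * tt) * (fst X * snd Y + snd X * fst Y) + (q + r * tt) * snd X * snd Y"
      unfolding step eq by (simp add: hang_def algebra_simps)
    moreover have "nonneg_poly (q * (1 + tt) + r * tt)" "positive_poly (q + r * tt)"
      using qr by (auto intro!: nonneg_poly_add nonneg_poly_mult positive_poly_add2 positive_poly_mult
          intro: positive_poly_imp_nonneg)
    ultimately show ?case by blast
  qed
  then show thesis using that by blast
qed

lemma move_decreases:
  assumes "heavier Y X" "proper S"
  shows "positive_poly (tot (glue (glue X S) ((hang ^^ Suc d) Y)) - tot (glue X ((hang ^^ Suc d) (glue Y S))))"
proof -
  obtain q r where qr: "nonneg_poly q" "positive_poly r"
    and eq: "\<And>X Y. tot (glue X ((hang ^^ Suc d) Y)) =
       (q + r * tt) * fst X * fst Y + q * (fst X * snd Y + snd X * fst Y) + r * snd X * snd Y"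
    using path_join_form[of d] by metis
  \<comment> \<open>Only the term with \<open>snd X * snd Y\<close> notices at which end
    \<open>S\<close> sits; all terms with \<open>q\<close> or \<open>fst X * fst Y\<close> cancel.
    This is why nothing but the sign of \<open>r\<close> matters.\<close>
  have "tot (glue (glue X S) ((hang ^^ Suc d) Y)) - tot (glue X ((hang ^^ Suc d) (glue Y S)))
    = r * snd S * cross Y X"
    unfolding eq by (simp add: glue_def cross_def algebra_simps)
  then show ?thesis
    using assms qr by (simp add: proper_def positive_poly_mult)
qed

text \<open>The same move with the path read from its other end.\<close>

lemma move_up_decreases:
  assumes "heavier X Y" "proper S"
  shows "positive_poly (tot (glue X ((hang ^^ Suc d) (glue Y S))) - tot (glue (glue X S) ((hang ^^ Suc d) Y)))"
proof -
  have "positive_poly (tot (glue (glue Y S) ((hang ^^ Suc d) X)) - tot (glue Y ((hang ^^ Suc d) (glue X S))))"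
    using move_decreases[OF assms] .
  then show ?thesis
    unfolding tot_glue_hang_pow[of Y] tot_glue_hang_pow[of "glue Y S"] by (simp add: glue_commute)
qed


section \<open>Paths, and the triangle on a stem\<close>

definition path_pair :: "nat \<Rightarrow> ppair" where
  "path_pair b = (hang ^^ b) (1, 0)"

text \<open>The triangle, rooted at one of its vertices.\<close>

definition tri_pair :: ppair where
  "tri_pair = ((1 + tt) * (1 + 3 * tt), 2 * tt * (1 + 3 * tt))"

abbreviation tri_stem :: "nat \<Rightarrow> ppair" where
  "tri_stem s \<equiv> (hang ^^ s) tri_pair"

lemma good_hang_pow: "good X \<Longrightarrow> good ((hang ^^ s) X)"
  by (induction s) (simp_all add: good_hang)

lemma proper_hang_pow: "proper X \<Longrightarrow> proper ((hang ^^ s) X)"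
  by (induction s) (simp_all add: proper_hang proper_imp_good)

lemma path_pair_0 [simp]: "path_pair 0 = (1, 0)"
  by (simp add: path_pair_def)

lemma path_pair_Suc: "path_pair (Suc b) = hang (path_pair b)"
  by (simp add: path_pair_def)

lemma good_path_pair [simp]: "good (path_pair b)"
  by (simp add: path_pair_def good_hang_pow)

lemma proper_path_pair: "b > 0 \<Longrightarrow> proper (path_pair b)"
  by (cases b) (simp_all add: path_pair_Suc proper_hang)

lemma proper_tri_pair [simp]: "proper tri_pair"
  by (auto simp: proper_def tri_pair_def intro!: positive_poly_mult positive_poly_add1 nonneg_poly_mult)

lemma proper_tri_stem [simp]: "proper (tri_stem s)"
  by (simp add: proper_hang_pow)

lemma good_tri_stem [simp]: "good (tri_stem s)"
  by (simp add: proper_imp_good)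

lemma heavier_unit: "proper X \<Longrightarrow> heavier X (path_pair 0)"
  by (simp add: cross_unit proper_def)

lemma tri_heavier_path1: "heavier tri_pair (path_pair 1)"
proof -
  have "cross tri_pair (path_pair 1) = tt * (1 + tt) * (1 + 3 * tt)"
    by (simp add: cross_def tri_pair_def path_pair_Suc hang_def algebra_simps One_nat_def)
  then show ?thesis
    by (auto intro!: positive_poly_mult positive_poly_add1 nonneg_poly_mult)
qed

lemma tri_heavier_path2: "heavier tri_pair (path_pair 2)"
proof -
  have "cross tri_pair (path_pair 2) = tt * (1 + 6 * tt + 9 * tt * tt)"
    by (simp add: cross_def tri_pair_def path_pair_Suc hang_def algebra_simps numeral_2_eq_2)
  then show ?thesis
    by (auto intro!: positive_poly_mult positive_poly_add1 nonneg_poly_mult)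
qed

text \<open>Lengthening stem and path together multiplies \<open>cross\<close> by
  \<open>tt * tt\<close>. So it suffices to treat the bare triangle, where the path has length at
  most 2, and paths of length 0.\<close>

lemma tri_stem_heavier_path:
  "b \<le> s + 2 \<Longrightarrow> heavier (tri_stem s) (path_pair b)"
proof (induction s arbitrary: b)
  case 0
  then have "b = 0 \<or> b = 1 \<or> b = 2" by auto
  then show ?case
    using tri_heavier_path1 tri_heavier_path2 heavier_unit[OF proper_tri_pair] by auto
next
  case (Suc s)
  show ?case
  proof (cases b)
    case 0
    then show ?thesis using heavier_unit[OF proper_tri_stem[of "Suc s"]] by simp
  next
    case (Suc c)
    then show ?thesis
      using Suc.IH[of c] Suc.prems heavier_hang[of "tri_stem s" "path_pair c"]
      by (simp add: path_pair_Suc)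
  qed
qed

section \<open>Rooted trees\<close>

text \<open>\<open>Join T C\<close> hangs the root of \<open>C\<close> below the root of \<open>T\<close>, which is also the root of the whole.\<close>

datatype 'a rtree = Vtx 'a | Join "'a rtree" "'a rtree"

primrec pair_of :: "'a rtree \<Rightarrow> ppair" where
  "pair_of (Vtx v) = (1, 0)"
| "pair_of (Join T C) = glue (pair_of T) (hang (pair_of C))"

primrec nverts :: "'a rtree \<Rightarrow> nat" where
  "nverts (Vtx v) = 1"
| "nverts (Join T C) = nverts T + nverts C"

text \<open>The root is not counted as a leaf.\<close>

primrec nleaves :: "'a rtree \<Rightarrow> nat" where
  "nleaves (Vtx v) = 0"
| "nleaves (Join T C) = nleaves T + max 1 (nleaves C)"

primrec height :: "'a rtree \<Rightarrow> nat" where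
  "height (Vtx v) = 0"
| "height (Join T C) = max (height T) (Suc (height C))"

primrec merge :: "'a rtree \<Rightarrow> 'a rtree \<Rightarrow> 'a rtree" where
  "merge T (Vtx v) = T"
| "merge T (Join S C) = Join (merge T S) C"

abbreviation pt :: "unit rtree" where "pt \<equiv> Vtx ()"

primrec stem :: "nat \<Rightarrow> unit rtree \<Rightarrow> unit rtree" where
  "stem 0 T = T"
| "stem (Suc s) T = Join pt (stem s T)"

lemma unit_rtree_Vtx: "(T :: unit rtree) = pt \<or> (\<exists>S C. T = Join S C)"
  by (cases T) auto

lemma nleaves_eq_0: "nleaves T = 0 \<longleftrightarrow> (\<exists>v. T = Vtx v)"
  by (cases T) auto

lemma nleaves_eq_0_unit [simp]: "nleaves (T :: unit rtree) = 0 \<longleftrightarrow> T = pt"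
  by (auto simp: nleaves_eq_0)

lemma pair_of_merge [simp]: "pair_of (merge T S) = glue (pair_of T) (pair_of S)"
  by (induction S) (simp_all add: glue_assoc)

lemma nleaves_merge [simp]: "nleaves (merge T S) = nleaves T + nleaves S"
  by (induction S) simp_all

lemma merge_eq_Vtx [simp]: "merge T S = pt \<longleftrightarrow> T = pt \<and> S = pt"
  by (cases S) auto

lemma nverts_merge: "Suc (nverts (merge T S)) = nverts T + nverts S"
  by (induction S) simp_all

lemma good_pair_of [simp]: "good (pair_of T)"
  by (induction T) (auto intro: good_glue good_hang)

lemma proper_pair_of: "nleaves T > 0 \<Longrightarrow> proper (pair_of T)"
  by (cases T) (simp_all add: proper_glue2 proper_hang)

lemma proper_pair_of_unit: "(T :: unit rtree) \<noteq> pt \<Longrightarrow> proper (pair_of T)"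
  using proper_pair_of by force

lemma pair_of_stem [simp]: "pair_of (stem s T) = (hang ^^ s) (pair_of T)"
  by (induction s) simp_all

lemma pair_of_path: "pair_of (stem b pt) = path_pair b"
  by (simp add: path_pair_def)

lemma nverts_stem [simp]: "nverts (stem s T) = s + nverts T"
  by (induction s) simp_all

lemma nleaves_stem [simp]: "T \<noteq> pt \<Longrightarrow> nleaves (stem s T) = nleaves T"
  by (induction s) (auto simp: max_def Suc_le_eq)

lemma nleaves_path: "nleaves (stem s pt) = min s 1"
  by (induction s) simp_all

lemma height_path [simp]: "height (stem s pt) = s"
  by (induction s) simp_all

lemma one_leaf_path: "nleaves T \<le> 1 \<Longrightarrow> \<exists>b. T = stem b pt"
proof (induction T)
  case (Vtx v)
  then show ?case by (intro exI[of _ 0]) simp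
next
  case (Join T C)
  from Join.prems have "nleaves T + max 1 (nleaves C) \<le> 1" by (simp only: nleaves.simps)
  then have "nleaves T = 0" "nleaves C \<le> 1" by linarith+
  with Join.IH(2) obtain b where "C = stem b pt" by blast
  moreover have "T = pt" using \<open>nleaves T = 0\<close> by (simp only: nleaves_eq_0_unit)
  ultimately show ?case by (intro exI[of _ "Suc b"]) simp
qed

text \<open>Descends from the root through only children; \<open>U \<noteq> pt\<close> says that the
  vertex reached after \<open>s\<close> steps has a second child.\<close>

lemma branching_decomp:
  "2 \<le> nleaves T \<Longrightarrow> \<exists>s U C. T = stem s (Join U C) \<and> U \<noteq> pt"
proof (induction T)
  case (Join T C)
  show ?case
  proof (cases "T = pt")
    case True
    with Join.prems have "2 \<le> nleaves C" by simp
    with Join.IH(2) obtain s U D where "C = stem s (Join U D)" "U \<noteq> pt" by auto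
    with True show ?thesis by (intro exI[of _ "Suc s"] exI[of _ U] exI[of _ D]) simp
  next
    case False
    then show ?thesis by (intro exI[of _ 0]) auto
  qed
qed simp

text \<open>The child that carries the height may sit anywhere among the nested
  \<open>Join\<close>s. As \<open>glue\<close> ignores the order, the decomposition is stated for
  the pair and not for the tree.\<close>

lemma high_branch:
  fixes T :: "'a rtree"
  shows "Suc k \<le> height T \<Longrightarrow> \<exists>R C. pair_of T = glue (pair_of (R :: 'a rtree)) (hang (pair_of (C :: 'a rtree))) \<and> k \<le> height C"
proof (induction T)
  case (Join T D)
  show ?case
  proof (cases "Suc k \<le> height T")
    case True
    with Join obtain R C where *: "pair_of T = glue (pair_of (R :: 'a rtree)) (hang (pair_of (C :: 'a rtree)))" "k \<le> height C"
      by blast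
    then have "pair_of (Join T D) = glue (pair_of (Join R D)) (hang (pair_of C))"
      by (simp add: glue_ac)
    with * show ?thesis by blast
  next
    case False
    with Join.prems have "k \<le> height D" by auto
    then show ?thesis by (intro exI[of _ T] exI[of _ D]) simp
  qed
qed simp

text \<open>Induction down a longest path: the child on it beats the path shortened by one, and
  whatever else hangs at the root only adds weight.\<close>

lemma height_heavier_path:
  fixes T :: "'a rtree"
  shows "b < height T \<Longrightarrow> heavier (pair_of T) (path_pair b)"
proof (induction b arbitrary: T)
  case 0
  then have "proper (pair_of T)"
    by (cases T) (simp_all add: proper_glue2 proper_hang)
  then show ?case by (rule heavier_unit)
next
  case (Suc b)
  obtain R C where *: "pair_of T = glue (pair_of (R :: 'a rtree)) (hang (pair_of (C :: 'a rtree)))" "Suc b \<le> height C"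
    using high_branch[of "Suc b" T] Suc.prems by auto
  then have "heavier (hang (pair_of C)) (path_pair (Suc b))"
    using Suc.IH[of C] by (auto simp: path_pair_Suc intro!: heavier_hang)
  then show ?case
    unfolding * by (intro heavier_glue') (auto intro: good_hang)
qed

lemma path_heavier_path: "b < c \<Longrightarrow> heavier (path_pair c) (path_pair b)"
  using height_heavier_path[of b "stem c pt"] unfolding pair_of_path by simp

text \<open>Base case of the next comparison. A path of length 2 is lighter than the triangle, but
  one more pendant edge at its root reverses this; accordingly \<open>D\<close> may be a single
  vertex while \<open>C\<close> has an edge at its root.\<close>

lemma two_branches_heavier_tri:
  assumes C: "good C" and D: "good D" and pos: "positive_poly (snd C)"
  shows "heavier (glue (hang C) (hang D)) tri_pair"
proof -
  define a b c d where "a = fst C" "b = snd C" "c = fst D" "d = snd D"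
  have "cross (glue (hang C) (hang D)) tri_pair =
    (1 + 3 * tt) * tt * tt * (b * ((1 + tt) * c + d) + d * ((1 + tt) * a + b))"
    by (simp add: cross_def glue_def hang_def tri_pair_def a_b_c_d_def algebra_simps)
  moreover have "positive_poly (b * ((1 + tt) * c + d) + d * ((1 + tt) * a + b))"
    using assms unfolding a_b_c_d_def good_def
    by (intro positive_poly_add1 positive_poly_mult nonneg_poly_mult nonneg_poly_add)
      (auto simp: positive_poly_imp_nonneg intro: nonneg_poly_mult nonneg_poly_add)
  ultimately show ?thesis
    by (auto intro!: positive_poly_mult positive_poly_add1 nonneg_poly_mult)
qed

text \<open>Complements \<open>tri_stem_heavier_path\<close>: a path of length \<open>s + 2\<close>
  alone is lighter than the stem with the triangle, and any second branch \<open>Z\<close> tips the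
  balance.\<close>

lemma branch_heavier_tri_stem:
  fixes C Z :: "unit rtree"
  shows "s + 2 \<le> height C \<Longrightarrow> Z \<noteq> pt \<Longrightarrow> heavier (glue (pair_of C) (pair_of Z)) (tri_stem s)"
proof (induction s arbitrary: C Z)
  case 0
  obtain R D where C: "pair_of C = glue (pair_of (R :: unit rtree)) (hang (pair_of (D :: unit rtree)))" "1 \<le> height D"
    using high_branch[of 1 C] 0 by auto
  obtain Q E where Z: "Z = Join Q E"
    using 0 unit_rtree_Vtx by blast
  have "D \<noteq> pt" using C(2) by auto
  then have "positive_poly (snd (pair_of D))"
    using proper_pair_of_unit by (auto simp: proper_def)
  then have "heavier (glue (hang (pair_of D)) (hang (pair_of E))) tri_pair"
    by (intro two_branches_heavier_tri) auto
  then have "heavier (glue (glue (hang (pair_of D)) (hang (pair_of E))) (glue (pair_of R) (pair_of Q))) tri_pair"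
    by (rule heavier_glue) (auto intro!: good_glue good_hang simp: proper_imp_good)
  then show ?case by (simp add: C Z glue_ac)
next
  case (Suc s)
  obtain R D where C: "pair_of C = glue (pair_of (R :: unit rtree)) (hang (pair_of (D :: unit rtree)))" "s + 2 \<le> height D"
    using high_branch[of "s + 2" C] Suc.prems by auto
  define Y where "Y = pair_of (merge R Z)"
  define T where "T = tri_stem s"
  have "merge R Z \<noteq> pt"
    using Suc.prems by simp
  then have IH: "heavier (glue (pair_of D) Y) T" and Y: "proper Y"
    unfolding Y_def T_def using Suc.IH C(2) proper_pair_of_unit by blast+
  \<comment> \<open>\<open>f X\<close> is the first component of \<open>hang X\<close>.\<close>
  define f where "f = (\<lambda>X :: ppair. (1 + tt) * fst X + snd X)"
  have fD: "f X * f T - tt * tt * fst X * fst T =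
      (1 + 2 * tt) * fst X * fst T + (1 + tt) * (fst X * snd T + snd X * fst T) + snd X * snd T" for X
    by (simp add: f_def algebra_simps)
  \<comment> \<open>Compares with the tree in which the extra branch \<open>Y\<close> is pushed down
    to the root of \<open>D\<close>. The induction hypothesis covers that tree, and having
    \<open>Y\<close> one level higher adds a nonnegative polynomial.\<close>
  have "cross (glue (hang (pair_of D)) Y) (hang T) =
      snd Y * (f (pair_of D) * f T - tt * tt * fst (pair_of D) * fst T) + tt * tt * cross (glue (pair_of D) Y) T"
    by (simp add: cross_def glue_def hang_def f_def algebra_simps)
  moreover have "nonneg_poly (snd Y * (f (pair_of D) * f T - tt * tt * fst (pair_of D) * fst T))"
    unfolding fD using Y good_pair_of[of D] good_tri_stem[of s]
    by (auto simp: T_def good_def proper_def positive_poly_imp_nonneg intro!: nonneg_poly_mult nonneg_poly_add)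
  ultimately have "heavier (glue (hang (pair_of D)) Y) (hang T)"
    using IH by (auto intro!: positive_poly_add2 positive_poly_mult)
  then show ?case
    by (simp add: C T_def Y_def glue_ac)
qed

section \<open>Improving a tree that is not a balanced spider\<close>

text \<open>
  Walking down a branching tree \<open>C\<close> from a vertex above it that is heavier than every path that
  fits into \<open>C\<close>, one meets a vertex with a pendant path, and moves its other branches up one step.
\<close>

lemma lift_branch:
  assumes "2 \<le> nleaves C" "good X" "\<And>b. b \<le> k \<Longrightarrow> heavier X (path_pair b)" "height C \<le> k"
  shows "\<exists>Z. nverts Z = Suc (nverts C) \<and> nleaves Z = nleaves C \<and>
     positive_poly (tot (glue X (hang (pair_of (C :: unit rtree)))) - tot (glue X (pair_of (Z :: unit rtree))))"
  using assms
proof (induction C arbitrary: X k)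
  case (Join D E)
  have hX: "heavier (hang X) (path_pair b)" if "b \<le> Suc k" for b
  proof (cases b)
    case 0
    then show ?thesis using Join.prems heavier_unit[OF proper_hang[of X]] by simp
  next
    case (Suc c)
    then show ?thesis using Join.prems(3)[of c] that by (simp add: path_pair_Suc heavier_hang)
  qed
  consider "D \<noteq> pt" "nleaves E \<le> 1" | "2 \<le> nleaves E"
    using Join.prems(1) by (cases "D = pt"; cases "nleaves E \<le> 1") auto
  then show ?case
  proof cases
    case 1
    then obtain b where E: "E = stem b pt" using one_leaf_path by blast
    have "heavier X (path_pair (Suc b))"
      using Join.prems(3)[of "Suc b"] Join.prems(4) E by simp
    then have "heavier X (hang (pair_of E))"
      by (simp add: E path_pair_def)
    \<comment> \<open>The pendant path stays and the whole of \<open>D\<close> moves up. The new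
      tree takes the place of \<open>hang\<close> of the old one, whence its additional
      vertex.\<close>
    from move_up_decreases[OF this proper_pair_of_unit[OF 1(1)], of 0] show ?thesis
      using 1 by (intro exI[of _ "Join D (Join pt E)"]) (auto simp: glue_ac)
  next
    case 2
    \<comment> \<open>Everything except \<open>E\<close>, seen from the root of
      \<open>Join D E\<close>. It is again heavier than all paths up to length \<open>k\<close>, so
      the descent can continue into \<open>E\<close>.\<close>
    define Y where "Y = glue (hang X) (pair_of D)"
    have Y: "height E \<le> k" "good Y"
      using Join.prems by (auto simp: Y_def good_glue good_hang)
    have hY: "heavier Y (path_pair b)" if "b \<le> k" for b
      unfolding Y_def using hX[of b] that Join.prems(2)
      by (simp add: heavier_glue good_hang)
    have "\<exists>Z. nverts Z = Suc (nverts E) \<and> nleaves Z = nleaves E \<and>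
      positive_poly (tot (glue Y (hang (pair_of E))) - tot (glue Y (pair_of (Z :: unit rtree))))"
      by (rule Join.IH(2)[OF 2 Y(2) _ Y(1)]) (rule hY)
    then obtain Z :: "unit rtree" where Z: "nverts Z = Suc (nverts E)" "nleaves Z = nleaves E"
      "positive_poly (tot (glue Y (hang (pair_of E))) - tot (glue Y (pair_of Z)))"
      by blast
    have "tot (glue X (hang (pair_of (Join D E)))) = tot (glue Y (hang (pair_of E)))"
      "tot (glue X (pair_of (Join pt (merge D Z)))) = tot (glue Y (pair_of Z))"
      unfolding Y_def by (simp_all only: pair_of.simps pair_of_merge glue_unit tot_glue_hang[of X] glue_assoc)
    with Z 2 show ?thesis
      by (intro exI[of _ "Join pt (merge D Z)"]) (use nverts_merge[of D Z] in auto)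
  qed
qed simp

text \<open>The subtraction would turn a leg of length 0 into one of length 1, whence the recurring
  hypothesis \<open>0 \<notin> set bs\<close>.\<close>

definition legs :: "nat list \<Rightarrow> unit rtree" where
  "legs bs = foldl (\<lambda>T b. Join T (stem (b - 1) pt)) pt bs"

lemma legs_Nil [simp]: "legs [] = pt"
  by (simp add: legs_def)

lemma legs_snoc: "legs (bs @ [b]) = Join (legs bs) (stem (b - 1) pt)"
  by (simp add: legs_def)

definition legs_pair :: "nat list \<Rightarrow> ppair" where
  "legs_pair bs = foldr (\<lambda>b. glue (path_pair b)) bs (1, 0)"

lemma legs_pair_Nil [simp]: "legs_pair [] = (1, 0)"
  and legs_pair_Cons [simp]: "legs_pair (b # bs) = glue (path_pair b) (legs_pair bs)"
  by (simp_all add: legs_pair_def)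

lemma legs_pair_append: "legs_pair (as @ bs) = glue (legs_pair as) (legs_pair bs)"
  by (induction as) (simp_all add: glue_assoc)

lemma pair_of_legs: "0 \<notin> set bs \<Longrightarrow> pair_of (legs bs) = legs_pair bs"
proof (induction bs rule: rev_induct)
  case (snoc b bs)
  then obtain c where "b = Suc c" by (cases b) auto
  with snoc show ?case
    by (simp add: legs_snoc legs_pair_append path_pair_Suc pair_of_path[symmetric])
qed simp

lemma nverts_legs: "0 \<notin> set bs \<Longrightarrow> nverts (legs bs) = Suc (sum_list bs)"
  by (induction bs rule: rev_induct) (auto simp: legs_snoc)

lemma nleaves_legs: "nleaves (legs bs) = length bs"
  by (induction bs rule: rev_induct) (auto simp: legs_snoc nleaves_path)

lemma good_legs_pair [simp]: "good (legs_pair bs)"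
  by (induction bs) (auto intro: good_glue)

lemma proper_legs_pair: "bs \<noteq> [] \<Longrightarrow> 0 \<notin> set bs \<Longrightarrow> proper (legs_pair bs)"
  by (cases bs) (auto intro!: proper_glue1 proper_path_pair)

lemma legs_pair_remove1:
  "b \<in> set bs \<Longrightarrow> legs_pair bs = glue (path_pair b) (legs_pair (remove1 b bs))"
  by (induction bs) (auto simp: glue_left_commute)

text \<open>A branching child of the root is brought to the last position. This changes the term, so
  only pair, order and number of leaves are preserved; the final conjunct retains that the root has
  another child.\<close>

lemma legs_or_branching:
  fixes T :: "unit rtree"
  shows "(\<exists>bs. 0 \<notin> set bs \<and> T = legs bs) \<or>
   (\<exists>R C :: unit rtree. pair_of T = pair_of (Join R C) \<and> nverts T = nverts (Join R C)
       \<and> nleaves T = nleaves (Join R C) \<and> 2 \<le> nleaves C \<and> (\<forall>R' C'. T = Join R' C' \<longrightarrow> R' \<noteq> pt \<longrightarrow> R \<noteq> pt))"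
proof (induction T)
  case (Vtx v)
  have "0 \<notin> set [] \<and> Vtx v = legs []" by simp
  then show ?case by blast
next
  case (Join T C)
  show ?case
  proof (cases "2 \<le> nleaves C")
    case True
    then show ?thesis by (intro disjI2 exI[of _ T] exI[of _ C]) auto
  next
    case False
    then obtain b where b: "C = stem b pt" using one_leaf_path[of C] by auto
    from Join.IH(1) show ?thesis
    proof
      assume "\<exists>bs. 0 \<notin> set bs \<and> T = legs bs"
      then obtain bs where "0 \<notin> set bs" "T = legs bs" by blast
      then have "0 \<notin> set (bs @ [Suc b]) \<and> Join T C = legs (bs @ [Suc b])"
        using b by (simp add: legs_snoc)
      then show ?thesis by blast
    next
      assume "\<exists>R C :: unit rtree. pair_of T = pair_of (Join R C) \<and> nverts T = nverts (Join R C)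
       \<and> nleaves T = nleaves (Join R C) \<and> 2 \<le> nleaves C \<and> (\<forall>R' C'. T = Join R' C' \<longrightarrow> R' \<noteq> pt \<longrightarrow> R \<noteq> pt)"
      then obtain R D :: "unit rtree" where "pair_of T = pair_of (Join R D)" "nverts T = nverts (Join R D)"
        "nleaves T = nleaves (Join R D)" "2 \<le> nleaves D" by blast
      then show ?thesis
        by (intro disjI2 exI[of _ "Join R C"] exI[of _ D]) (auto simp: glue_ac)
    qed
  qed
qed

text \<open>\<open>Y\<close> is the tree at the next branching vertex, \<open>d + 1\<close> steps
  below the one that carries \<open>U\<close>. If \<open>Y\<close> has height at least
  \<open>s + 2\<close>, it is heavier than the triangle on its stem and \<open>U\<close> moves down
  to it. Otherwise all that lies above \<open>Y\<close> is heavier than every path fitting into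
  \<open>Y\<close>, and \<open>lift_branch\<close> moves something up.\<close>

lemma branching_improvable:
  fixes U C :: "unit rtree"
  assumes U: "U \<noteq> pt" and C: "2 \<le> nleaves C"
  shows "\<exists>T. nverts T = nverts (stem s (Join U C)) \<and> nleaves T = nleaves (stem s (Join U C)) \<and>
    positive_poly (tot (glue tri_pair (pair_of (stem s (Join U C)))) - tot (glue tri_pair (pair_of (T :: unit rtree))))"
proof -
  obtain d Y0 E where C_eq: "C = stem d (Join Y0 E)" and Y0: "Y0 \<noteq> pt"
    using branching_decomp[OF C] by blast
  define Y where "Y = Join Y0 E"
  have nY: "nleaves Y = nleaves C" by (simp add: C_eq Y_def)
  have tot0: "tot (glue tri_pair (pair_of (stem s (Join U C)))) =
      tot (glue (glue (tri_stem s) (pair_of U)) ((hang ^^ Suc d) (pair_of Y)))"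
    by (simp add: C_eq Y_def tot_glue_hang_pow glue_assoc)
  show ?thesis
  proof (cases "s + 2 \<le> height Y")
    case True
    have "heavier (pair_of Y) (tri_stem s)"
    \<comment> \<open>The height is attained in \<open>Y0\<close> or in the child \<open>E\<close>;
      the other of the two serves as the second branch.\<close>
    proof (cases "s + 2 \<le> height Y0")
      case True
      from branch_heavier_tri_stem[OF this, of "Join pt E"] show ?thesis
        by (simp add: Y_def)
    next
      case False
      with True have "s + 2 \<le> height (Join pt E)" by (auto simp: Y_def)
      from branch_heavier_tri_stem[OF this Y0] show ?thesis
        by (simp add: Y_def glue_commute)
    qed
    from move_decreases[OF this proper_pair_of_unit[OF U], of d]
    have "positive_poly (tot (glue tri_pair (pair_of (stem s (Join U C)))) -
      tot (glue (tri_stem s) ((hang ^^ Suc d) (pair_of (merge Y U)))))"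
      unfolding tot0 pair_of_merge .
    then have "positive_poly (tot (glue tri_pair (pair_of (stem s (Join U C)))) -
      tot (glue tri_pair (pair_of (stem s (stem (Suc d) (merge Y U))))))"
      by (simp add: tot_glue_hang_pow)
    moreover have "merge Y U \<noteq> pt"
      using U by simp
    ultimately show ?thesis
      using nverts_merge[of Y U] nY C
      by (intro exI[of _ "stem s (stem (Suc d) (merge Y U))"]) (auto simp: C_eq Y_def)
  next
    case False
    define X where "X = (hang ^^ d) (glue (tri_stem s) (pair_of U))"
    have "good X" unfolding X_def by (rule good_hang_pow, rule good_glue) simp_all
    \<comment> \<open>Length \<open>s + 2\<close> is what the triangle on its stem can beat; each of
      the \<open>d\<close> vertices on the way down to \<open>Y\<close> allows one more.\<close>
    have hX: "heavier X (path_pair b)" if "b \<le> s + 2 + d" for b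
      unfolding X_def using that
    proof (induction d arbitrary: b)
      case 0
      then have "heavier (tri_stem s) (path_pair b)" by (intro tri_stem_heavier_path) simp
      then show ?case by (simp add: heavier_glue)
    next
      case (Suc d)
      show ?case
      proof (cases b)
        case 0
        have "proper ((hang ^^ Suc d) (glue (tri_stem s) (pair_of U)))"
          by (rule proper_hang_pow, rule proper_glue1) simp_all
        then show ?thesis unfolding 0 by (rule heavier_unit)
      next
        case (Suc c)
        with Suc.IH[of c] Suc.prems show ?thesis
          by (simp add: path_pair_Suc heavier_hang)
      qed
    qed
    have Y2: "2 \<le> nleaves Y" "height Y \<le> s + 2 + d" using nY C False by auto
    have "\<exists>Z. nverts Z = Suc (nverts Y) \<and> nleaves Z = nleaves Y \<and>
      positive_poly (tot (glue X (hang (pair_of Y))) - tot (glue X (pair_of (Z :: unit rtree))))"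
      by (rule lift_branch[OF Y2(1) \<open>good X\<close> _ Y2(2)]) (rule hX)
    then obtain Z :: "unit rtree" where Z: "nverts Z = Suc (nverts Y)" "nleaves Z = nleaves Y"
      "positive_poly (tot (glue X (hang (pair_of Y))) - tot (glue X (pair_of Z)))"
      by blast
    have Zne: "Z \<noteq> pt" using Z(2) nY C by auto
    have "merge U (stem d Z) \<noteq> pt"
      using U by simp
    moreover have "tot (glue X (hang (pair_of Y))) = tot (glue tri_pair (pair_of (stem s (Join U C))))"
      unfolding tot0 X_def funpow_Suc_right o_apply by (rule tot_glue_hang_pow[symmetric])
    moreover have "tot (glue X (pair_of Z)) = tot (glue tri_pair (pair_of (stem s (merge U (stem d Z)))))"
      unfolding X_def tot_glue_hang_pow[symmetric, where X = "glue (tri_stem s) (pair_of U)"]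
      by (simp add: tot_glue_hang_pow[where X = tri_pair] glue_assoc)
    ultimately show ?thesis
      using Z nY C Zne nverts_merge[of U "stem d Z"]
      by (intro exI[of _ "stem s (merge U (stem d Z))"]) (auto simp: C_eq Y_def)
  qed
qed

text \<open>The stem and all other legs form one branch, which moves by one vertex towards the
  longer of the two legs. The lengths \<open>b\<close> and \<open>c\<close> become
  \<open>b + 1\<close> and \<open>c - 1\<close>.\<close>

lemma leg_lengths_improvable:
  assumes bs: "0 \<notin> set bs" and b: "b \<in> set bs" "c \<in> set bs" "b + 2 \<le> c"
  shows "\<exists>bs'. 0 \<notin> set bs' \<and> length bs' = length bs \<and> sum_list bs' = sum_list bs \<and>
    positive_poly (tot (glue (tri_stem s) (legs_pair bs)) - tot (glue (tri_stem s) (legs_pair bs')))"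
proof -
  define rs where "rs = remove1 b (remove1 c bs)"
  have b': "b \<in> set (remove1 c bs)" using b by auto
  define S where "S = glue (tri_stem s) (legs_pair rs)"
  have eq: "legs_pair bs = glue (path_pair c) (glue (path_pair b) (legs_pair rs))"
    unfolding rs_def using legs_pair_remove1[OF b(2)] legs_pair_remove1[OF b'] by simp
  have "0 < c - 1" "b < c - 1" using b by auto
  obtain e where e: "c = Suc e" "b < e" using b by (cases c) auto
  have "proper S" unfolding S_def by (rule proper_glue1) simp_all
  from move_decreases[OF path_heavier_path[OF e(2)] this, of 0]
  have "positive_poly (tot (glue (tri_stem s) (legs_pair bs))
    - tot (glue (tri_stem s) (legs_pair (Suc b # e # rs))))"
    by (simp add: tot_glue_hang eq S_def e path_pair_Suc glue_ac)
  moreover have "sum_list (remove1 c bs) + c = sum_list bs" "sum_list rs + b = sum_list (remove1 c bs)"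
    unfolding rs_def using sum_list_map_remove1[OF b(2), of id] sum_list_map_remove1[OF b', of id] by simp_all
  moreover have "length rs + 2 = length bs"
    unfolding rs_def using b b' length_pos_if_in_set[OF b(2)] length_pos_if_in_set[OF b']
    by (simp add: length_remove1)
  moreover have "0 \<notin> set rs" unfolding rs_def using bs notin_set_remove1 by metis
  ultimately show ?thesis
    using e by (intro exI[of _ "Suc b # e # rs"]) auto
qed

text \<open>All legs except \<open>b\<close> move one vertex towards the triangle, so the stem loses
  a vertex and the leg \<open>b\<close> gains it. With at least two legs this branch is
  nontrivial.\<close>

lemma short_leg_improvable:
  assumes bs: "0 \<notin> set bs" "2 \<le> length bs" and b: "b \<in> set bs" "b \<le> s + 2"
  shows "\<exists>bs'. 0 \<notin> set bs' \<and> length bs' = length bs \<and> sum_list bs' = Suc (sum_list bs) \<and>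
    positive_poly (tot (glue (tri_stem (Suc s)) (legs_pair bs)) - tot (glue (tri_stem s) (legs_pair bs')))"
proof -
  define rs where "rs = remove1 b bs"
  have len: "length rs + 1 = length bs" unfolding rs_def using b length_pos_if_in_set[OF b(1)] by (simp add: length_remove1)
  have rs: "rs \<noteq> []" using len bs by auto
  have "0 \<notin> set rs" unfolding rs_def using bs notin_set_remove1 by metis
  with rs have "proper (legs_pair rs)" by (intro proper_legs_pair)
  from move_decreases[OF tri_stem_heavier_path[OF b(2)] this, of 0]
  have "positive_poly (tot (glue (tri_stem (Suc s)) (legs_pair bs)) - tot (glue (tri_stem s) (legs_pair (Suc b # rs))))"
    unfolding rs_def legs_pair_remove1[OF b(1)] by (simp add: tot_glue_hang path_pair_Suc glue_ac)
  moreover have "sum_list rs + b = sum_list bs"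
    unfolding rs_def using sum_list_map_remove1[OF b(1), of id] by simp
  ultimately show ?thesis
    using len \<open>0 \<notin> set rs\<close> by (intro exI[of _ "Suc b # rs"]) auto
qed

text \<open>A triangle with rooted graphs \<open>X\<close>, \<open>Y\<close>, \<open>Z\<close> glued to its corners.\<close>

definition tri_total :: "ppair \<Rightarrow> ppair \<Rightarrow> ppair \<Rightarrow> real poly" where
  "tri_total X Y Z = tot X * tot Y * tot Z
     + 2 * tt * (tot X * tot Y * fst Z + tot X * fst Y * tot Z + fst X * tot Y * tot Z)
     + 3 * tt * tt * (tot X * fst Y * fst Z + fst X * tot Y * fst Z + fst X * fst Y * tot Z)"

lemma tri_total_rotate: "tri_total X Y Z = tri_total Y Z X"
  by (simp add: tri_total_def algebra_simps)

lemma tri_total_unit: "tri_total X (1, 0) (1, 0) = tot (glue tri_pair X)"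
  by (simp add: tri_total_def tot_def glue_def tri_pair_def algebra_simps)

text \<open>In contrast to a move along a path, no comparison of weights is required: the difference
  is \<open>snd X * snd Y\<close> times a positive polynomial, whatever hangs at the third
  corner.\<close>

lemma tri_total_merge:
  assumes "proper X" "proper Y" "good Z"
  shows "positive_poly (tri_total X Y Z - tri_total (glue X Y) (1, 0) Z)"
proof -
  have "tri_total X Y Z - tri_total (glue X Y) (1, 0) Z = snd X * snd Y * (fst Z + (snd Z + 2 * tt * fst Z))"
    by (simp add: tri_total_def tot_def glue_def algebra_simps)
  moreover have "positive_poly (snd X * snd Y * (fst Z + (snd Z + 2 * tt * fst Z)))"
    using assms unfolding proper_def good_def
    by (auto intro!: positive_poly_mult positive_poly_add1 nonneg_poly_add nonneg_poly_mult
        simp: positive_poly_imp_nonneg)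
  ultimately show ?thesis by simp
qed

section \<open>Improving a triple of trees at the corners of a triangle\<close>

definition better :: "unit rtree \<Rightarrow> unit rtree \<Rightarrow> unit rtree \<Rightarrow> unit rtree \<Rightarrow> unit rtree \<Rightarrow> unit rtree \<Rightarrow> bool" where
  "better R1 R2 R3 T1 T2 T3 \<longleftrightarrow>
     nverts R1 + nverts R2 + nverts R3 = nverts T1 + nverts T2 + nverts T3 \<and>
     nleaves R1 + nleaves R2 + nleaves R3 = nleaves T1 + nleaves T2 + nleaves T3 \<and>
     positive_poly (tri_total (pair_of T1) (pair_of T2) (pair_of T3)
       - tri_total (pair_of R1) (pair_of R2) (pair_of R3))"

lemma better_rotate: "better R1 R2 R3 T2 T3 T1 \<Longrightarrow> better R1 R2 R3 T1 T2 T3"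
  unfolding better_def using tri_total_rotate[of "pair_of T1" "pair_of T2" "pair_of T3"] by auto

text \<open>What remains when neither \<open>leg_lengths_improvable\<close> nor
  \<open>short_leg_improvable\<close> applies. The latter shortens a stem of length
  \<open>s = r + 1\<close> as soon as a leg is at most \<open>r + 2\<close>, that is,
  \<open>s + 1\<close>.\<close>

definition optimal_spider :: "nat \<Rightarrow> nat list \<Rightarrow> bool" where
  "optimal_spider s bs \<longleftrightarrow> 0 \<notin> set bs \<and> (\<forall>b\<in>set bs. \<forall>c\<in>set bs. c \<le> b + 1) \<and>
     (s = 0 \<or> (\<forall>b\<in>set bs. s + 2 \<le> b))"

lemma improvable_or_spider1:
  assumes "2 \<le> nleaves T"
  shows "(\<exists>R1 R2 R3. better R1 R2 R3 T pt pt) \<or> (\<exists>s bs. T = stem s (legs bs) \<and> optimal_spider s bs)"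
proof -
  obtain s U0 C0 where T: "T = stem s (Join U0 C0)" "U0 \<noteq> pt"
    using branching_decomp[OF assms] by blast
  from legs_or_branching[of "Join U0 C0"] show ?thesis
  proof
    assume "\<exists>R C :: unit rtree. pair_of (Join U0 C0) = pair_of (Join R C) \<and> nverts (Join U0 C0) = nverts (Join R C)
       \<and> nleaves (Join U0 C0) = nleaves (Join R C) \<and> 2 \<le> nleaves C
       \<and> (\<forall>R' C'. Join U0 C0 = Join R' C' \<longrightarrow> R' \<noteq> pt \<longrightarrow> R \<noteq> pt)"
    then obtain R C :: "unit rtree" where RC: "pair_of (Join U0 C0) = pair_of (Join R C)"
      "nverts (Join U0 C0) = nverts (Join R C)" "nleaves (Join U0 C0) = nleaves (Join R C)"
      "2 \<le> nleaves C" "R \<noteq> pt"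
      using T(2) by blast
    from branching_improvable[OF RC(5,4), of s] obtain S :: "unit rtree" where
      S: "nverts S = nverts (stem s (Join R C))" "nleaves S = nleaves (stem s (Join R C))"
      "positive_poly (tot (glue tri_pair (pair_of (stem s (Join R C)))) - tot (glue tri_pair (pair_of S)))"
      by blast
    have "better S pt pt T pt pt"
      using S RC(1-3) unfolding better_def T by (simp add: tri_total_unit)
    then show ?thesis by blast
  next
    assume "\<exists>bs. 0 \<notin> set bs \<and> Join U0 C0 = legs bs"
    then obtain bs where bs: "0 \<notin> set bs" "Join U0 C0 = legs bs" by blast
    have ne: "legs bs \<noteq> pt" using bs(2)[symmetric] by simp
    have T_eq: "T = stem s (legs bs)" using T bs by simp
    have len: "2 \<le> length bs" using assms ne by (simp add: T_eq nleaves_legs)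
    have betterI: "better (stem r (legs cs)) pt pt T pt pt"
      if "0 \<notin> set cs" "length cs = length bs" "r + sum_list cs = s + sum_list bs"
        "positive_poly (tot (glue (tri_stem s) (legs_pair bs)) - tot (glue (tri_stem r) (legs_pair cs)))" for r cs
    proof -
      have "legs cs \<noteq> pt" using that(2) len nleaves_legs[of cs] by (metis nleaves_eq_0_unit not_numeral_le_zero)
      then show ?thesis
        using that bs(1) ne unfolding better_def T_eq
        by (simp add: tri_total_unit nverts_legs nleaves_legs pair_of_legs tot_glue_hang_pow)
    qed
    show ?thesis
    proof (cases "optimal_spider s bs")
      case True
      then show ?thesis using T_eq by blast
    next
      case False
      then consider b c where "b \<in> set bs" "c \<in> set bs" "b + 2 \<le> c"
        | b where "s \<noteq> 0" "b \<in> set bs" "b < s + 2"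
        using bs(1) unfolding optimal_spider_def by (metis not_less Suc_eq_plus1 add_2_eq_Suc' not_less_eq_eq)
      then show ?thesis
      proof cases
        case 1
        from leg_lengths_improvable[OF bs(1) this, of s] obtain cs where
          "0 \<notin> set cs" "length cs = length bs" "sum_list cs = sum_list bs"
          "positive_poly (tot (glue (tri_stem s) (legs_pair bs)) - tot (glue (tri_stem s) (legs_pair cs)))"
          by blast
        then have "better (stem s (legs cs)) pt pt T pt pt" by (intro betterI) simp_all
        then show ?thesis by blast
      next
        case 2
        then obtain r where r: "s = Suc r" "b \<le> r + 2" by (cases s) auto
        from short_leg_improvable[OF bs(1) len 2(2) r(2)] obtain cs where
          "0 \<notin> set cs" "length cs = length bs" "sum_list cs = Suc (sum_list bs)"
          "positive_poly (tot (glue (tri_stem s) (legs_pair bs)) - tot (glue (tri_stem r) (legs_pair cs)))"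
          unfolding r(1) by blast
        then have "better (stem r (legs cs)) pt pt T pt pt" by (intro betterI) (simp_all add: r(1))
        then show ?thesis by blast
      qed
    qed
  qed
qed

lemma improvable_or_spider:
  assumes "2 \<le> nleaves T1 + nleaves T2 + nleaves T3"
  shows "(\<exists>R1 R2 R3. better R1 R2 R3 T1 T2 T3) \<or>
    (\<exists>s bs. (T1, T2, T3) \<in> {(stem s (legs bs), pt, pt), (pt, stem s (legs bs), pt), (pt, pt, stem s (legs bs))}
       \<and> optimal_spider s bs)"
proof -
  have two: "\<exists>R1 R2 R3. better R1 R2 R3 T1 T2 T3" if "T1 \<noteq> pt" "T2 \<noteq> pt" for T1 T2 T3
  proof -
    from tri_total_merge[OF proper_pair_of_unit[OF that(1)] proper_pair_of_unit[OF that(2)] good_pair_of[of T3]]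
    have "better (merge T1 T2) pt T3 T1 T2 T3"
      using nverts_merge[of T1 T2] by (simp add: better_def)
    then show ?thesis by blast
  qed
  consider "T1 \<noteq> pt" "T2 \<noteq> pt" | "T2 \<noteq> pt" "T3 \<noteq> pt" | "T3 \<noteq> pt" "T1 \<noteq> pt"
    | "T2 = pt" "T3 = pt" | "T1 = pt" "T3 = pt" | "T1 = pt" "T2 = pt" by blast
  then show ?thesis
  proof cases
    case 1
    then show ?thesis using two by blast
  next
    case 2
    from two[OF this, of T1] obtain R1 R2 R3 where "better R1 R2 R3 T2 T3 T1" by blast
    then have "better R1 R2 R3 T1 T2 T3" by (rule better_rotate)
    then show ?thesis by blast
  next
    case 3
    from two[OF this, of T2] obtain R1 R2 R3 where "better R1 R2 R3 T3 T1 T2" by blast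
    then have "better R1 R2 R3 T1 T2 T3" by (rule better_rotate[OF better_rotate])
    then show ?thesis by blast
  next
    case 4
    then show ?thesis using improvable_or_spider1[of T1] assms by auto
  next
    case 5
    then have "2 \<le> nleaves T2" using assms by simp
    from improvable_or_spider1[OF this] show ?thesis
    proof
      assume "\<exists>R1 R2 R3. better R1 R2 R3 T2 pt pt"
      then obtain R1 R2 R3 where "better R1 R2 R3 T2 T3 T1" using 5 by blast
      then have "better R1 R2 R3 T1 T2 T3" by (rule better_rotate)
      then show ?thesis by blast
    qed (use 5 in blast)
  next
    case 6
    then have "2 \<le> nleaves T3" using assms by simp
    from improvable_or_spider1[OF this] show ?thesis
    proof
      assume "\<exists>R1 R2 R3. better R1 R2 R3 T3 pt pt"
      then obtain R1 R2 R3 where "better R1 R2 R3 T3 T1 T2" using 6 by blast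
      then have "better R1 R2 R3 T1 T2 T3" by (rule better_rotate[OF better_rotate])
      then show ?thesis by blast
    qed (use 6 in blast)
  qed
qed

section \<open>The Laplacian determinant\<close>

text \<open>Indexed by an arbitrary set of vertices, so that deleting a vertex requires no
  renumbering.\<close>

definition det_on :: "nat set \<Rightarrow> (nat \<Rightarrow> nat \<Rightarrow> real) \<Rightarrow> real" where
  "det_on V M = (\<Sum>p | p permutes V. of_int (sign p) * (\<Prod>i\<in>V. M i (p i)))"

definition shift_diag :: "(nat \<Rightarrow> nat \<Rightarrow> real) \<Rightarrow> nat \<Rightarrow> real \<Rightarrow> nat \<Rightarrow> nat \<Rightarrow> real" where
  "shift_diag M u c i j = M i j + (if i = u \<and> j = u then c else 0)"

lemma det_on_cong:
  assumes "\<And>i j. i \<in> V \<Longrightarrow> j \<in> V \<Longrightarrow> M i j = N i j"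
  shows "det_on V M = det_on V N"
  unfolding det_on_def
  by (intro sum.cong refl arg_cong2[of _ _ _ _ "(*)"] prod.cong) (auto simp: assms permutes_in_image)

lemma det_on_insert:
  assumes "finite S" "w \<notin> S"
  shows "det_on (insert w S) M = (\<Sum>b\<in>insert w S. \<Sum>q | q permutes S.
    of_int (sign (transpose w b \<circ> q)) * (M w b * (\<Prod>i\<in>S. M i (transpose w b (q i)))))"
  unfolding det_on_def sum_over_permutations_insert[OF assms]
proof (intro sum.cong refl)
  fix b q assume "q \<in> {q. q permutes S}"
  then have "q w = w" using assms(2) by (simp add: permutes_not_in)
  then show "of_int (sign (transpose w b \<circ> q)) * (\<Prod>i\<in>insert w S. M i ((transpose w b \<circ> q) i)) =
    of_int (sign (transpose w b \<circ> q)) * (M w b * (\<Prod>i\<in>S. M i (transpose w b (q i))))"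
    by (simp add: prod.insert[OF assms])
qed

text \<open>One step of Gaussian elimination. The row and column of \<open>w\<close> vanish outside
  \<open>w\<close> and \<open>u\<close>, so a contributing permutation either fixes \<open>w\<close>
  or swaps it with \<open>u\<close>; the swaps become a correction of the diagonal entry at
  \<open>u\<close>.\<close>

lemma det_on_pendant:
  assumes V: "finite V" "w \<in> V" "u \<in> V" "w \<noteq> u"
    and off: "\<And>j. j \<in> V \<Longrightarrow> j \<noteq> w \<Longrightarrow> j \<noteq> u \<Longrightarrow> M w j = 0 \<and> M j w = 0"
    and nz: "M w w \<noteq> 0"
  shows "det_on V M = M w w * det_on (V - {w}) (shift_diag M u (- (M w u * M u w / M w w)))"
proof -
  define S where "S = V - {w}"
  have S: "finite S" "w \<notin> S" "u \<in> S" "V = insert w S" using V by (auto simp: S_def)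
  define P where "P q = (\<Prod>i\<in>S - {u}. M i (q i))" for q :: "nat \<Rightarrow> nat"
  define g where "g b q = of_int (sign (transpose w b \<circ> q)) * (M w b * (\<Prod>i\<in>S. M i (transpose w b (q i))))" for b q
  have prodS: "(\<Prod>i\<in>S. h i) = h u * (\<Prod>i\<in>S - {u}. h i)" for h :: "nat \<Rightarrow> real"
    using S by (simp add: prod.remove)
  have gw: "g w q = of_int (sign q) * (M w w * (M u (q u) * P q))" if "q permutes S" for q
    by (simp add: g_def P_def prodS)
  \<comment> \<open>Here \<open>w\<close> is sent to \<open>u\<close>. Since column \<open>w\<close>
    vanishes elsewhere, \<open>u\<close> has to be sent back to \<open>w\<close>, which for the
    composition with the transposition means \<open>q u = u\<close>.\<close>
  have gu: "g u q = (if q u = u then - of_int (sign q) * (M w u * (M u w * P q)) else 0)" if q: "q permutes S" for q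
  proof -
    have "permutation q" using q S(1) permutation_permutes by blast
    then have sgn: "sign (transpose w u \<circ> q) = - sign q"
      using V(4) by (simp add: sign_compose permutation_swap_id sign_swap_id)
    show ?thesis
    proof (cases "q u = u")
      case True
      have "(\<Prod>i\<in>S - {u}. M i (transpose w u (q i))) = P q"
        unfolding P_def
      proof (rule prod.cong)
        fix i assume i: "i \<in> S - {u}"
        then have "q i \<in> S" "q i \<noteq> u"
          using q True by (auto simp: permutes_in_image permutes_def)
        then show "M i (transpose w u (q i)) = M i (q i)"
          using S(2) by (metis transpose_apply_other)
      qed simp
      then show ?thesis
        using True by (simp add: g_def prodS sgn)
    next
      case False
      obtain i where i: "i \<in> S" "q i = u"
        using q S(3) by (metis permutes_image imageE)
      with False have "i \<noteq> u" by auto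
      then have "M i (transpose w u (q i)) = 0"
        using i off[of i] S by auto
      then have "(\<Prod>i\<in>S. M i (transpose w u (q i))) = 0"
        using i(1) S(1) by (auto simp: prod_zero_iff)
      then show ?thesis using False by (simp add: g_def)
    qed
  qed
  have g0: "g b q = 0" if "b \<in> S - {u}" for b q
    using that off[of b] S by (auto simp: g_def)
  have "det_on V M = (\<Sum>b\<in>insert w S. \<Sum>q | q permutes S. g b q)"
    unfolding S(4) det_on_insert[OF S(1,2)] g_def ..
  also have "\<dots> = (\<Sum>q | q permutes S. g w q) + (\<Sum>b\<in>S. \<Sum>q | q permutes S. g b q)"
    using S by simp
  also have "(\<Sum>b\<in>S. \<Sum>q | q permutes S. g b q) = (\<Sum>q | q permutes S. g u q)"
    using S g0 by (simp add: sum.remove)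
  also have "(\<Sum>q | q permutes S. g w q) + (\<Sum>q | q permutes S. g u q) = (\<Sum>q | q permutes S. g w q + g u q)"
    by (simp add: sum.distrib)
  also have "\<dots> = (\<Sum>q | q permutes S. M w w * (of_int (sign q) *
      (\<Prod>i\<in>S. shift_diag M u (- (M w u * M u w / M w w)) i (q i))))"
  proof (rule sum.cong)
    fix q assume "q \<in> {q. q permutes S}"
    then have q: "q permutes S" by simp
    have "(\<Prod>i\<in>S - {u}. shift_diag M u (- (M w u * M u w / M w w)) i (q i)) = P q"
      unfolding P_def by (rule prod.cong) (auto simp: shift_diag_def)
    then have "(\<Prod>i\<in>S. shift_diag M u (- (M w u * M u w / M w w)) i (q i)) =
      shift_diag M u (- (M w u * M u w / M w w)) u (q u) * P q"
      by (simp add: prodS)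
    then show "g w q + g u q = M w w * (of_int (sign q) *
      (\<Prod>i\<in>S. shift_diag M u (- (M w u * M u w / M w w)) i (q i)))"
      using nz by (simp add: gw[OF q] gu[OF q] shift_diag_def field_simps)
  qed simp
  finally show ?thesis
    by (simp add: det_on_def S_def sum_distrib_left)
qed

lemma det_on_3:
  assumes "a \<noteq> b" "a \<noteq> c" "b \<noteq> c"
  shows "det_on {a, b, c} M = M a a * (M b b * M c c - M b c * M c b)
    - M a b * (M b a * M c c - M b c * M c a) + M a c * (M b a * M c b - M b b * M c a)"
proof -
  have perms: "{q. q permutes {b, c}} = {id, transpose b c}"
    using permutes_doubleton_iff[of _ b c] by (auto simp: fun_eq_iff id_def)
  have "transpose b c \<noteq> id" using assms by (metis id_apply transpose_apply_first)
  then show ?thesis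
    using assms unfolding det_on_insert[of "{b, c}" a, simplified] perms
    by (simp add: det_on_insert perms sign_compose permutation_swap_id sign_swap_id transpose_def algebra_simps)
qed


section \<open>Labelled trees and the elimination of their non-root vertices\<close>

primrec root_of :: "'a rtree \<Rightarrow> 'a" where
  "root_of (Vtx v) = v"
| "root_of (Join T C) = root_of T"

primrec edges :: "'a rtree \<Rightarrow> 'a rel" where
  "edges (Vtx v) = {}"
| "edges (Join T C) = insert (root_of T, root_of C) (edges T \<union> edges C)"

primrec wf_tree :: "'a rtree \<Rightarrow> bool" where
  "wf_tree (Vtx v) \<longleftrightarrow> True"
| "wf_tree (Join T C) \<longleftrightarrow> wf_tree T \<and> wf_tree C \<and> set_rtree T \<inter> set_rtree C = {}"

text \<open>Meaningful for vertices \<open>i\<close> of the tree only.\<close>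

primrec deg :: "'a rtree \<Rightarrow> 'a \<Rightarrow> nat" where
  "deg (Vtx v) i = 0"
| "deg (Join T C) i = (if i \<in> set_rtree T then deg T i + of_bool (i = root_of T)
     else deg C i + of_bool (i = root_of C))"

lemma root_in_set [simp]: "root_of T \<in> set_rtree T"
  by (induction T) auto

lemma edges_subset: "edges T \<subseteq> set_rtree T \<times> set_rtree T"
  by (induction T) auto

lemma edges_in: "(i, j) \<in> edges T \<Longrightarrow> i \<in> set_rtree T \<and> j \<in> set_rtree T"
  using edges_subset[of T] by blast

lemma finite_edges [simp]: "finite (edges T)"
  by (induction T) auto

lemma positive_poly_poly:
  assumes "positive_poly p" "x > 0"
  shows "poly p x > 0"
proof -
  obtain k where k: "coeff p k \<noteq> 0"
    using assms(1) by (auto simp: positive_poly_def poly_eq_iff)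
  then have "k \<le> degree p" by (simp add: le_degree)
  have nn: "0 \<le> coeff p i * x ^ i" for i
    using assms by (simp add: positive_poly_def nonneg_poly_def)
  have "0 \<le> coeff p k"
    using assms(1) by (simp add: positive_poly_def nonneg_poly_def)
  then have "0 < coeff p k * x ^ k"
    using k assms(2) by (intro mult_pos_pos) simp_all
  also have "\<dots> \<le> poly p x"
    unfolding poly_altdef using \<open>k \<le> degree p\<close> nn
    by (intro member_le_sum[where f = "\<lambda>i. coeff p i * x ^ i"]) auto
  finally show ?thesis .
qed

lemma nonneg_poly_poly: "nonneg_poly p \<Longrightarrow> x > 0 \<Longrightarrow> poly p x \<ge> 0"
  using positive_poly_poly[of p x] by (cases "p = 0") (auto simp: positive_poly_def)

text \<open>For a tree standing alone, \<open>1 + ratio\<close> is the pivot left at its root once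
  all other vertices have been eliminated.\<close>

definition ratio :: "ppair \<Rightarrow> real \<Rightarrow> real" where
  "ratio X x = poly (snd X) x / poly (fst X) x"

lemma good_poly:
  assumes "good X" "x > 0"
  shows "poly (fst X) x > 0" "poly (snd X) x \<ge> 0" "ratio X x \<ge> 0"
  using assms positive_poly_poly[of "fst X" x] nonneg_poly_poly[of "snd X" x]
  by (auto simp: good_def ratio_def)

definition adj :: "'a rel \<Rightarrow> 'a \<Rightarrow> 'a \<Rightarrow> bool" where
  "adj E i j \<longleftrightarrow> (i, j) \<in> E \<or> (j, i) \<in> E"

text \<open>Prescribes rows and columns of the non-root vertices only. The diagonal entry of the
  root stays free, because it also collects edges outside the tree and the corrections from earlier
  eliminations.\<close>

definition lap_on_tree :: "real \<Rightarrow> nat set \<Rightarrow> nat rtree \<Rightarrow> (nat \<Rightarrow> nat \<Rightarrow> real) \<Rightarrow> bool" where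
  "lap_on_tree x V T M \<longleftrightarrow> (\<forall>i\<in>set_rtree T - {root_of T}. M i i = 1 + x * real (deg T i) \<and>
     (\<forall>j\<in>V. i \<noteq> j \<longrightarrow> M i j = (if adj (edges T) i j then - x else 0) \<and> M j i = M i j))"

text \<open>Once the proper descendants in \<open>C\<close> are gone, the root of \<open>C\<close>
  is pendant at the root of \<open>T\<close> and can be eliminated. The diagonal entry at a root
  counts its edges into the tree; these are withdrawn as \<open>x * deg\<close> and replaced by the
  ratio.\<close>

lemma det_on_tree:
  assumes "wf_tree T" "finite V" "set_rtree T \<subseteq> V" "x > 0" "lap_on_tree x V T M"
  shows "det_on V M = poly (fst (pair_of T)) x * det_on (V - (set_rtree T - {root_of T}))
    (shift_diag M (root_of T) (ratio (pair_of T) x - x * deg T (root_of T)))"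
  using assms
proof (induction T arbitrary: V M)
  case (Vtx v)
  have "shift_diag M v 0 = M" by (simp add: shift_diag_def fun_eq_iff)
  then show ?case by (simp add: ratio_def)
next
  case (Join T C)
  define w u where "w = root_of C" "u = root_of T"
  have wf: "wf_tree T" "wf_tree C" and disj: "set_rtree T \<inter> set_rtree C = {}"
    and sub: "set_rtree T \<subseteq> V" "set_rtree C \<subseteq> V"
    using Join.prems by auto
  note M = Join.prems(5)[unfolded lap_on_tree_def]
  have wC: "w \<in> set_rtree C" "w \<notin> set_rtree T" and uT: "u \<in> set_rtree T" "u \<notin> set_rtree C"
    using disj root_in_set[of C] root_in_set[of T] unfolding w_u_def by blast+
  have adjC: "adj (edges (Join T C)) i j \<longleftrightarrow> adj (edges C) i j" if "i \<in> set_rtree C" "i \<noteq> w" for i j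
    using that disj edges_subset[of T] uT unfolding adj_def edges.simps w_u_def[symmetric] by blast
  have adjT: "adj (edges (Join T C)) i j \<longleftrightarrow> adj (edges T) i j" if "i \<in> set_rtree T" "i \<noteq> u" for i j
    using that disj edges_subset[of C] wC unfolding adj_def edges.simps w_u_def[symmetric] by blast
  have adjw: "adj (edges (Join T C)) w j \<longleftrightarrow> j = u" if "j \<in> V - (set_rtree C - {w})" "j \<noteq> w" for j
    using that edges_subset[of C] edges_subset[of T] wC uT
    unfolding adj_def edges.simps w_u_def[symmetric] by blast
  have lapC: "lap_on_tree x V C M"
    unfolding lap_on_tree_def
  proof (intro ballI, goal_cases)
    case (1 i)
    then have i: "i \<in> set_rtree C" "i \<noteq> w" "i \<notin> set_rtree T" using disj unfolding w_u_def by blast+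
    then have "i \<in> set_rtree (Join T C) - {root_of (Join T C)}" using uT by auto
    with M have "M i i = 1 + x * real (deg (Join T C) i) \<and>
     (\<forall>j\<in>V. i \<noteq> j \<longrightarrow> M i j = (if adj (edges (Join T C)) i j then - x else 0) \<and> M j i = M i j)" by blast
    then show ?case using i unfolding adjC[OF i(1,2)] by (simp add: w_u_def)
  qed
  define rC where "rC = ratio (pair_of C) x"
  define V1 where "V1 = V - (set_rtree C - {w})"
  define M1 where "M1 = shift_diag M w (rC - x * deg C w)"
  have det1: "det_on V M = poly (fst (pair_of C)) x * det_on V1 M1"
    using Join.IH(2)[OF wf(2) Join.prems(2) sub(2) Join.prems(4) lapC]
    by (simp add: V1_def M1_def w_u_def rC_def)
  \<comment> \<open>The pivot at the root of \<open>C\<close>: \<open>x\<close> for the edge to its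
    parent and \<open>rC\<close> for the tree below it.\<close>
  define e where "e = 1 + x + rC"
  have rC: "rC \<ge> 0" unfolding rC_def using good_poly(3)[OF good_pair_of] Join.prems(4) .
  then have e: "e > 0" using Join.prems(4) by (simp add: e_def)
  have wM: "M w w = 1 + x * real (deg (Join T C) w) \<and>
     (\<forall>j\<in>V. w \<noteq> j \<longrightarrow> M w j = (if adj (edges (Join T C)) w j then - x else 0) \<and> M j w = M w j)"
  proof -
    have "w \<in> set_rtree (Join T C) - {root_of (Join T C)}" using wC uT by (auto simp: w_u_def)
    with M show ?thesis by blast
  qed
  have "M1 w w = e"
    using wM wC by (simp add: M1_def shift_diag_def e_def w_u_def algebra_simps)
  have wu: "w \<noteq> u" using wC uT by auto
  have V1: "w \<in> V1" "u \<in> V1" "finite V1" using wC uT sub Join.prems(2) by (auto simp: V1_def)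
  have Mwu: "M1 w u = - x" "M1 u w = - x"
    using wM adjw[of u] V1 wu by (auto simp: M1_def shift_diag_def V1_def)
  have "M1 w j = 0 \<and> M1 j w = 0" if "j \<in> V1" "j \<noteq> w" "j \<noteq> u" for j
    using wM adjw[of j] that by (auto simp: M1_def shift_diag_def V1_def)
  from det_on_pendant[where M = M1, OF V1(3,1,2) wu this] have
    det2: "det_on V1 M1 = e * det_on (V1 - {w}) (shift_diag M1 u (- (x * x / e)))"
    using \<open>M1 w w = e\<close> e Mwu by simp
  define V2 where "V2 = V - set_rtree C"
  have V2: "V1 - {w} = V2" "finite V2" "set_rtree T \<subseteq> V2"
    using wC sub disj Join.prems(2) by (auto simp: V1_def V2_def)
  define M2 where "M2 = shift_diag M1 u (- (x * x / e))"
  have lapT: "lap_on_tree x V2 T M2"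
    unfolding lap_on_tree_def
  proof (intro ballI, goal_cases)
    case (1 i)
    then have i: "i \<in> set_rtree T" "i \<noteq> u" unfolding w_u_def by blast+
    then have "i \<in> set_rtree (Join T C) - {root_of (Join T C)}" by (simp add: w_u_def)
    with M have "M i i = 1 + x * real (deg (Join T C) i) \<and>
     (\<forall>j\<in>V. i \<noteq> j \<longrightarrow> M i j = (if adj (edges (Join T C)) i j then - x else 0) \<and> M j i = M i j)" by blast
    then show ?case using i wC unfolding adjT[OF i]
      by (auto simp: w_u_def M2_def M1_def shift_diag_def V2_def)
  qed
  define aT rT where "aT = poly (fst (pair_of T)) x" "rT = ratio (pair_of T) x"
  have det3: "det_on V2 M2 = aT * det_on (V2 - (set_rtree T - {u})) (shift_diag M2 u (rT - x * deg T u))"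
    using Join.IH(1)[OF wf(1) V2(2,3) Join.prems(4) lapT] by (simp add: aT_rT_def w_u_def)
  define aC where "aC = poly (fst (pair_of C)) x"
  define bC where "bC = poly (snd (pair_of C)) x"
  define bT where "bT = poly (snd (pair_of T)) x"
  have aC: "aC > 0" and aT: "aT > 0" unfolding aC_def aT_rT_def using good_poly(1)[OF good_pair_of] Join.prems(4) by blast+
  have rr: "rC = bC / aC" "rT = bT / aT"
    by (simp_all add: rC_def aT_rT_def ratio_def bC_def aC_def bT_def)
  have fst_eq: "poly (fst (pair_of (Join T C))) x = aC * e * aT"
    using aC by (simp add: glue_def hang_def e_def rr aC_def[symmetric] bC_def[symmetric] aT_rT_def[symmetric] field_simps)
  \<comment> \<open>\<open>x - x * x / e\<close> is the ratio of \<open>hang\<close> applied to the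
    pair of \<open>C\<close>.\<close>
  have eq2: "ratio (pair_of (Join T C)) x = rT + x - x * x / e"
    using aC aT e
    by (simp add: glue_def hang_def e_def rr ratio_def aC_def[symmetric] bC_def[symmetric] aT_rT_def[symmetric] bT_def[symmetric])
      (simp add: field_simps add_pos_nonneg)
  have sets: "V2 - (set_rtree T - {u}) = V - (set_rtree (Join T C) - {root_of (Join T C)})"
    using uT sub by (auto simp: V2_def w_u_def)
  define rJ where "rJ = ratio (pair_of (Join T C)) x"
  have degJ: "deg (Join T C) u = deg T u + 1" using uT by (simp add: w_u_def)
  have "det_on (V2 - (set_rtree T - {u})) (shift_diag M2 u (rT - x * deg T u)) =
    det_on (V2 - (set_rtree T - {u})) (shift_diag M u (rJ - x * deg (Join T C) u))"
  proof (rule det_on_cong)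
    fix i j assume "i \<in> V2 - (set_rtree T - {u})"
    then have "i \<noteq> w" using wC by (auto simp: V2_def)
    then show "shift_diag M2 u (rT - x * deg T u) i j = shift_diag M u (rJ - x * deg (Join T C) u) i j"
      unfolding degJ rJ_def eq2 by (simp add: M2_def M1_def shift_diag_def algebra_simps)
  qed
  then show ?case
    unfolding det1 det2 V2(1) M2_def[symmetric] det3 fst_eq sets
    by (simp add: w_u_def aC_def rJ_def)
qed

lemma finite_adj [simp]: "finite (Collect (adj (edges T) i))"
proof (rule finite_subset)
  show "Collect (adj (edges T) i) \<subseteq> set_rtree T"
    using edges_subset[of T] by (auto simp: adj_def)
qed simp

lemma card_adj:
  "wf_tree T \<Longrightarrow> i \<in> set_rtree T \<Longrightarrow> card {j. adj (edges T) i j} = deg T i"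
proof (induction T)
  case (Join T C)
  have disj: "set_rtree T \<inter> set_rtree C = {}" using Join.prems by simp
  show ?case
  proof (cases "i \<in> set_rtree T")
    case True
    then have i: "i \<notin> set_rtree C" using disj by auto
    have "{j. adj (edges (Join T C)) i j} = {j. adj (edges T) i j} \<union> (if i = root_of T then {root_of C} else {})"
      using i root_in_set[of C] by (auto simp: adj_def dest: edges_in)
    moreover have "root_of C \<notin> {j. adj (edges T) i j}"
      using disj root_in_set[of C] edges_subset[of T] unfolding adj_def by blast
    ultimately show ?thesis
      using Join True by (cases "i = root_of T") simp_all
  next
    case False
    then have i: "i \<in> set_rtree C" using Join.prems by auto
    have "{j. adj (edges (Join T C)) i j} = {j. adj (edges C) i j} \<union> (if i = root_of C then {root_of T} else {})"
      using False root_in_set[of T] by (auto simp: adj_def dest: edges_in)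
    moreover have "root_of T \<notin> {j. adj (edges C) i j}"
      using disj root_in_set[of T] edges_subset[of C] unfolding adj_def by blast
    ultimately show ?thesis
      using Join False i by (cases "i = root_of C") simp_all
  qed
qed (simp add: adj_def card_eq_0_iff)

section \<open>A triangle with three labelled trees\<close>

definition tri_edges :: "'a rtree \<Rightarrow> 'a rtree \<Rightarrow> 'a rtree \<Rightarrow> 'a rel" where
  "tri_edges T1 T2 T3 = {(root_of T1, root_of T2), (root_of T2, root_of T3), (root_of T3, root_of T1)}
     \<union> (edges T1 \<union> edges T2 \<union> edges T3)"

definition tri_verts :: "'a rtree \<Rightarrow> 'a rtree \<Rightarrow> 'a rtree \<Rightarrow> 'a set" where
  "tri_verts T1 T2 T3 = set_rtree T1 \<union> set_rtree T2 \<union> set_rtree T3"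

definition wf_tri :: "'a rtree \<Rightarrow> 'a rtree \<Rightarrow> 'a rtree \<Rightarrow> bool" where
  "wf_tri T1 T2 T3 \<longleftrightarrow> wf_tree T1 \<and> wf_tree T2 \<and> wf_tree T3 \<and>
     set_rtree T1 \<inter> set_rtree T2 = {} \<and> set_rtree T1 \<inter> set_rtree T3 = {} \<and> set_rtree T2 \<inter> set_rtree T3 = {}"

definition tri_graph :: "nat rtree \<Rightarrow> nat rtree \<Rightarrow> nat rtree \<Rightarrow> nat pair_pre_digraph" where
  "tri_graph T1 T2 T3 = \<lparr> pverts = tri_verts T1 T2 T3,
     parcs = tri_edges T1 T2 T3 \<union> (tri_edges T1 T2 T3)\<inverse> \<rparr>"

lemma tri_edges_rotate: "tri_edges T2 T3 T1 = tri_edges T1 T2 T3"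
  by (auto simp: tri_edges_def)

lemma tri_verts_rotate: "tri_verts T2 T3 T1 = tri_verts T1 T2 T3"
  by (auto simp: tri_verts_def)

lemma wf_tri_rotate: "wf_tri T2 T3 T1 = wf_tri T1 T2 T3"
  by (auto simp: wf_tri_def)

lemma tri_graph_rotate: "tri_graph T2 T3 T1 = tri_graph T1 T2 T3"
  by (simp add: tri_graph_def tri_edges_rotate tri_verts_rotate)

lemma wf_tri_roots:
  assumes "wf_tri T1 T2 T3"
  shows "root_of T2 \<noteq> root_of T3" "root_of T2 \<notin> set_rtree T1" "root_of T3 \<notin> set_rtree T1"
    "root_of T1 \<noteq> root_of T2" "root_of T1 \<noteq> root_of T3"
proof -
  have disj: "set_rtree T1 \<inter> set_rtree T2 = {}" "set_rtree T1 \<inter> set_rtree T3 = {}" "set_rtree T2 \<inter> set_rtree T3 = {}"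
    using assms by (simp_all add: wf_tri_def)
  note roots = root_in_set[of T1] root_in_set[of T2] root_in_set[of T3]
  show "root_of T2 \<noteq> root_of T3" using disj(3) roots(2,3) by (metis disjoint_iff)
  show "root_of T2 \<notin> set_rtree T1" using disj(1) roots(2) by (metis disjoint_iff)
  show "root_of T3 \<notin> set_rtree T1" using disj(2) roots(3) by (metis disjoint_iff)
  show "root_of T1 \<noteq> root_of T2" using disj(1) roots(1,2) by (metis disjoint_iff)
  show "root_of T1 \<noteq> root_of T3" using disj(2) roots(1,3) by (metis disjoint_iff)
qed

lemma adj_tri_edges:
  assumes "wf_tri T1 T2 T3" "i \<in> set_rtree T1"
  shows "adj (tri_edges T1 T2 T3) i j \<longleftrightarrow>
    adj (edges T1) i j \<or> i = root_of T1 \<and> (j = root_of T2 \<or> j = root_of T3)"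
proof -
  have "i \<notin> set_rtree T2" "i \<notin> set_rtree T3" using assms by (auto simp: wf_tri_def)
  then show ?thesis
    using root_in_set[of T2] root_in_set[of T3]
    by (auto simp: adj_def tri_edges_def dest: edges_in)
qed

lemma card_adj_tri:
  assumes "wf_tri T1 T2 T3" "i \<in> set_rtree T1"
  shows "card {j. adj (tri_edges T1 T2 T3) i j} = deg T1 i + 2 * of_bool (i = root_of T1)"
proof -
  have eq: "{j. adj (tri_edges T1 T2 T3) i j} = {j. adj (edges T1) i j} \<union> (if i = root_of T1 then {root_of T2, root_of T3} else {})"
    unfolding adj_tri_edges[OF assms] by auto
  note roots = wf_tri_roots[OF assms(1)]
  have "root_of T2 \<notin> {j. adj (edges T1) i j}" "root_of T3 \<notin> {j. adj (edges T1) i j}"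
    using roots(2,3) by (auto simp: adj_def dest: edges_in)
  then show ?thesis
    unfolding eq using roots(1) card_adj[of T1 i] assms
    by (cases "i = root_of T1") (simp_all add: wf_tri_def)
qed

text \<open>The entries of I + x L for the graph obtained by symmetrising \<open>E\<close>.\<close>

definition lap_fun :: "real \<Rightarrow> 'a rel \<Rightarrow> 'a \<Rightarrow> 'a \<Rightarrow> real" where
  "lap_fun x E i j = (if i = j then 1 + x * real (card {j. adj E i j}) else if adj E i j then - x else 0)"

lemma adj_commute: "adj E i j = adj E j i"
  by (auto simp: adj_def)

lemma lap_on_tree_lap_fun:
  assumes "wf_tri T1 T2 T3"
  shows "lap_on_tree x V T1 (lap_fun x (tri_edges T1 T2 T3))"
  unfolding lap_on_tree_def
proof (intro ballI conjI allI impI)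
  fix i assume i: "i \<in> set_rtree T1 - {root_of T1}"
  then show "lap_fun x (tri_edges T1 T2 T3) i i = 1 + x * real (deg T1 i)"
    using card_adj_tri[OF assms, of i] by (simp add: lap_fun_def)
  fix j assume "i \<noteq> j"
  then show "lap_fun x (tri_edges T1 T2 T3) i j = (if adj (edges T1) i j then - x else 0)"
    using i adj_tri_edges[OF assms, of i j] by (simp add: lap_fun_def)
  show "lap_fun x (tri_edges T1 T2 T3) j i = lap_fun x (tri_edges T1 T2 T3) i j"
    using \<open>i \<noteq> j\<close> by (simp add: lap_fun_def adj_commute[of _ j i])
qed

lemma lap_on_tree_shift:
  assumes "lap_on_tree x V T M" "u \<notin> set_rtree T" "W \<subseteq> V"
  shows "lap_on_tree x W T (shift_diag M u c)"
  unfolding lap_on_tree_def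
proof (intro ballI, goal_cases)
  case (1 i)
  then have "i \<noteq> u" using assms(2) by auto
  moreover have "M i i = 1 + x * real (deg T i) \<and>
    (\<forall>j\<in>V. i \<noteq> j \<longrightarrow> M i j = (if adj (edges T) i j then - x else 0) \<and> M j i = M i j)"
    using assms(1) 1 unfolding lap_on_tree_def by blast
  ultimately show ?case
    using assms(3) by (simp add: shift_diag_def subset_eq)
qed

text \<open>Eliminating the trees leaves a 3 by 3 determinant, whose denominators are cleared by the
  three first components. Combinatorially, forests are sorted by the triangle edges they use: with
  one edge each product in \<open>tri_total\<close> arises from two edges, with two edges there are
  three choices, and all three edges would close a cycle.\<close>

lemma det_on_tri:
  assumes wf: "wf_tri T1 T2 T3" and x: "x > 0"
  shows "det_on (tri_verts T1 T2 T3) (lap_fun x (tri_edges T1 T2 T3)) =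
    poly (tri_total (pair_of T1) (pair_of T2) (pair_of T3)) x"
proof -
  define a b c where "a = root_of T1" "b = root_of T2" "c = root_of T3"
  define M where "M = lap_fun x (tri_edges T1 T2 T3)"
  have wfs: "wf_tree T1" "wf_tree T2" "wf_tree T3" using wf by (auto simp: wf_tri_def)
  have wf': "wf_tri T2 T3 T1" "wf_tri T3 T1 T2" using wf wf_tri_rotate by blast+
  have rot: "tri_edges T2 T3 T1 = tri_edges T1 T2 T3" "tri_edges T3 T1 T2 = tri_edges T1 T2 T3"
    using tri_edges_rotate by blast+
  have abc: "a \<in> set_rtree T1" "b \<in> set_rtree T2" "c \<in> set_rtree T3" by (simp_all add: a_b_c_def)
  have disj: "set_rtree T1 \<inter> set_rtree T2 = {}" "set_rtree T1 \<inter> set_rtree T3 = {}" "set_rtree T2 \<inter> set_rtree T3 = {}"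
    using wf by (auto simp: wf_tri_def)
  have ne: "a \<noteq> b" "a \<noteq> c" "b \<noteq> c" using abc disj by auto
  define r where "r T = ratio (pair_of T) x" for T :: "nat rtree"
  define \<alpha> where "\<alpha> T = poly (fst (pair_of T)) x" for T :: "nat rtree"
  define V where "V = tri_verts T1 T2 T3"
  define V1 where "V1 = V - (set_rtree T1 - {a})"
  define V2 where "V2 = V1 - (set_rtree T2 - {b})"
  define M1 where "M1 = shift_diag M a (r T1 - x * deg T1 a)"
  define M2 where "M2 = shift_diag M1 b (r T2 - x * deg T2 b)"
  define M3 where "M3 = shift_diag M2 c (r T3 - x * deg T3 c)"
  have fin: "finite V" "finite V1" "finite V2" by (simp_all add: V_def V1_def V2_def tri_verts_def)
  have sub: "set_rtree T1 \<subseteq> V" "set_rtree T2 \<subseteq> V1" "set_rtree T3 \<subseteq> V2"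
    using disj by (auto simp: V_def V1_def V2_def tri_verts_def)
  have lap: "lap_on_tree x V T1 M" "lap_on_tree x V T2 M" "lap_on_tree x V T3 M"
    using lap_on_tree_lap_fun[OF wf] lap_on_tree_lap_fun[OF wf'(1)] lap_on_tree_lap_fun[OF wf'(2)]
    unfolding rot M_def by auto
  have lap1: "lap_on_tree x V1 T2 M1"
    unfolding M1_def by (rule lap_on_tree_shift[OF lap(2)]) (use abc disj in \<open>auto simp: V1_def\<close>)
  have "lap_on_tree x V1 T3 M1"
    unfolding M1_def by (rule lap_on_tree_shift[OF lap(3)]) (use abc disj in \<open>auto simp: V1_def\<close>)
  then have lap2: "lap_on_tree x V2 T3 M2"
    unfolding M2_def by (rule lap_on_tree_shift) (use abc disj in \<open>auto simp: V2_def\<close>)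
  have "det_on V M = \<alpha> T1 * det_on V1 M1"
    using det_on_tree[OF wfs(1) fin(1) sub(1) x lap(1)] by (simp add: V1_def M1_def r_def \<alpha>_def a_b_c_def)
  also have "det_on V1 M1 = \<alpha> T2 * det_on V2 M2"
    using det_on_tree[OF wfs(2) fin(2) sub(2) x lap1] by (simp add: V2_def M2_def r_def \<alpha>_def a_b_c_def)
  also have "det_on V2 M2 = \<alpha> T3 * det_on (V2 - (set_rtree T3 - {c})) M3"
    using det_on_tree[OF wfs(3) fin(3) sub(3) x lap2] by (simp add: M3_def r_def \<alpha>_def a_b_c_def)
  also have "V2 - (set_rtree T3 - {c}) = {a, b, c}"
    using abc disj by (auto simp: V_def V1_def V2_def tri_verts_def)
  also have "det_on {a, b, c} M3 = (1 + 2 * x + r T1) * (1 + 2 * x + r T2) * (1 + 2 * x + r T3)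
     - x * x * (1 + 2 * x + r T1 + 1 + 2 * x + r T2 + 1 + 2 * x + r T3) - 2 * x * x * x"
  proof -
    have "M a a = 1 + x * (deg T1 a + 2)" "M b b = 1 + x * (deg T2 b + 2)" "M c c = 1 + x * (deg T3 c + 2)"
      using card_adj_tri[OF wf abc(1)] card_adj_tri[OF wf'(1) abc(2)] card_adj_tri[OF wf'(2) abc(3)]
      unfolding rot by (simp_all add: M_def lap_fun_def a_b_c_def)
    then have diag: "M3 a a = 1 + 2 * x + r T1" "M3 b b = 1 + 2 * x + r T2" "M3 c c = 1 + 2 * x + r T3"
      using ne by (simp_all add: M3_def M2_def M1_def shift_diag_def algebra_simps)
    have "adj (tri_edges T1 T2 T3) a b" "adj (tri_edges T1 T2 T3) a c" "adj (tri_edges T1 T2 T3) b c"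
      "adj (tri_edges T1 T2 T3) b a" "adj (tri_edges T1 T2 T3) c a" "adj (tri_edges T1 T2 T3) c b"
      by (auto simp: adj_def tri_edges_def a_b_c_def)
    then have "M3 a b = - x" "M3 a c = - x" "M3 b c = - x" "M3 b a = - x" "M3 c a = - x" "M3 c b = - x"
      using ne by (simp_all add: M3_def M2_def M1_def shift_diag_def M_def lap_fun_def)
    with diag show ?thesis
      unfolding det_on_3[OF ne] by (simp add: algebra_simps)
  qed
  finally have det: "det_on V M = \<alpha> T1 * (\<alpha> T2 * (\<alpha> T3 * ((1 + 2 * x + r T1) * (1 + 2 * x + r T2) * (1 + 2 * x + r T3)
     - x * x * (1 + 2 * x + r T1 + 1 + 2 * x + r T2 + 1 + 2 * x + r T3) - 2 * x * x * x)))" .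
  have "\<alpha> T > 0" for T unfolding \<alpha>_def using good_poly(1)[OF good_pair_of x] .
  then have snd: "poly (snd (pair_of T)) x = \<alpha> T * r T" for T
    by (simp add: r_def ratio_def \<alpha>_def[symmetric] less_imp_neq[symmetric])
  have "poly (tri_total (pair_of T1) (pair_of T2) (pair_of T3)) x = det_on V M"
    unfolding det tri_total_def tot_def poly_add poly_mult poly_numeral poly_tt snd \<alpha>_def[symmetric]
    by (simp add: algebra_simps)
  then show ?thesis by (simp add: V_def M_def)
qed

section \<open>From the determinant to the Laplacian coefficients\<close>

lemma poly_eq_on_positive:
  fixes p q :: "real poly"
  assumes "\<And>x. x > 0 \<Longrightarrow> poly p x = poly q x"
  shows "p = q"
proof (rule ccontr)
  assume "p \<noteq> q"
  then have "p - q \<noteq> 0" by simp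
  then have "finite {x. poly (p - q) x = 0}" by (rule poly_roots_finite)
  moreover have "{0<..} \<subseteq> {x. poly (p - q) x = 0}" using assms by auto
  ultimately show False using infinite_Ioi[of "0 :: real"] finite_subset by blast
qed

text \<open>det (I + x L) is the characteristic polynomial at \<open>- 1 / x\<close>, multiplied by
  \<open>(- x) ^ n\<close>; the matrix \<open>D\<close> in the proof is I + x L.\<close>

lemma lap_coeff_poly:
  assumes n: "pverts G = {0..<n}" and arcs: "parcs G = E \<union> E\<inverse>" and irr: "\<And>i. (i, i) \<notin> E"
    and x: "x > 0"
  shows "(\<Sum>k\<le>n. real_of_int (lap_coeff G k) * x ^ k) = det_on {0..<n} (lap_fun x E)"
proof -
  define L where "L = map_mat real_of_int (laplacian_mat G)"
  define P where "P = char_poly L"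
  have L: "L \<in> carrier_mat n n"
    unfolding L_def laplacian_mat_def degree_mat_def adjacency_mat_def Let_def n
    by (intro carrier_matI) simp_all
  have L': "laplacian_mat G \<in> carrier_mat n n"
    unfolding laplacian_mat_def degree_mat_def adjacency_mat_def Let_def n
    by (intro carrier_matI) simp_all
  have coeffP: "coeff P j = real_of_int (coeff (char_poly (laplacian_mat G)) j)" for j
    unfolding P_def L_def of_int_hom.char_poly_hom[OF L'] of_int_hom.coeff_map_poly_hom ..
  have deg: "degree P = n"
    unfolding P_def using degree_monic_char_poly[OF L] by simp
  have arc: "(i, j) \<in> parcs G \<longleftrightarrow> adj E i j" for i j by (auto simp: arcs adj_def)
  have degree: "degree_of G i = card {j. adj E i j}" for i
  proof -
    have "out_arcs (with_proj G) i = Pair i ` {j. adj E i j}"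
      by (auto simp: out_arcs_def arc)
    then show ?thesis
      by (simp add: degree_of_def out_degree_def card_image inj_on_def)
  qed
  have entry: "L $$ (i, j) = (if i = j then real (card {j. adj E i j}) else if adj E i j then - 1 else 0)"
    if "i < n" "j < n" for i j
  proof -
    have "\<not> adj E k k" for k using irr by (auto simp: adj_def)
    then show ?thesis
      using that unfolding L_def laplacian_mat_def degree_mat_def adjacency_mat_def n Let_def
      by (simp add: arc degree)
  qed
  define D where "D = (- x) \<cdot>\<^sub>m (- (char_matrix L (- 1 / x)))"
  have D: "D \<in> carrier_mat n n" using L by (simp add: D_def char_matrix_def)
  have Dij: "D $$ (i, j) = lap_fun x E i j" if "i < n" "j < n" for i j
  proof -
    have "D $$ (i, j) = x * L $$ (i, j) + (if i = j then 1 else 0)"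
      using that x carrier_matD[OF L] by (simp add: D_def char_matrix_def algebra_simps)
    then show ?thesis
      by (simp add: entry[OF that] lap_fun_def)
  qed
  have "(\<Sum>k\<le>n. real_of_int (lap_coeff G k) * x ^ k) = (\<Sum>k\<le>n. coeff P (n - k) * (- x) ^ k)"
    by (simp add: lap_coeff_def n coeffP power_minus[of x] mult_ac)
  also have "\<dots> = (\<Sum>j\<le>n. coeff P j * (- x) ^ (n - j))"
    by (rule sum.reindex_bij_witness[where i = "\<lambda>j. n - j" and j = "\<lambda>j. n - j"]) auto
  also have "\<dots> = (\<Sum>j\<le>n. (- x) ^ n * (coeff P j * (- 1 / x) ^ j))"
  proof (rule sum.cong)
    fix j assume "j \<in> {..n}"
    then have "(- x) ^ n = (- x) ^ (n - j) * (- x) ^ j" by (simp add: power_add[symmetric])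
    moreover have "(- x) ^ j * (- 1 / x) ^ j = 1" using x by (simp add: power_mult_distrib[symmetric])
    ultimately show "coeff P j * (- x) ^ (n - j) = (- x) ^ n * (coeff P j * (- 1 / x) ^ j)"
      by (simp add: mult_ac)
  qed simp
  also have "\<dots> = (- x) ^ n * poly P (- 1 / x)"
    by (simp add: poly_altdef deg sum_distrib_left)
  also have "\<dots> = det D"
    unfolding D_def P_def char_poly_matrix[OF L] using L by (simp add: char_matrix_def)
  also have "\<dots> = det_on {0..<n} (lap_fun x E)"
    unfolding det_def'[OF D] det_on_def
    by (intro sum.cong refl arg_cong2[of _ _ _ _ "(*)"] prod.cong)
      (auto simp: Dij permutes_in_image)
  finally show ?thesis .
qed

lemma wf_tree_irrefl: "wf_tree T \<Longrightarrow> (i, i) \<notin> edges T"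
proof (induction T)
  case (Join T C)
  then have "root_of T \<noteq> root_of C"
    using root_in_set[of T] root_in_set[of C] by (metis disjoint_iff wf_tree.simps(2))
  with Join show ?case by simp
qed simp

lemma wf_tri_irrefl:
  assumes "wf_tri T1 T2 T3"
  shows "(i, i) \<notin> tri_edges T1 T2 T3"
  using assms wf_tri_roots[OF assms] wf_tree_irrefl[of T1] wf_tree_irrefl[of T2] wf_tree_irrefl[of T3]
  by (auto simp: wf_tri_def tri_edges_def)

text \<open>The elimination divides by pivots that are known to be nonzero for positive
  \<open>x\<close>; agreement on all positive numbers is enough for equality of polynomials.\<close>

lemma lap_poly_tri_graph:
  assumes wf: "wf_tri T1 T2 T3" and n: "tri_verts T1 T2 T3 = {0..<n}"
  shows "(\<Sum>k\<le>n. monom (real_of_int (lap_coeff (tri_graph T1 T2 T3) k)) k) =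
    tri_total (pair_of T1) (pair_of T2) (pair_of T3)"
proof (rule poly_eq_on_positive)
  fix x :: real assume x: "x > 0"
  have "(\<Sum>k\<le>n. real_of_int (lap_coeff (tri_graph T1 T2 T3) k) * x ^ k) =
    det_on {0..<n} (lap_fun x (tri_edges T1 T2 T3))"
    by (rule lap_coeff_poly[OF _ _ wf_tri_irrefl[OF wf] x]) (simp_all add: tri_graph_def n)
  then show "poly (\<Sum>k\<le>n. monom (real_of_int (lap_coeff (tri_graph T1 T2 T3) k)) k) x =
    poly (tri_total (pair_of T1) (pair_of T2) (pair_of T3)) x"
    using det_on_tri[OF wf x] by (simp add: n poly_sum poly_monom)
qed

lemma lap_coeff_tri_graph:
  assumes "wf_tri T1 T2 T3" "tri_verts T1 T2 T3 = {0..<n}" "k \<le> n"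
  shows "real_of_int (lap_coeff (tri_graph T1 T2 T3) k) =
    coeff (tri_total (pair_of T1) (pair_of T2) (pair_of T3)) k"
  unfolding lap_poly_tri_graph[OF assms(1,2), symmetric] using assms(3) by (simp add: coeff_sum)

text \<open>Guarantees that a nonzero difference of two such polynomials shows at an index
  \<open>k \<le> n\<close>, as \<open>lap_less\<close> demands.\<close>

lemma coeff_tri_total_eq_0:
  assumes "wf_tri T1 T2 T3" "tri_verts T1 T2 T3 = {0..<n}" "n < k"
  shows "coeff (tri_total (pair_of T1) (pair_of T2) (pair_of T3)) k = 0"
  unfolding lap_poly_tri_graph[OF assms(1,2), symmetric] using assms(3)
  by (auto simp: coeff_sum intro!: sum.neutral)

section \<open>Graphs with a single triangle\<close>

lemma finite_tri_verts [simp]: "finite (tri_verts T1 T2 T3)"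
  by (simp add: tri_verts_def)

lemma tri_edges_in: "(i, j) \<in> tri_edges T1 T2 T3 \<Longrightarrow> i \<in> tri_verts T1 T2 T3 \<and> j \<in> tri_verts T1 T2 T3"
  using edges_in[of i j] root_in_set[of T1] root_in_set[of T2] root_in_set[of T3]
  unfolding tri_edges_def tri_verts_def by fast

lemma pair_graph_tri_graph:
  assumes wf: "wf_tri T1 T2 T3"
  shows "pair_graph (tri_graph T1 T2 T3)"
proof unfold_locales
  show "finite (parcs (tri_graph T1 T2 T3))"
    by (simp add: tri_graph_def tri_edges_def)
  show "symmetric (with_proj (tri_graph T1 T2 T3))"
    by (auto simp: symmetric_def sym_def tri_graph_def)
next
  fix e assume e: "e \<in> parcs (tri_graph T1 T2 T3)"
  then show "fst e \<in> pverts (tri_graph T1 T2 T3)" "snd e \<in> pverts (tri_graph T1 T2 T3)"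
    by (cases e; auto simp: tri_graph_def dest: tri_edges_in)+
  show "fst e \<noteq> snd e"
    using e wf_tri_irrefl[OF wf] by (cases e) (auto simp: tri_graph_def)
qed (simp add: tri_graph_def)

lemma rtrancl_on_tree:
  assumes "edges T \<subseteq> S" "set_rtree T \<subseteq> W" "i \<in> set_rtree T"
  shows "(root_of T, i) \<in> rtrancl_on W S"
  using assms
proof (induction T)
  case (Join T C)
  show ?case
  proof (cases "i \<in> set_rtree T")
    case True
    with Join show ?thesis by auto
  next
    case False
    with Join.prems have "i \<in> set_rtree C" by auto
    with Join have "(root_of C, i) \<in> rtrancl_on W S" by auto
    moreover have "(root_of T, root_of C) \<in> S" "root_of T \<in> W"
      using Join.prems root_in_set[of T] by auto
    ultimately show ?thesis
      using converse_rtrancl_on_into_rtrancl_on[of "root_of T" "root_of C" S i W] by simp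
  qed
qed auto

lemma rtrancl_on_tri:
  assumes "i \<in> tri_verts T1 T2 T3" "j \<in> tri_verts T1 T2 T3"
  shows "(i, j) \<in> rtrancl_on (tri_verts T1 T2 T3) (tri_edges T1 T2 T3 \<union> (tri_edges T1 T2 T3)\<inverse>)"
proof -
  define S where "S = tri_edges T1 T2 T3 \<union> (tri_edges T1 T2 T3)\<inverse>"
  define W where "W = tri_verts T1 T2 T3"
  have from_root: "(root_of T1, i) \<in> rtrancl_on W S" if "i \<in> W" for i
  proof -
    have r: "root_of T1 \<in> W" "root_of T2 \<in> W" "root_of T3 \<in> W" by (auto simp: W_def tri_verts_def)
    have s: "(root_of T1, root_of T2) \<in> S" "(root_of T1, root_of T3) \<in> S" by (auto simp: S_def tri_edges_def)
    have "edges T1 \<subseteq> S" "edges T2 \<subseteq> S" "edges T3 \<subseteq> S" by (auto simp: S_def tri_edges_def)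
    moreover have "set_rtree T1 \<subseteq> W" "set_rtree T2 \<subseteq> W" "set_rtree T3 \<subseteq> W"
      by (auto simp: W_def tri_verts_def)
    ultimately have "i \<in> set_rtree T1 \<Longrightarrow> (root_of T1, i) \<in> rtrancl_on W S"
      "i \<in> set_rtree T2 \<Longrightarrow> (root_of T2, i) \<in> rtrancl_on W S"
      "i \<in> set_rtree T3 \<Longrightarrow> (root_of T3, i) \<in> rtrancl_on W S"
      by (auto intro: rtrancl_on_tree)
    moreover have "i \<in> set_rtree T1 \<or> i \<in> set_rtree T2 \<or> i \<in> set_rtree T3"
      using that by (auto simp: W_def tri_verts_def)
    ultimately show ?thesis
      using r s by (meson converse_rtrancl_on_into_rtrancl_on)
  qed
  have "(root_of T1, i) \<in> rtrancl_on W S" "(root_of T1, j) \<in> rtrancl_on W S"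
    using from_root assms by (auto simp: W_def)
  moreover have "S\<inverse> = S" by (auto simp: S_def)
  ultimately have "(i, root_of T1) \<in> rtrancl_on W S"
    using rtrancl_on_converseI[of "root_of T1" i W S] by simp
  then show ?thesis
    using \<open>(root_of T1, j) \<in> _\<close> unfolding S_def W_def by (rule rtrancl_on_trans)
qed

lemma connected_tri_graph: "Digraph_Component.connected (with_proj (tri_graph T1 T2 T3))"
proof -
  have "(tri_edges T1 T2 T3 \<union> (tri_edges T1 T2 T3)\<inverse>)\<^sup>s = tri_edges T1 T2 T3 \<union> (tri_edges T1 T2 T3)\<inverse>"
    by (auto simp: symcl_def)
  moreover have "tri_verts T1 T2 T3 \<noteq> {}"
    using root_in_set[of T1] unfolding tri_verts_def by blast
  ultimately show ?thesis
    unfolding connected_conv using rtrancl_on_tri[of _ T1 T2 T3] by (simp add: tri_graph_def)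
qed

section \<open>Cycles as cyclic lists of arcs\<close>

definition cyclic_list :: "('a \<times> 'a) list \<Rightarrow> bool" where
  "cyclic_list p \<longleftrightarrow> p \<noteq> [] \<and> distinct (map snd p) \<and>
     (\<forall>i<length p. snd (p ! i) = fst (p ! (Suc i mod length p)))"

lemma pcas_conv:
  "p \<noteq> [] \<Longrightarrow> pcas u p v \<longleftrightarrow> u = fst (hd p) \<and> snd (last p) = v \<and>
     (\<forall>i. Suc i < length p \<longrightarrow> snd (p ! i) = fst (p ! Suc i))"
proof (induction p arbitrary: u)
  case (Cons e p)
  show ?case
  proof (cases "p = []")
    case False
    have "(\<forall>i. Suc i < length (e # p) \<longrightarrow> snd ((e # p) ! i) = fst ((e # p) ! Suc i)) \<longleftrightarrow>
      snd e = fst (hd p) \<and> (\<forall>i. Suc i < length p \<longrightarrow> snd (p ! i) = fst (p ! Suc i))"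
      using False by (auto simp: hd_conv_nth nth_Cons split: nat.splits)
    with Cons.IH[OF False] False show ?thesis by auto
  qed auto
qed simp

lemma pawalk_verts_conv: "pcas u p v \<Longrightarrow> pawalk_verts u p = u # map snd p"
  by (induction p arbitrary: u) auto

lemma graph_cycle_iff:
  assumes "pair_wf_digraph G"
  shows "graph_cycle G p \<longleftrightarrow> set p \<subseteq> parcs G \<and> cyclic_list p \<and> 3 \<le> length p"
proof (cases "p = []")
  case False
  have wrap: "(\<forall>i<length p. snd (p ! i) = fst (p ! (Suc i mod length p))) \<longleftrightarrow>
    snd (last p) = fst (hd p) \<and> (\<forall>i. Suc i < length p \<longrightarrow> snd (p ! i) = fst (p ! Suc i))" (is "?L \<longleftrightarrow> ?R")
  proof
    assume L: ?L
    show ?R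
      using L[rule_format, of "length p - 1"] L False
      by (auto simp: last_conv_nth hd_conv_nth)
  next
    assume R: ?R
    show ?L
    proof (intro allI impI)
      fix i assume "i < length p"
      then consider "Suc i < length p" | "i = length p - 1" by linarith
      then show "snd (p ! i) = fst (p ! (Suc i mod length p))"
        using R False by cases (auto simp: last_conv_nth hd_conv_nth)
    qed
  qed
  have "pre_digraph.cycle (with_proj G) p \<longleftrightarrow> set p \<subseteq> parcs G \<and> cyclic_list p"
  proof
    assume "pre_digraph.cycle (with_proj G) p"
    then obtain u where u: "set p \<subseteq> parcs G" "pcas u p u" "distinct (tl (pawalk_verts u p))"
      unfolding pre_digraph.cycle_def pre_digraph.awalk_def
      by (auto simp: cas_with_proj_eq awalk_verts_with_proj_eq)
    then have "distinct (map snd p)" by (simp add: pawalk_verts_conv)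
    moreover have "\<forall>i<length p. snd (p ! i) = fst (p ! (Suc i mod length p))"
      unfolding wrap using u(2) unfolding pcas_conv[OF False] by auto
    ultimately show "set p \<subseteq> parcs G \<and> cyclic_list p"
      using u(1) False by (simp add: cyclic_list_def)
  next
    assume *: "set p \<subseteq> parcs G \<and> cyclic_list p"
    then have "snd (last p) = fst (hd p)" "\<forall>i. Suc i < length p \<longrightarrow> snd (p ! i) = fst (p ! Suc i)"
      using wrap by (auto simp: cyclic_list_def)
    then have cas: "pcas (fst (hd p)) p (fst (hd p))"
      unfolding pcas_conv[OF False] by auto
    have "hd p \<in> parcs G" using * False hd_in_set by blast
    then have "fst (hd p) \<in> pverts G" using assms by (simp add: pair_wf_digraph.arc_fst_in_verts)
    moreover have "distinct (tl (pawalk_verts (fst (hd p)) p))"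
      using * cas by (simp add: pawalk_verts_conv cyclic_list_def)
    ultimately show "pre_digraph.cycle (with_proj G) p"
      unfolding pre_digraph.cycle_def pre_digraph.awalk_def
      using * cas False by (auto simp: cas_with_proj_eq awalk_verts_with_proj_eq)
  qed
  then show ?thesis by (auto simp: graph_cycle_def)
qed (auto simp: graph_cycle_def)

text \<open>The predecessor and the successor of \<open>z\<close> on the cycle. They differ because
  the length is at least 3, which excludes going back and forth along one edge.\<close>

lemma cyclic_list_neighbours:
  assumes p: "cyclic_list p" "3 \<le> length p" and z: "z \<in> snd ` set p"
  shows "\<exists>y1 y2. y1 \<noteq> y2 \<and> y1 \<in> snd ` set p \<and> y2 \<in> snd ` set p \<and> (y1, z) \<in> set p \<and> (z, y2) \<in> set p"
proof -
  define n where "n = length p"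
  have n: "3 \<le> n" using p by (simp add: n_def)
  have nxt: "i < n \<Longrightarrow> snd (p ! i) = fst (p ! (Suc i mod n))" for i
    using p by (simp add: cyclic_list_def n_def)
  have inj: "i < n \<Longrightarrow> j < n \<Longrightarrow> snd (p ! i) = snd (p ! j) \<Longrightarrow> i = j" for i j
    using p nth_eq_iff_index_eq[of "map snd p" i j] by (simp add: cyclic_list_def n_def)
  obtain j where j: "j < n" "z = snd (p ! j)"
    using z by (auto simp: in_set_conv_nth n_def)
  \<comment> \<open>The cyclic predecessor of \<open>j\<close>: adding \<open>n - 1\<close>
    subtracts one modulo \<open>n\<close>.\<close>
  define i where "i = (j + (n - 1)) mod n"
  define k where "k = Suc j mod n"
  have i: "i < n" "Suc i mod n = j"
    using n j by (simp_all add: i_def mod_Suc_eq)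
  have k: "k < n" using n by (simp add: k_def)
  have "i \<noteq> k"
  proof
    assume "i = k"
    then have "j = Suc (Suc j mod n) mod n" using i by (simp add: k_def)
    then have "j = Suc (Suc j) mod n" by (simp add: mod_Suc_eq)
    with n j(1) show False
      by (cases "Suc (Suc j) < n") (auto simp: mod_if split: if_splits)
  qed
  then have "snd (p ! i) \<noteq> snd (p ! k)" using inj i k by blast
  moreover have "(snd (p ! i), z) = p ! j" using nxt[OF i(1)] i(2) j(2) by simp
  moreover have "(z, snd (p ! k)) = p ! k" using nxt[OF j(1)] j(2) by (simp add: k_def)
  ultimately show ?thesis
    using i(1) j(1) k by (metis n_def nth_mem image_eqI)
qed


section \<open>Depth in the trees, and uniqueness of the cycle\<close>

primrec depth :: "'a rtree \<Rightarrow> 'a \<Rightarrow> nat" where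
  "depth (Vtx v) i = 0"
| "depth (Join T C) i = (if i \<in> set_rtree C then Suc (depth C i) else depth T i)"

lemma not_edge_to_root: "wf_tree T \<Longrightarrow> (i, root_of T) \<notin> edges T"
proof (induction T)
  case (Join T C)
  then have "root_of T \<notin> set_rtree C"
    using root_in_set[of T] by (metis disjoint_iff wf_tree.simps(2))
  with Join show ?case using root_in_set[of C] by (auto dest: edges_in)
qed simp

lemma parent_unique:
  "wf_tree T \<Longrightarrow> (i, k) \<in> edges T \<Longrightarrow> (j, k) \<in> edges T \<Longrightarrow> i = j"
proof (induction T)
  case (Join T C)
  have disj: "set_rtree T \<inter> set_rtree C = {}" using Join.prems by simp
  show ?case
  proof (cases "k \<in> set_rtree C")
    case True
    then have "(i, k) \<notin> edges T" "(j, k) \<notin> edges T" using disj by (auto dest: edges_in)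
    with Join.prems have "k = root_of C \<and> i = root_of T \<or> (i, k) \<in> edges C"
      "k = root_of C \<and> j = root_of T \<or> (j, k) \<in> edges C" by auto
    with Join.IH(2) Join.prems(1) not_edge_to_root[of C] show ?thesis by auto
  next
    case False
    then have "(i, k) \<notin> edges C" "(j, k) \<notin> edges C" "k \<noteq> root_of C" by (auto dest: edges_in)
    with Join.IH(1) Join.prems show ?thesis by auto
  qed
qed simp

lemma depth_root: "wf_tree T \<Longrightarrow> depth T (root_of T) = 0"
proof (induction T)
  case (Join T C)
  then have "root_of T \<notin> set_rtree C"
    using root_in_set[of T] by (metis disjoint_iff wf_tree.simps(2))
  with Join show ?case by simp
qed simp

lemma depth_edge: "wf_tree T \<Longrightarrow> (i, j) \<in> edges T \<Longrightarrow> depth T i < depth T j"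
proof (induction T)
  case (Join T C)
  have disj: "set_rtree T \<inter> set_rtree C = {}" using Join.prems by simp
  then have "root_of T \<notin> set_rtree C" using root_in_set[of T] by (metis disjoint_iff)
  then show ?case
    using Join disj depth_root[of T] by (auto dest: edges_in)
qed simp

definition tri_depth :: "'a rtree \<Rightarrow> 'a rtree \<Rightarrow> 'a rtree \<Rightarrow> 'a \<Rightarrow> nat" where
  "tri_depth T1 T2 T3 i =
     (if i \<in> set_rtree T1 then depth T1 i else if i \<in> set_rtree T2 then depth T2 i else depth T3 i)"

lemma tri_depth_rotate: "wf_tri T1 T2 T3 \<Longrightarrow> i \<in> tri_verts T1 T2 T3 \<Longrightarrow>
    tri_depth T2 T3 T1 i = tri_depth T1 T2 T3 i"
  by (auto simp: tri_depth_def wf_tri_def tri_verts_def)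

text \<open>Only the parent of \<open>z\<close> fails to be deeper than \<open>z\<close>, and the
  parent is unique.\<close>

lemma deeper_neighbour1:
  assumes wf: "wf_tri T1 T2 T3" and z: "z \<in> set_rtree T1" "z \<noteq> root_of T1"
    and y: "adj (tri_edges T1 T2 T3) z y" "adj (tri_edges T1 T2 T3) z y'" "y \<noteq> y'"
  shows "tri_depth T1 T2 T3 z < tri_depth T1 T2 T3 y \<or> tri_depth T1 T2 T3 z < tri_depth T1 T2 T3 y'"
proof -
  have "wf_tree T1" using wf by (simp add: wf_tri_def)
  have "adj (edges T1) z y" "adj (edges T1) z y'"
    using y z adj_tri_edges[OF wf z(1)] by auto
  then have "(z, y) \<in> edges T1 \<or> (z, y') \<in> edges T1"
    using y(3) parent_unique[OF \<open>wf_tree T1\<close>] by (auto simp: adj_def)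
  then show ?thesis
    using depth_edge[OF \<open>wf_tree T1\<close>] z by (auto simp: tri_depth_def dest: edges_in)
qed

lemma adj_tri_edges_in: "adj (tri_edges T1 T2 T3) i j \<Longrightarrow> j \<in> tri_verts T1 T2 T3"
  by (auto simp: adj_def dest: tri_edges_in)

lemma deeper_neighbour:
  assumes wf: "wf_tri T1 T2 T3" and z: "z \<in> tri_verts T1 T2 T3" "z \<notin> {root_of T1, root_of T2, root_of T3}"
    and y: "adj (tri_edges T1 T2 T3) z y" "adj (tri_edges T1 T2 T3) z y'" "y \<noteq> y'"
  shows "tri_depth T1 T2 T3 z < tri_depth T1 T2 T3 y \<or> tri_depth T1 T2 T3 z < tri_depth T1 T2 T3 y'"
proof -
  have wf': "wf_tri T2 T3 T1" "wf_tri T3 T1 T2" using wf wf_tri_rotate by blast+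
  have V: "tri_verts T2 T3 T1 = tri_verts T1 T2 T3" "tri_verts T3 T1 T2 = tri_verts T1 T2 T3"
    by (metis tri_verts_rotate)+
  have E: "tri_edges T2 T3 T1 = tri_edges T1 T2 T3" "tri_edges T3 T1 T2 = tri_edges T1 T2 T3"
    by (metis tri_edges_rotate)+
  have yV: "y \<in> tri_verts T1 T2 T3" "y' \<in> tri_verts T1 T2 T3" using adj_tri_edges_in[OF y(1)] adj_tri_edges_in[OF y(2)] .
  have D: "tri_depth T2 T3 T1 i = tri_depth T1 T2 T3 i" "tri_depth T3 T1 T2 i = tri_depth T1 T2 T3 i"
    if "i \<in> tri_verts T1 T2 T3" for i
  proof -
    show 1: "tri_depth T2 T3 T1 i = tri_depth T1 T2 T3 i" by (rule tri_depth_rotate[OF wf that])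
    have "i \<in> tri_verts T2 T3 T1" using that V by simp
    from tri_depth_rotate[OF wf'(1) this] 1
    show "tri_depth T3 T1 T2 i = tri_depth T1 T2 T3 i" by simp
  qed
  consider "z \<in> set_rtree T1" | "z \<in> set_rtree T2" | "z \<in> set_rtree T3"
    using z by (auto simp: tri_verts_def)
  then show ?thesis
  proof cases
    case 1
    then show ?thesis using deeper_neighbour1[OF wf] z y by simp
  next
    case 2
    then show ?thesis using deeper_neighbour1[OF wf'(1), of z y y'] z y by (simp add: E D yV)
  next
    case 3
    then show ?thesis using deeper_neighbour1[OF wf'(2), of z y y'] z y by (simp add: E D yV)
  qed
qed

definition triangle_arcs :: "'a \<Rightarrow> 'a \<Rightarrow> 'a \<Rightarrow> 'a rel" where
  "triangle_arcs a b c = {(a, b), (b, c), (c, a), (b, a), (c, b), (a, c)}"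

lemma cyclic_list_in_triangle:
  assumes p: "cyclic_list p" "3 \<le> length p" and sub: "snd ` set p \<subseteq> {a, b, c}"
  shows "length p = 3 \<and> set p \<union> (set p)\<inverse> = triangle_arcs a b c"
proof -
  have "distinct (map snd p)" using p by (simp add: cyclic_list_def)
  then have card: "card (snd ` set p) = length p"
    by (metis distinct_card length_map set_map)
  have "card {a, b, c} \<le> 3"
    by (simp add: card_insert_if)
  moreover have "card (snd ` set p) \<le> card {a, b, c}" using sub by (intro card_mono) auto
  ultimately have len: "length p = 3" using card p by linarith
  then obtain e0 e1 e2 where pe: "p = [e0, e1, e2]"
    by (auto simp: numeral_3_eq_3 length_Suc_conv)
  define x y z where "x = snd e0" "y = snd e1" "z = snd e2"
  have "snd e0 = fst e1 \<and> snd e1 = fst e2 \<and> snd e2 = fst e0"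
  proof -
    have nxt: "snd (p ! i) = fst (p ! (Suc i mod length p))" if "i < length p" for i
      using p that by (simp add: cyclic_list_def)
    show ?thesis
      using nxt[of 0] nxt[of 1] nxt[of 2] by (simp add: pe)
  qed
  then have e: "e0 = (z, x)" "e1 = (x, y)" "e2 = (y, z)"
    by (simp_all add: x_y_z_def prod_eq_iff)
  have "x \<noteq> y" "x \<noteq> z" "y \<noteq> z" using p unfolding pe cyclic_list_def e by auto
  moreover have "{x, y, z} \<subseteq> {a, b, c}" using sub unfolding pe e by auto
  ultimately have "set p \<union> (set p)\<inverse> = triangle_arcs a b c"
    unfolding pe e triangle_arcs_def by auto
  with len show ?thesis by simp
qed

text \<open>If the cycle left the triangle, a deepest such vertex would have two distinct neighbours
  on the cycle, one of them deeper still. The corners have depth 0, so they do not disturb the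
  maximum.\<close>

lemma graph_cycle_tri_graph:
  assumes wf: "wf_tri T1 T2 T3" and p: "graph_cycle (tri_graph T1 T2 T3) p"
  shows "length p = 3 \<and> set p \<union> (set p)\<inverse> = triangle_arcs (root_of T1) (root_of T2) (root_of T3)"
proof -
  have pw: "pair_wf_digraph (tri_graph T1 T2 T3)"
    using pair_graph_tri_graph[OF wf] by (simp add: pair_graph_def pair_digraph_def pair_fin_digraph_def)
  have sub: "set p \<subseteq> parcs (tri_graph T1 T2 T3)" and cyc: "cyclic_list p" "3 \<le> length p"
    using p graph_cycle_iff[OF pw] by auto
  have adj: "adj (tri_edges T1 T2 T3) i j" "adj (tri_edges T1 T2 T3) j i" if "(i, j) \<in> set p" for i j
    using sub that by (auto simp: tri_graph_def adj_def)
  have "snd ` set p \<subseteq> {root_of T1, root_of T2, root_of T3}"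
  proof (rule ccontr)
    define Z where "Z = snd ` set p - {root_of T1, root_of T2, root_of T3}"
    assume "\<not> snd ` set p \<subseteq> {root_of T1, root_of T2, root_of T3}"
    then have Z: "finite (tri_depth T1 T2 T3 ` Z)" "tri_depth T1 T2 T3 ` Z \<noteq> {}" by (auto simp: Z_def)
    from Max_in[OF Z] obtain z where z: "z \<in> Z" "Max (tri_depth T1 T2 T3 ` Z) = tri_depth T1 T2 T3 z" by auto
    have max: "tri_depth T1 T2 T3 y \<le> tri_depth T1 T2 T3 z" if "y \<in> snd ` set p" for y
    proof (cases "y \<in> Z")
      case True
      then show ?thesis using Max_ge[OF Z(1), of "tri_depth T1 T2 T3 y"] z by auto
    next
      case False
      then have "y = root_of T1 \<or> y = root_of T2 \<or> y = root_of T3" using that by (auto simp: Z_def)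
      then have "tri_depth T1 T2 T3 y = 0"
        using wf wf_tri_roots[OF wf] wf_tri_roots[of T2 T3 T1] by (auto simp: tri_depth_def wf_tri_def depth_root)
      then show ?thesis by simp
    qed
    obtain y y' where y: "y \<noteq> y'" "y \<in> snd ` set p" "y' \<in> snd ` set p" "(y, z) \<in> set p" "(z, y') \<in> set p"
      using cyclic_list_neighbours[OF cyc, of z] z by (auto simp: Z_def)
    have "tri_depth T1 T2 T3 z < tri_depth T1 T2 T3 y \<or> tri_depth T1 T2 T3 z < tri_depth T1 T2 T3 y'"
      by (rule deeper_neighbour[OF wf _ _ adj(2)[OF y(4)] adj(1)[OF y(5)] y(1)])
        (use z adj_tri_edges_in[OF adj(1)[OF y(4)]] in \<open>auto simp: Z_def\<close>)
    with max[OF y(2)] max[OF y(3)] show False by simp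
  qed
  with cyclic_list_in_triangle[OF cyc] show ?thesis by blast
qed

lemma pair_wf_digraph_tri_graph: "wf_tri T1 T2 T3 \<Longrightarrow> pair_wf_digraph (tri_graph T1 T2 T3)"
  using pair_graph_tri_graph by (simp add: pair_graph_def pair_digraph_def pair_fin_digraph_def)

lemma graph_cycle_triangle:
  assumes "wf_tri T1 T2 T3"
  shows "graph_cycle (tri_graph T1 T2 T3) [(root_of T1, root_of T2), (root_of T2, root_of T3), (root_of T3, root_of T1)]"
  unfolding graph_cycle_iff[OF pair_wf_digraph_tri_graph[OF assms]] cyclic_list_def
  using wf_tri_roots[OF assms]
  by (auto simp: tri_graph_def tri_edges_def less_Suc_eq)

lemma girth_tri_graph:
  assumes "wf_tri T1 T2 T3"
  shows "girth (tri_graph T1 T2 T3) = 3"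
  unfolding girth_def
proof (rule Least_equality)
  show "\<exists>p. graph_cycle (tri_graph T1 T2 T3) p \<and> length p = 3"
    using graph_cycle_triangle[OF assms] by (intro exI conjI) (assumption, simp)
next
  fix k assume "\<exists>p. graph_cycle (tri_graph T1 T2 T3) p \<and> length p = k"
  then show "3 \<le> k" by (auto simp: graph_cycle_def)
qed

lemma unicyclic_tri_graph:
  assumes "wf_tri T1 T2 T3"
  shows "unicyclic (tri_graph T1 T2 T3)"
  unfolding unicyclic_def
proof (rule ex1I)
  show "\<exists>p. graph_cycle (tri_graph T1 T2 T3) p \<and> triangle_arcs (root_of T1) (root_of T2) (root_of T3) = set p \<union> (set p)\<inverse>"
    using graph_cycle_triangle[OF assms] graph_cycle_tri_graph[OF assms] by metis
next
  fix C assume "\<exists>p. graph_cycle (tri_graph T1 T2 T3) p \<and> C = set p \<union> (set p)\<inverse>"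
  then show "C = triangle_arcs (root_of T1) (root_of T2) (root_of T3)"
    using graph_cycle_tri_graph[OF assms] by auto
qed

text \<open>The root is left out because its degree depends on what the tree is attached to: below a
  parent it is a leaf iff the tree is a single vertex, and at a corner of the triangle it never
  is.\<close>

definition tree_leaves :: "'a rtree \<Rightarrow> 'a set" where
  "tree_leaves T = {i \<in> set_rtree T - {root_of T}. deg T i = 1}"

lemma deg_root_0: "wf_tree T \<Longrightarrow> deg T (root_of T) = 0 \<longleftrightarrow> nleaves T = 0"
  by (cases T) auto

lemma card_tree_leaves: "wf_tree T \<Longrightarrow> card (tree_leaves T) = nleaves T"
proof (induction T)
  case (Join T C)
  have disj: "set_rtree T \<inter> set_rtree C = {}" using Join.prems by simp
  have rC: "root_of C \<notin> set_rtree T" using disj root_in_set[of C] by (metis disjoint_iff)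
  have rT: "root_of T \<notin> set_rtree C" using disj root_in_set[of T] by (metis disjoint_iff)
  have mem: "i \<in> set_rtree T \<Longrightarrow> i \<notin> set_rtree C" for i using disj by auto
  have d0: "deg C (root_of C) = 0 \<longleftrightarrow> nleaves C = 0" using deg_root_0 Join.prems by auto
  have eq: "tree_leaves (Join T C) = tree_leaves T \<union> (tree_leaves C \<union> (if nleaves C = 0 then {root_of C} else {}))"
    using rC rT d0 mem by (auto simp: tree_leaves_def split: if_splits)
  have fin: "finite (tree_leaves T)" for T :: "'a rtree" by (simp add: tree_leaves_def)
  have "tree_leaves T \<inter> (tree_leaves C \<union> (if nleaves C = 0 then {root_of C} else {})) = {}"
    using disj rC by (auto simp: tree_leaves_def)
  then have "card (tree_leaves (Join T C)) = card (tree_leaves T) + card (tree_leaves C \<union> (if nleaves C = 0 then {root_of C} else {}))"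
    unfolding eq using fin by (intro card_Un_disjoint) auto
  also have "card (tree_leaves C \<union> (if nleaves C = 0 then {root_of C} else {})) = card (tree_leaves C) + (if nleaves C = 0 then 1 else 0)"
    by (subst card_Un_disjoint) (auto simp: fin, auto simp: tree_leaves_def)
  finally show ?case using Join by simp
qed (simp add: tree_leaves_def)

lemma degree_of_tri_graph:
  "degree_of (tri_graph T1 T2 T3) i = card {j. adj (tri_edges T1 T2 T3) i j}"
proof -
  have "out_arcs (with_proj (tri_graph T1 T2 T3)) i = Pair i ` {j. adj (tri_edges T1 T2 T3) i j}"
    by (auto simp: out_arcs_def tri_graph_def adj_def)
  then show ?thesis
    by (simp add: degree_of_def out_degree_def card_image inj_on_def)
qed

lemma degree_of_tri_graph_eq_1:
  assumes "wf_tri T1 T2 T3" "i \<in> set_rtree T1"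
  shows "degree_of (tri_graph T1 T2 T3) i = 1 \<longleftrightarrow> i \<in> tree_leaves T1"
  unfolding degree_of_tri_graph card_adj_tri[OF assms] tree_leaves_def
  using assms(2) by (cases "i = root_of T1") auto

lemma card_leaves_tri_graph:
  assumes wf: "wf_tri T1 T2 T3"
  shows "card (leaves (tri_graph T1 T2 T3)) = nleaves T1 + nleaves T2 + nleaves T3"
proof -
  define G where "G = tri_graph T1 T2 T3"
  have wf': "wf_tri T2 T3 T1" "wf_tri T3 T1 T2" using wf by (metis wf_tri_rotate)+
  have G: "G = tri_graph T2 T3 T1" "G = tri_graph T3 T1 T2"
    unfolding G_def by (metis tri_graph_rotate)+
  have d: "i \<in> set_rtree T1 \<Longrightarrow> degree_of G i = 1 \<longleftrightarrow> i \<in> tree_leaves T1"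
    "i \<in> set_rtree T2 \<Longrightarrow> degree_of G i = 1 \<longleftrightarrow> i \<in> tree_leaves T2"
    "i \<in> set_rtree T3 \<Longrightarrow> degree_of G i = 1 \<longleftrightarrow> i \<in> tree_leaves T3" for i
    using degree_of_tri_graph_eq_1[OF wf, of i] degree_of_tri_graph_eq_1[OF wf'(1), of i]
      degree_of_tri_graph_eq_1[OF wf'(2), of i]
    unfolding G_def[symmetric] G(1)[symmetric] G(2)[symmetric] by blast+
  have sub: "tree_leaves T \<subseteq> set_rtree T" "finite (tree_leaves T)" for T :: "nat rtree"
    by (auto simp: tree_leaves_def)
  have "pverts G = tri_verts T1 T2 T3" by (simp add: G_def tri_graph_def)
  then have leaves: "leaves G = tree_leaves T1 \<union> tree_leaves T2 \<union> tree_leaves T3"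
    using d sub(1) unfolding leaves_def tri_verts_def by blast
  have "tree_leaves T1 \<inter> tree_leaves T2 = {}" "(tree_leaves T1 \<union> tree_leaves T2) \<inter> tree_leaves T3 = {}"
    using wf sub(1) unfolding wf_tri_def by blast+
  then have "card (leaves G) = card (tree_leaves T1) + card (tree_leaves T2) + card (tree_leaves T3)"
    unfolding leaves using sub(2) by (simp add: card_Un_disjoint)
  then show ?thesis
    using wf by (simp add: wf_tri_def card_tree_leaves G_def)
qed

lemma tri_graph_in_class:
  assumes wf: "wf_tri T1 T2 T3" and n: "tri_verts T1 T2 T3 = {0..<n}"
    and l: "nleaves T1 + nleaves T2 + nleaves T3 = l"
  shows "tri_graph T1 T2 T3 \<in> unicyclic_graphs n l 3"
  unfolding unicyclic_graphs_def graph_of_order_def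
  using pair_graph_tri_graph[OF wf] connected_tri_graph[of T1 T2 T3] unicyclic_tri_graph[OF wf]
    card_leaves_tri_graph[OF wf] girth_tri_graph[OF wf] n l
  by (simp add: tri_graph_def)

section \<open>Every unicyclic graph of girth 3 is a triangle with trees\<close>

lemma insert_pendant:
  "wf_tree T \<Longrightarrow> u \<in> set_rtree T \<Longrightarrow> w \<notin> set_rtree T \<Longrightarrow>
    \<exists>S. wf_tree S \<and> set_rtree S = insert w (set_rtree T) \<and> root_of S = root_of T \<and>
        edges S = insert (u, w) (edges T)"
proof (induction T)
  case (Vtx v)
  then show ?case by (intro exI[of _ "Join (Vtx v) (Vtx w)"]) auto
next
  case (Join T C)
  show ?case
  proof (cases "u \<in> set_rtree T")
    case True
    with Join obtain S where S: "wf_tree S" "set_rtree S = insert w (set_rtree T)" "root_of S = root_of T"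
      "edges S = insert (u, w) (edges T)" by auto
    with Join.prems show ?thesis
      by (intro exI[of _ "Join S C"]) auto
  next
    case False
    with Join obtain S where S: "wf_tree S" "set_rtree S = insert w (set_rtree C)" "root_of S = root_of C"
      "edges S = insert (u, w) (edges C)" by auto
    with Join.prems show ?thesis
      by (intro exI[of _ "Join T S"]) auto
  qed
qed

definition extends_tri where
  "extends_tri T1 T2 T3 u w S1 S2 S3 \<longleftrightarrow>
    wf_tri S1 S2 S3 \<and> tri_verts S1 S2 S3 = insert w (tri_verts T1 T2 T3) \<and>
    root_of S1 = root_of T1 \<and> root_of S2 = root_of T2 \<and> root_of S3 = root_of T3 \<and>
    tri_edges S1 S2 S3 = insert (u, w) (tri_edges T1 T2 T3)"

lemma extends_tri_rotate: "extends_tri T2 T3 T1 u w S2 S3 S1 = extends_tri T1 T2 T3 u w S1 S2 S3"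
  unfolding extends_tri_def
  using tri_verts_rotate[of T2 T3 T1] tri_edges_rotate[of T2 T3 T1] tri_verts_rotate[of S2 S3 S1]
    tri_edges_rotate[of S2 S3 S1] wf_tri_rotate[of S2 S3 S1] by auto

lemma insert_pendant_tri1:
  assumes wf: "wf_tri T1 T2 T3" and u: "u \<in> set_rtree T1" and w: "w \<notin> tri_verts T1 T2 T3"
  shows "\<exists>S. extends_tri T1 T2 T3 u w S T2 T3"
proof -
  have w': "w \<notin> set_rtree T1" "w \<notin> set_rtree T2" "w \<notin> set_rtree T3" using w by (auto simp: tri_verts_def)
  have "wf_tree T1" using wf by (auto simp: wf_tri_def)
  from insert_pendant[OF this u w'(1)] obtain S where S: "wf_tree S" "set_rtree S = insert w (set_rtree T1)"
    "root_of S = root_of T1" "edges S = insert (u, w) (edges T1)" by blast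
  have "wf_tri S T2 T3" using wf w' S by (simp add: wf_tri_def)
  moreover have "tri_verts S T2 T3 = insert w (tri_verts T1 T2 T3)" using S by (simp add: tri_verts_def)
  moreover have "tri_edges S T2 T3 = insert (u, w) (tri_edges T1 T2 T3)"
    using S by (simp add: tri_edges_def insert_commute)
  ultimately show ?thesis using S(3) unfolding extends_tri_def by blast
qed

lemma insert_pendant_tri:
  assumes wf: "wf_tri T1 T2 T3" and u: "u \<in> tri_verts T1 T2 T3" and w: "w \<notin> tri_verts T1 T2 T3"
  shows "\<exists>S1 S2 S3. extends_tri T1 T2 T3 u w S1 S2 S3"
proof -
  have wf': "wf_tri T2 T3 T1" "wf_tri T3 T1 T2" using wf by (metis wf_tri_rotate)+
  have w': "w \<notin> tri_verts T2 T3 T1" "w \<notin> tri_verts T3 T1 T2" using w by (metis tri_verts_rotate)+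
  consider "u \<in> set_rtree T1" | "u \<in> set_rtree T2" | "u \<in> set_rtree T3"
    using u by (auto simp: tri_verts_def)
  then show ?thesis
  proof cases
    case 1
    then show ?thesis using insert_pendant_tri1[OF wf _ w] by blast
  next
    case 2
    from insert_pendant_tri1[OF wf'(1) this w'(1)] obtain S where "extends_tri T2 T3 T1 u w S T3 T1" by blast
    then have "extends_tri T1 T2 T3 u w T1 S T3" using extends_tri_rotate by metis
    then show ?thesis by blast
  next
    case 3
    from insert_pendant_tri1[OF wf'(2) this w'(2)] obtain S where "extends_tri T3 T1 T2 u w S T1 T2" by blast
    then have "extends_tri T1 T2 T3 u w T1 T2 S" using extends_tri_rotate by metis
    then show ?thesis by blast
  qed
qed

lemma connected_leaves_subset:
  assumes "(a, b) \<in> rtrancl_on F r" "a \<in> A" "b \<notin> A"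
  shows "\<exists>u w. (u, w) \<in> r \<and> u \<in> A \<and> w \<notin> A \<and> w \<in> F"
  using assms by (induction rule: rtrancl_on_induct) auto

text \<open>Among the subgraphs that consist of the given triangle with trees, one with the most
  vertices is taken. It spans by connectedness, since otherwise a pendant vertex could be added. An
  arc of \<open>G\<close> outside it would close a path inside it to a second cycle.\<close>

lemma unicyclic_triangle_is_tri_graph:
  assumes G: "G \<in> unicyclic_graphs n l 3"
  shows "\<exists>T1 T2 T3. wf_tri T1 T2 T3 \<and> tri_verts T1 T2 T3 = {0..<n} \<and> G = tri_graph T1 T2 T3"
proof -
  have pg: "pair_graph G" and V: "pverts G = {0..<n}" and conn: "Digraph_Component.connected (with_proj G)"
    and uni: "unicyclic G" and girth: "girth G = 3"
    using G by (auto simp: unicyclic_graphs_def graph_of_order_def)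
  interpret pair_graph G by (rule pg)
  have pw: "pair_wf_digraph G" by unfold_locales
  have sym: "(i, j) \<in> parcs G \<Longrightarrow> (j, i) \<in> parcs G" for i j
    using pair_sym_arcs by (auto simp: symmetric_def sym_def)
  have fin: "finite {0..<n}" by simp
  have "\<exists>k p. graph_cycle G p \<and> length p = k"
    using uni unfolding unicyclic_def by blast
  then have "\<exists>p. graph_cycle G p \<and> length p = girth G"
    unfolding girth_def by (rule LeastI_ex)
  then obtain p where p: "graph_cycle G p" "length p = 3" using girth by auto
  then obtain e0 e1 e2 where pe: "p = [e0, e1, e2]"
    by (auto simp: numeral_3_eq_3 length_Suc_conv)
  define a b c where "a = snd e0" "b = snd e1" "c = snd e2"
  have cyc: "cyclic_list p" "set p \<subseteq> parcs G" using p graph_cycle_iff[OF pw] by auto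
  have nxt: "snd (p ! i) = fst (p ! (Suc i mod length p))" if "i < length p" for i
    using cyc that by (simp add: cyclic_list_def)
  have e: "e0 = (c, a)" "e1 = (a, b)" "e2 = (b, c)"
    using nxt[of 0] nxt[of 1] nxt[of 2] by (simp_all add: pe a_b_c_def prod_eq_iff)
  have abc: "a \<noteq> b" "a \<noteq> c" "b \<noteq> c" using cyc unfolding pe cyclic_list_def e by auto
  have abc_arcs: "(c, a) \<in> parcs G" "(a, b) \<in> parcs G" "(b, c) \<in> parcs G"
    using cyc(2) by (simp_all add: pe e)
  have abc_V: "a \<in> {0..<n}" "b \<in> {0..<n}" "c \<in> {0..<n}"
    using abc_arcs wellformed' V by metis+
  define Q where "Q = (\<lambda>(T1, T2, T3). wf_tri T1 T2 T3 \<and> tri_verts T1 T2 T3 \<subseteq> {0..<n} \<and>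
    tri_edges T1 T2 T3 \<subseteq> parcs G \<and> root_of T1 = a \<and> root_of T2 = b \<and> root_of T3 = c)"
  define f where "f = (\<lambda>(T1, T2, T3). card (tri_verts T1 T2 (T3 :: nat rtree)))"
  have "Q (Vtx a, Vtx b, Vtx c)"
    using abc abc_V abc_arcs by (auto simp: Q_def wf_tri_def tri_verts_def tri_edges_def)
  moreover have "\<forall>t. Q t \<longrightarrow> f t < Suc n"
    using card_mono[OF fin] by (auto simp: Q_def f_def less_Suc_eq_le)
  ultimately obtain t where t: "Q t" "\<forall>s. Q s \<longrightarrow> f s \<le> f t"
    using ex_has_greatest_nat[of Q _ f "Suc n"] by blast
  obtain T1 T2 T3 where t_eq: "t = (T1, T2, T3)" by (cases t)
  have wf: "wf_tri T1 T2 T3" and sub: "tri_verts T1 T2 T3 \<subseteq> {0..<n}" "tri_edges T1 T2 T3 \<subseteq> parcs G"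
    and roots: "root_of T1 = a" "root_of T2 = b" "root_of T3 = c"
    using t(1) by (auto simp: Q_def t_eq)
  have verts: "tri_verts T1 T2 T3 = {0..<n}"
  proof (rule ccontr)
    assume "tri_verts T1 T2 T3 \<noteq> {0..<n}"
    then obtain j where j: "j \<in> {0..<n}" "j \<notin> tri_verts T1 T2 T3" using sub by blast
    have aT: "a \<in> tri_verts T1 T2 T3" using root_in_set[of T1] roots by (auto simp: tri_verts_def)
    have "(a, j) \<in> rtrancl_on {0..<n} ((parcs G)\<^sup>s)"
      using conn j abc_V unfolding connected_conv by (simp add: V)
    moreover have "(parcs G)\<^sup>s = parcs G" using sym by (auto simp: symcl_def)
    ultimately obtain u w where uw: "(u, w) \<in> parcs G" "u \<in> tri_verts T1 T2 T3" "w \<notin> tri_verts T1 T2 T3" "w \<in> {0..<n}"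
      using connected_leaves_subset[OF _ aT j(2)] by metis
    from insert_pendant_tri[OF wf uw(2,3)] obtain S1 S2 S3 where
      S: "wf_tri S1 S2 S3" "tri_verts S1 S2 S3 = insert w (tri_verts T1 T2 T3)"
       "root_of S1 = root_of T1" "root_of S2 = root_of T2" "root_of S3 = root_of T3"
       "tri_edges S1 S2 S3 = insert (u, w) (tri_edges T1 T2 T3)"
      unfolding extends_tri_def by blast
    then have "Q (S1, S2, S3)" using uw sub roots by (auto simp: Q_def)
    with t(2) have "f (S1, S2, S3) \<le> f t" by blast
    then show False using S(2) uw(3) by (simp add: f_def t_eq)
  qed
  interpret H: pair_graph "tri_graph T1 T2 T3" by (rule pair_graph_tri_graph[OF wf])
  have HG: "parcs (tri_graph T1 T2 T3) \<subseteq> parcs G" using sub(2) sym by (auto simp: tri_graph_def)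
  have "parcs G \<subseteq> parcs (tri_graph T1 T2 T3)"
  proof (rule ccontr)
    assume "\<not> parcs G \<subseteq> parcs (tri_graph T1 T2 T3)"
    then obtain u v where uv: "(u, v) \<in> parcs G" "(u, v) \<notin> parcs (tri_graph T1 T2 T3)" by auto
    have ne: "u \<noteq> v" using uv(1) no_loops' by blast
    have "(u, v) \<in> rtrancl_on (tri_verts T1 T2 T3) (parcs (tri_graph T1 T2 T3))"
      using rtrancl_on_tri[of u T1 T2 T3 v] wellformed'[OF uv(1)] by (simp add: V verts tri_graph_def)
    then have "u \<rightarrow>\<^sup>*\<^bsub>with_proj (tri_graph T1 T2 T3)\<^esub> v"
      by (simp add: reachable_def) (simp add: tri_graph_def)
    then obtain q where "H.apath u q v" using H.reachable_apath by blast
    then have q: "set q \<subseteq> parcs (tri_graph T1 T2 T3)" "pcas u q v" "distinct (pawalk_verts u q)"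
      by (auto simp: H.apath_def H.awalk_def)
    have q_ne: "q \<noteq> []" using q(2) ne by auto
    \<comment> \<open>A path of one arc would be \<open>(u, v)\<close> itself; with two arcs, the
      closing arc makes a cycle of length at least 3.\<close>
    have q2: "2 \<le> length q"
    proof (rule ccontr)
      assume "\<not> 2 \<le> length q"
      moreover have "0 < length q" using q_ne by simp
      ultimately have "length q = 1" by linarith
      then obtain e where "q = [e]" by (auto simp: length_Suc_conv)
      then have "(u, v) \<in> set q" using q(2) by (cases e) auto
      then show False using q(1) uv(2) by blast
    qed
    have "distinct (u # map snd q)" using q(2,3) pawalk_verts_conv by metis
    then have "distinct (map snd (q @ [(v, u)]))" by auto
    moreover have "pcas u (q @ [(v, u)]) u" using q(2)
      by (induction q arbitrary: u) auto
    ultimately have "pcas u (q @ [(v, u)]) u \<and> distinct (tl (pawalk_verts u (q @ [(v, u)])))"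
      using pawalk_verts_conv[of u "q @ [(v, u)]" u] by simp
    moreover have "u \<in> pverts G" "set (q @ [(v, u)]) \<subseteq> parcs G" "q @ [(v, u)] \<noteq> []"
      using wellformed'[OF uv(1)] sym[OF uv(1)] q(1) HG by auto
    ultimately have "pre_digraph.cycle (with_proj G) (q @ [(v, u)])"
      unfolding pre_digraph.cycle_def pre_digraph.awalk_def cas_with_proj_eq awalk_verts_with_proj_eq
      unfolding with_proj_simps by blast
    then have "graph_cycle G (q @ [(v, u)])"
      using q2 by (simp add: graph_cycle_def)
    moreover have "graph_cycle G p" by fact
    ultimately have "set (q @ [(v, u)]) \<union> (set (q @ [(v, u)]))\<inverse> = set p \<union> (set p)\<inverse>"
      using uni unfolding unicyclic_def by blast
    then have "(u, v) \<in> set p \<union> (set p)\<inverse>" by auto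
    moreover have "set p \<union> (set p)\<inverse> \<subseteq> parcs (tri_graph T1 T2 T3)"
      by (auto simp: pe e tri_graph_def tri_edges_def roots)
    ultimately show False using uv(2) by blast
  qed
  with HG have "parcs G = parcs (tri_graph T1 T2 T3)" by blast
  then have "G = tri_graph T1 T2 T3"
    by (intro pair_pre_digraph.equality) (simp_all add: V verts tri_graph_def)
  with wf verts show ?thesis by blast
qed

section \<open>Labellings and isomorphism\<close>

abbreviation shape :: "'a rtree \<Rightarrow> unit rtree" where
  "shape T \<equiv> map_rtree (\<lambda>_. ()) T"

primrec labels :: "'a rtree \<Rightarrow> 'a list" where
  "labels (Vtx v) = [v]"
| "labels (Join T C) = labels T @ labels C"

lemma set_labels [simp]: "set (labels T) = set_rtree T"
  by (induction T) auto

lemma length_labels [simp]: "length (labels T) = nverts T"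
  by (induction T) auto

lemma distinct_labels: "distinct (labels T) \<longleftrightarrow> wf_tree T"
  by (induction T) auto

lemma wf_tri_iff_distinct: "wf_tri T1 T2 T3 \<longleftrightarrow> distinct (labels T1 @ labels T2 @ labels T3)"
  by (auto simp: wf_tri_def distinct_labels)

lemma wf_tri_iff_card:
  "wf_tri T1 T2 T3 \<longleftrightarrow> card (tri_verts T1 T2 T3) = nverts T1 + nverts T2 + nverts T3"
proof -
  have "set (labels T1 @ labels T2 @ labels T3) = tri_verts T1 T2 T3"
    "length (labels T1 @ labels T2 @ labels T3) = nverts T1 + nverts T2 + nverts T3"
    by (auto simp: tri_verts_def)
  then show ?thesis
    unfolding wf_tri_iff_distinct by (metis card_distinct distinct_card)
qed

lemma pair_of_map [simp]: "pair_of (map_rtree f T) = pair_of T"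
  by (induction T) simp_all

lemma nverts_map [simp]: "nverts (map_rtree f T) = nverts T"
  by (induction T) simp_all

lemma nleaves_map [simp]: "nleaves (map_rtree f T) = nleaves T"
  by (induction T) simp_all

lemma root_map [simp]: "root_of (map_rtree f T) = f (root_of T)"
  by (induction T) simp_all

lemma edges_map: "edges (map_rtree f T) = map_prod f f ` edges T"
  by (induction T) (simp_all add: image_Un)

lemma tri_edges_map:
  "tri_edges (map_rtree f T1) (map_rtree f T2) (map_rtree f T3) = map_prod f f ` tri_edges T1 T2 T3"
  by (simp add: tri_edges_def edges_map image_Un)

lemma tri_verts_map:
  "tri_verts (map_rtree f T1) (map_rtree f T2) (map_rtree f T3) = f ` tri_verts T1 T2 T3"
  by (simp add: tri_verts_def rtree.set_map image_Un)

lemma wf_tri_map: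
  assumes "wf_tri T1 T2 T3" "inj_on f (tri_verts T1 T2 T3)"
  shows "wf_tri (map_rtree f T1) (map_rtree f T2) (map_rtree f T3)"
  using assms unfolding wf_tri_iff_card tri_verts_map by (simp add: card_image)

lemma labelled_tree_exists:
  "\<exists>T. shape T = S \<and> set_rtree T = {k..<k + nverts S}"
proof (induction S arbitrary: k)
  case (Vtx v)
  show ?case by (intro exI[of _ "Vtx k"]) auto
next
  case (Join S C)
  obtain T where T: "shape T = S" "set_rtree T = {k..<k + nverts S}" using Join(1) by blast
  obtain D where D: "shape D = C" "set_rtree D = {k + nverts S..<k + nverts S + nverts C}" using Join(2) by blast
  show ?case
    using T D by (intro exI[of _ "Join T D"]) auto
qed

lemma labelled_triple_exists:
  fixes S1 S2 S3 :: "unit rtree"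
  assumes "nverts S1 + nverts S2 + nverts S3 = n"
  shows "\<exists>T1 T2 T3. shape T1 = S1 \<and> shape T2 = S2 \<and> shape T3 = S3 \<and> wf_tri T1 T2 T3 \<and> tri_verts T1 T2 T3 = {0..<n}"
proof -
  obtain T1 where T1: "shape T1 = S1" "set_rtree T1 = {0..<0 + nverts S1}"
    using labelled_tree_exists by blast
  obtain T2 where T2: "shape T2 = S2" "set_rtree T2 = {nverts S1..<nverts S1 + nverts S2}"
    using labelled_tree_exists by blast
  obtain T3 where T3: "shape T3 = S3" "set_rtree T3 = {nverts S1 + nverts S2..<nverts S1 + nverts S2 + nverts S3}"
    using labelled_tree_exists by blast
  have V: "tri_verts T1 T2 T3 = {0..<n}"
    using T1 T2 T3 assms by (auto simp: tri_verts_def)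
  have "nverts T1 = nverts S1" "nverts T2 = nverts S2" "nverts T3 = nverts S3"
    using T1 T2 T3 by (metis nverts_map)+
  then have "wf_tri T1 T2 T3" unfolding wf_tri_iff_card V using assms by simp
  with T1 T2 T3 V show ?thesis by blast
qed

lemma distinct_map_exists:
  assumes "distinct xs" "length xs = length ys"
  shows "\<exists>f. map f xs = ys"
proof -
  have "map (\<lambda>x. the (map_of (zip xs ys) x)) xs = ys"
    using assms by (intro nth_equalityI) (auto simp: map_of_zip_nth)
  then show ?thesis by blast
qed

text \<open>A labelled tree is determined by its shape and its list of labels, so matching two lists
  of labels suffices to match two trees.\<close>

lemma same_shape_map:
  "shape T = shape S \<Longrightarrow> map f (labels T) = labels S \<Longrightarrow> map_rtree f T = S"
proof (induction T arbitrary: S)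
  case (Vtx v)
  then show ?case by (cases S) auto
next
  case (Join T C)
  then obtain T' C' where S: "S = Join T' C'" by (cases S) auto
  with Join.prems have sh: "shape T = shape T'" "shape C = shape C'" by auto
  then have "length (map f (labels T)) = length (labels T')"
    by (metis length_labels length_map nverts_map)
  with Join.prems S have "map f (labels T) = labels T'" "map f (labels C) = labels C'" by auto
  with Join.IH sh S show ?case by simp
qed

section \<open>Relabellings as graph isomorphisms\<close>

lemma graph_iso_map:
  assumes wf: "wf_tri T1 T2 T3" and inj: "inj_on f (tri_verts T1 T2 T3)"
  shows "(tri_graph T1 T2 T3, tri_graph (map_rtree f T1) (map_rtree f T2) (map_rtree f T3)) \<in> graph_iso"
proof -
  define G H where "G = tri_graph T1 T2 T3" "H = tri_graph (map_rtree f T1) (map_rtree f T2) (map_rtree f T3)"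
  define hom where "hom = \<lparr> iso_verts = f, iso_arcs = map_prod f f, iso_head = snd, iso_tail = (fst :: nat \<times> nat \<Rightarrow> nat) \<rparr>"
  have arcs_in: "a \<in> parcs G \<Longrightarrow> fst a \<in> tri_verts T1 T2 T3 \<and> snd a \<in> tri_verts T1 T2 T3" for a
    by (cases a) (auto simp: G_H_def tri_graph_def dest: tri_edges_in)
  have "inj_on (map_prod f f) (parcs G)"
    using inj arcs_in by (auto simp: inj_on_def map_prod_def split: prod.splits)
  moreover have "wf_digraph (with_proj G)"
    using pair_wf_digraph_tri_graph[OF wf] by (simp add: wf_digraph_wp_iff G_H_def)
  ultimately have "pre_digraph.digraph_isomorphism (with_proj G) hom"
    using inj unfolding pre_digraph.digraph_isomorphism_def by (simp add: hom_def G_H_def tri_graph_def)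
  moreover have "with_proj H = app_iso hom (with_proj G)"
    unfolding app_iso_def with_proj_def
    by (auto simp: hom_def G_H_def tri_graph_def tri_verts_map tri_edges_map)
  ultimately show ?thesis
    unfolding graph_iso_def digraph_iso_def G_H_def by blast
qed

lemma same_shape_graph_iso:
  assumes wf: "wf_tri T1 T2 T3" "wf_tri S1 S2 S3"
    and sh: "shape T1 = shape S1" "shape T2 = shape S2" "shape T3 = shape S3"
  shows "(tri_graph T1 T2 T3, tri_graph S1 S2 S3) \<in> graph_iso"
proof -
  have nv: "nverts T1 = nverts S1" "nverts T2 = nverts S2" "nverts T3 = nverts S3"
    using sh by (metis nverts_map)+
  obtain f where f: "map f (labels T1 @ labels T2 @ labels T3) = labels S1 @ labels S2 @ labels S3"
    using distinct_map_exists[of "labels T1 @ labels T2 @ labels T3" "labels S1 @ labels S2 @ labels S3"]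
      wf nv by (auto simp: wf_tri_iff_distinct)
  then have fs: "map f (labels T1) = labels S1" "map f (labels T2) = labels S2" "map f (labels T3) = labels S3"
    using nv by auto
  have "distinct (map f (labels T1 @ labels T2 @ labels T3))"
    using wf(2) unfolding f wf_tri_iff_distinct .
  then have "inj_on f (tri_verts T1 T2 T3)"
    unfolding distinct_map by (simp add: tri_verts_def Un_assoc)
  from graph_iso_map[OF wf(1) this] show ?thesis
    using same_shape_map[OF sh(1) fs(1)] same_shape_map[OF sh(2) fs(2)] same_shape_map[OF sh(3) fs(3)] by simp
qed

text \<open>The isomorphic image is again a triangle with trees, namely the relabelled ones, and
  \<open>pair_of\<close> ignores labels. Thus no similarity of matrices has to be discussed.\<close>

lemma graph_iso_lap_coeff:
  assumes wf: "wf_tri T1 T2 T3" "tri_verts T1 T2 T3 = {0..<n}"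
    and iso: "(tri_graph T1 T2 T3, H) \<in> graph_iso" and H: "pverts H = {0..<n}" and k: "k \<le> n"
  shows "lap_coeff H k = lap_coeff (tri_graph T1 T2 T3) k"
proof -
  define G where "G = tri_graph T1 T2 T3"
  obtain hom where hom: "pre_digraph.digraph_isomorphism (with_proj G) hom" "with_proj H = app_iso hom (with_proj G)"
    using iso by (auto simp: graph_iso_def digraph_iso_def G_def)
  define f where "f = iso_verts hom"
  have inj: "inj_on f (tri_verts T1 T2 T3)"
    and ends: "\<And>a. a \<in> parcs G \<Longrightarrow> f (fst a) = iso_tail hom (iso_arcs hom a) \<and> f (snd a) = iso_head hom (iso_arcs hom a)"
    using hom(1) unfolding pre_digraph.digraph_isomorphism_def f_def by (simp_all add: G_def tri_graph_def)
  have "verts (with_proj H) = f ` tri_verts T1 T2 T3" "arcs (with_proj H) = iso_arcs hom ` parcs G"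
    "tail (with_proj H) = iso_tail hom" "head (with_proj H) = iso_head hom"
    unfolding hom(2) by (simp_all add: app_iso_def f_def G_def tri_graph_def)
  then have H': "pverts H = f ` tri_verts T1 T2 T3" "parcs H = iso_arcs hom ` parcs G"
    "iso_tail hom = fst" "iso_head hom = snd" by simp_all
  \<comment> \<open>Arcs are pairs of vertices on both sides, so the vertex map determines the arc
    map.\<close>
  have "iso_arcs hom a = map_prod f f a" if "a \<in> parcs G" for a
    using ends[OF that] unfolding H' by (simp add: prod_eq_iff)
  then have "parcs H = map_prod f f ` parcs G" unfolding H' by (rule image_cong[OF refl])
  then have "parcs H = parcs (tri_graph (map_rtree f T1) (map_rtree f T2) (map_rtree f T3))"
    by (simp add: G_def tri_graph_def tri_edges_map image_Un) (auto simp: map_prod_def)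
  then have H_eq: "H = tri_graph (map_rtree f T1) (map_rtree f T2) (map_rtree f T3)"
    using H' by (intro pair_pre_digraph.equality) (simp_all add: tri_graph_def tri_verts_map)
  have "tri_verts (map_rtree f T1) (map_rtree f T2) (map_rtree f T3) = {0..<n}"
    using H H' by (simp add: tri_verts_map)
  from lap_coeff_tri_graph[OF wf_tri_map[OF wf(1) inj] this k] lap_coeff_tri_graph[OF wf k]
  show ?thesis unfolding H_eq by simp
qed

lemma graph_iso_class:
  assumes "wf_tri T1 T2 T3" "(tri_graph T1 T2 T3, H) \<in> graph_iso"
  shows "graph_iso `` {tri_graph T1 T2 T3} = graph_iso `` {H}"
proof -
  have "wf_digraph (with_proj (tri_graph T1 T2 T3))"
    using pair_wf_digraph_tri_graph[OF assms(1)] by (simp add: wf_digraph_wp_iff)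
  from digraph_iso_swap[OF this] assms(2) have "(H, tri_graph T1 T2 T3) \<in> graph_iso"
    by (auto simp: graph_iso_def)
  with assms(2) show ?thesis
    unfolding graph_iso_def by (auto intro: digraph_iso_trans)
qed

section \<open>Spiders and the graphs $U$\<close>

definition star :: "'a \<Rightarrow> 'a rtree list \<Rightarrow> 'a rtree" where
  "star v Cs = foldl Join (Vtx v) Cs"

lemma star_Nil [simp]: "star v [] = Vtx v"
  and star_snoc [simp]: "star v (Cs @ [C]) = Join (star v Cs) C"
  by (simp_all add: star_def)

lemma root_star [simp]: "root_of (star v Cs) = v"
  by (induction Cs rule: rev_induct) simp_all

lemma edges_star: "edges (star v Cs) = (\<Union>C\<in>set Cs. insert (v, root_of C) (edges C))"
  by (induction Cs rule: rev_induct) auto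

lemma set_star: "set_rtree (star v Cs) = insert v (\<Union>C\<in>set Cs. set_rtree C)"
  by (induction Cs rule: rev_induct) auto

lemma shape_star: "map shape Cs = map (\<lambda>b. stem (b - 1) pt) bs \<Longrightarrow> shape (star v Cs) = legs bs"
proof (induction Cs arbitrary: bs rule: rev_induct)
  case (snoc C Cs)
  then obtain b bs' where "bs = bs' @ [b]" by (cases bs rule: rev_cases) auto
  with snoc show ?case by (simp add: legs_snoc)
qed simp

lemma star_of_shape:
  "shape T = legs bs \<Longrightarrow> \<exists>v Cs. T = star v Cs \<and> map shape Cs = map (\<lambda>b. stem (b - 1) pt) bs"
proof (induction bs arbitrary: T rule: rev_induct)
  case Nil
  then obtain v where "T = Vtx v" by (cases T) auto
  then show ?case by (intro exI[of _ v] exI[of _ "[]"]) simp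
next
  case (snoc b bs)
  then obtain T' C where T: "T = Join T' C" "shape T' = legs bs" "shape C = stem (b - 1) pt"
    by (cases T) (auto simp: legs_snoc)
  from snoc.IH[OF T(2)] obtain v Cs where "T' = star v Cs" "map shape Cs = map (\<lambda>b. stem (b - 1) pt) bs" by blast
  with T show ?case by (intro exI[of _ v] exI[of _ "Cs @ [C]"]) simp
qed

text \<open>Reordering the children of the centre changes the term but not its edges: the result
  describes the very same graph, not just an isomorphic one.\<close>

lemma permute_legs:
  "shape T = stem s (legs bs) \<Longrightarrow> mset bs = mset bs' \<Longrightarrow>
    \<exists>S. shape S = stem s (legs bs') \<and> edges S = edges T \<and> set_rtree S = set_rtree T \<and> root_of S = root_of T"
proof (induction s arbitrary: T)
  case 0
  then obtain v Cs where T: "T = star v Cs" and Cs: "map shape Cs = map (\<lambda>b. stem (b - 1) pt) bs"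
    using star_of_shape[of T bs] by auto
  from 0(2) obtain \<pi> where \<pi>: "\<pi> permutes {..<length bs}" "permute_list \<pi> bs = bs'"
    using mset_eq_permutation[of bs' bs] by metis
  have len: "length Cs = length bs" using Cs by (metis length_map)
  have "map shape (permute_list \<pi> Cs) = permute_list \<pi> (map shape Cs)"
    using \<pi>(1) len by (simp add: permute_list_map)
  also have "\<dots> = map (\<lambda>b. stem (b - 1) pt) bs'"
    unfolding Cs by (simp only: permute_list_map[OF \<pi>(1)] \<pi>(2))
  finally have "shape (star v (permute_list \<pi> Cs)) = legs bs'" by (rule shape_star)
  moreover have "set (permute_list \<pi> Cs) = set Cs"
    using \<pi>(1) len by (simp add: set_permute_list)
  ultimately show ?case
    unfolding T by (intro exI[of _ "star v (permute_list \<pi> Cs)"]) (simp add: edges_star set_star)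
next
  case (Suc s)
  then obtain D C where DC: "T = Join D C" "shape D = pt" "shape C = stem s (legs bs)"
    by (cases T) auto
  then obtain v where "D = Vtx v" by (cases D) auto
  with DC have T: "T = Join (Vtx v) C" "shape C = stem s (legs bs)" by simp_all
  from Suc.IH[OF T(2) Suc.prems(2)] obtain S where
    "shape S = stem s (legs bs')" "edges S = edges C" "set_rtree S = set_rtree C" "root_of S = root_of C" by blast
  with T show ?case by (intro exI[of _ "Join (Vtx v) S"]) simp
qed

text \<open>Puts the vertices \<open>b i\<close>, \<open>b (i + d)\<close>, ... above
  \<open>T\<close>. The step is 1 for the path to the triangle and \<open>l\<close> for a leg, as
  the vertices of the balanced tree are dealt out to the \<open>l\<close> legs in turn.\<close>

primrec chain :: "nat \<Rightarrow> (nat \<Rightarrow> 'a) \<Rightarrow> nat \<Rightarrow> nat \<Rightarrow> 'a rtree \<Rightarrow> 'a rtree" where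
  "chain 0 b d i T = T"
| "chain (Suc k) b d i T = Join (Vtx (b i)) (chain k b d (i + d) T)"

lemma shape_chain [simp]: "shape (chain k b d i T) = stem k (shape T)"
  by (induction k arbitrary: i) simp_all

lemma root_chain: "root_of T = b (i + k * d) \<Longrightarrow> root_of (chain k b d i T) = b i"
  by (cases k) simp_all

lemma edges_chain:
  "root_of T = b (i + k * d) \<Longrightarrow>
    edges (chain k b d i T) = edges T \<union> (\<lambda>t. (b (i + t * d), b (i + Suc t * d))) ` {..<k}"
proof (induction k arbitrary: i)
  case (Suc k)
  then have r: "root_of T = b (i + d + k * d)" by (simp add: algebra_simps)
  then have "edges (chain (Suc k) b d i T) = insert (b i, b (i + d))
     (edges T \<union> (\<lambda>t. (b (i + d + t * d), b (i + d + Suc t * d))) ` {..<k})"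
    using Suc.IH[of "i + d", OF r] root_chain[where b = b and i = "i + d" and k = k and d = d, OF r] by simp
  also have "\<dots> = edges T \<union> (\<lambda>t. (b (i + t * d), b (i + Suc t * d))) ` {..<Suc k}"
    unfolding lessThan_Suc_eq_insert_0 image_insert image_image by (simp add: add.assoc)
  finally show ?case .
qed simp

lemma set_chain: "set_rtree (chain k b d i T) = set_rtree T \<union> (\<lambda>t. b (i + t * d)) ` {..<k}"
proof (induction k arbitrary: i)
  case (Suc k)
  show ?case
    unfolding lessThan_Suc_eq_insert_0 image_insert image_image chain.simps
    using Suc[of "i + d"] by (auto simp: add.assoc)
qed simp

text \<open>Entry \<open>i\<close> belongs to the leg of \<open>bst_edges\<close> that starts at
  vertex \<open>l - i\<close>. In this order, passing from \<open>N\<close> to \<open>N + 1\<close>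
  just drops the first entry and appends its successor at the end.\<close>

definition leg_lengths :: "nat \<Rightarrow> nat \<Rightarrow> nat list" where
  "leg_lengths N l = map (\<lambda>i. (N + i) div l) [0..<l]"

text \<open>Raising \<open>N\<close> by one shifts the range of summation: \<open>N div l\<close>
  disappears and \<open>(N + l) div l\<close>, which is one more, comes in.\<close>

lemma sum_div_shift: "0 < l \<Longrightarrow> (\<Sum>i<l. (N + i) div l) = (N :: nat)"
proof (induction N)
  case (Suc N)
  have "(\<Sum>i<Suc l. (N + i) div l) = N div l + (\<Sum>i<l. (Suc N + i) div l)"
    by (subst sum.lessThan_Suc_shift) simp
  moreover have "(N + l) div l = Suc (N div l)" using Suc.prems by simp
  moreover have "(\<Sum>i<Suc l. (N + i) div l) = (\<Sum>i<l. (N + i) div l) + (N + l) div l" by simp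
  ultimately show ?case using Suc.IH[OF Suc.prems] by linarith
qed simp

lemma sum_leg_lengths: "0 < l \<Longrightarrow> sum_list (leg_lengths N l) = N"
  by (simp add: leg_lengths_def interv_sum_list_conv_sum_set_nat sum_div_shift atLeast0LessThan)

lemma leg_start_le_iff:
  fixes i l t N :: nat
  assumes "i < l"
  shows "l - i + t * l \<le> N \<longleftrightarrow> t < (N + i) div l"
proof -
  have "t < (N + i) div l \<longleftrightarrow> Suc t * l \<le> N + i"
    using assms by (simp add: less_eq_div_iff_mult_less_eq Suc_le_eq[symmetric])
  also have "\<dots> \<longleftrightarrow> l - i + t * l \<le> N" using assms by auto
  finally show ?thesis by simp
qed

lemma leg_positions:
  fixes l N :: nat
  assumes "0 < l"
  shows "{1..N} = (\<Union>i\<in>{..<l}. (\<lambda>t. l - i + t * l) ` {..<(N + i) div l})"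
proof (intro equalityI subsetI)
  fix j assume j: "j \<in> {1..N}"
  \<comment> \<open>The residue of \<open>j - 1\<close> selects the leg, counted downwards because
    leg \<open>i\<close> starts at \<open>l - i\<close>.\<close>
  define i where "i = l - 1 - (j - 1) mod l"
  have "(j - 1) mod l < l" using assms by simp
  then have i: "i < l" "l - i = Suc ((j - 1) mod l)" by (auto simp: i_def)
  moreover have "(j - 1) mod l + (j - 1) div l * l = j - 1" by simp
  ultimately have "j = l - i + (j - 1) div l * l" using j by simp
  moreover from this have "(j - 1) div l < (N + i) div l"
    using leg_start_le_iff[OF i(1), of "(j - 1) div l" N] j by simp
  ultimately show "j \<in> (\<Union>i\<in>{..<l}. (\<lambda>t. l - i + t * l) ` {..<(N + i) div l})"
    using i(1) by blast
next
  fix j assume "j \<in> (\<Union>i\<in>{..<l}. (\<lambda>t. l - i + t * l) ` {..<(N + i) div l})"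
  then show "j \<in> {1..N}" using leg_start_le_iff by fastforce
qed

lemma bst_edges_legs:
  assumes "0 < l" "l \<le> N"
  shows "bst_edges (Suc N) l = (\<Union>i\<in>{..<l}. insert (0, l - i)
    ((\<lambda>t. (l - i + t * l, l - i + Suc t * l)) ` {..<(N + i) div l - 1}))"
proof -
  have pos: "0 < (N + i) div l" for i
    using assms by (simp add: div_greater_zero_iff)
  \<comment> \<open>Position 0 of a leg is treated apart: it is the vertex whose predecessor
    \<open>j - l\<close> truncates to the centre. Since \<open>l \<le> N\<close>, every leg has this
    position.\<close>
  have split: "{..<(N + i) div l} = insert 0 (Suc ` {..<(N + i) div l - 1})" for i
    using pos[of i] lessThan_Suc_eq_insert_0[of "(N + i) div l - 1"] by simp
  have "bst_edges (Suc N) l = (\<lambda>j. (j - l, j)) ` {1..N}"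
    by (auto simp: bst_edges_def)
  also have "\<dots> = (\<Union>i\<in>{..<l}. (\<lambda>t. (l - i + t * l - l, l - i + t * l)) ` {..<(N + i) div l})"
    unfolding leg_positions[OF assms(1)] by (simp add: image_UN image_image)
  also have "\<dots> = (\<Union>i\<in>{..<l}. insert (0, l - i)
    ((\<lambda>t. (l - i + t * l, l - i + Suc t * l)) ` {..<(N + i) div l - 1}))"
    unfolding split image_insert image_image by (intro SUP_cong refl arg_cong2[of _ _ _ _ insert] image_cong) auto
  finally show ?thesis .
qed

text \<open>The tree at corner 0 is labelled with the vertex names of \<open>U_edges\<close>
  themselves, so the graphs are equal and not merely isomorphic.\<close>

lemma U_graph_tri_graph:
  assumes l: "0 < l" and n: "3 + q + l \<le> n"
  shows "\<exists>T. shape T = stem q (legs (leg_lengths (n - 3 - q) l)) \<and> wf_tri T (Vtx 1) (Vtx 2) \<and>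
    tri_verts T (Vtx 1) (Vtx 2) = {0..<n} \<and> U_graph n l 3 q = tri_graph T (Vtx 1) (Vtx 2)"
proof -
  define N where "N = n - 3 - q"
  have N: "l \<le> N" "n = N + 3 + q" using n by (auto simp: N_def)
  define b where "b = bst_vertex 3 q"
  define K where "K i = (N + i) div l - 1" for i
  have K: "(N + i) div l = Suc (K i)" for i
    using l N by (simp add: K_def div_greater_zero_iff)
  define C where "C i = chain (K i) b l (l - i) (Vtx (b (l - i + K i * l)))" for i
  define T where "T = chain q (path_vertex 3) 1 0 (star (b 0) (map C [0..<l]))"
  have b0: "b 0 = path_vertex 3 q" by (simp add: b_def bst_vertex_def)
  have C: "root_of (C i) = b (l - i)" "shape (C i) = stem (K i) pt"
    "edges (C i) = (\<lambda>t. (b (l - i + t * l), b (l - i + Suc t * l))) ` {..<K i}"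
    "set_rtree (C i) = (\<lambda>t. b (l - i + t * l)) ` {..<(N + i) div l}" for i
    by (simp_all add: C_def root_chain edges_chain set_chain K lessThan_Suc)
  have "shape (star (b 0) (map C [0..<l])) = legs (leg_lengths N l)"
    by (rule shape_star) (simp add: leg_lengths_def C K)
  then have sh: "shape T = stem q (legs (leg_lengths N l))" by (simp add: T_def)
  have rootT: "root_of T = 0"
    unfolding T_def by (subst root_chain) (simp_all add: b0 path_vertex_def)
  have edges: "edges T = map_prod b b ` bst_edges (Suc N) l \<union>
    map_prod (path_vertex 3) (path_vertex 3) ` path_edges q"
  proof -
    have "edges (star (b 0) (map C [0..<l])) = map_prod b b ` bst_edges (Suc N) l"
      unfolding edges_star bst_edges_legs[OF l N(1)]
      by (simp add: C K image_UN image_image atLeast0LessThan)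
    moreover have "map_prod (path_vertex 3) (path_vertex 3) ` path_edges q =
      (\<lambda>t. (path_vertex 3 (0 + t * 1), path_vertex 3 (0 + Suc t * 1))) ` {..<q}"
      by (auto simp: path_edges_def)
    ultimately show ?thesis
      unfolding T_def by (subst edges_chain) (simp_all add: b0)
  qed
  have cyc: "cycle_edges 3 = {(0, 1), (1, 2), (2, 0)}"
  proof -
    have "cycle_edges 3 = (\<lambda>i. (i, (i + 1) mod 3)) ` {i. i < 3}"
      unfolding cycle_edges_def by blast
    moreover have "{i :: nat. i < 3} = {0, 1, 2}" by auto
    ultimately have "cycle_edges 3 = (\<lambda>i. (i, (i + 1) mod 3)) ` {0, 1, 2}" by simp
    then show ?thesis by (simp add: numeral_2_eq_2)
  qed
  have E: "U_edges n l 3 q = tri_edges T (Vtx 1) (Vtx 2)"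
  proof -
    have "n + 1 - q - 3 = Suc N" using N by simp
    then show ?thesis
      unfolding U_edges_def tri_edges_def edges cyc b_def
      by (simp only: root_of.simps rootT edges.simps Un_empty_left Un_empty_right Un_assoc Un_commute Un_left_commute)
  qed
  have "set_rtree T = insert (b 0) (b ` {1..N}) \<union> path_vertex 3 ` {..<q}"
    unfolding T_def set_chain set_star leg_positions[OF l]
    by (simp add: C image_UN image_image atLeast0LessThan)
  also have "b ` {1..N} = {q + 3..<n}"
  proof -
    have "b ` {1..N} = (\<lambda>j. j + (q + 2)) ` {1..N}"
      by (intro image_cong) (auto simp: b_def bst_vertex_def)
    also have "\<dots> = {1 + (q + 2)..N + (q + 2)}" by (rule image_add_atLeastAtMost')
    also have "\<dots> = {q + 3..<n}" using N by auto
    finally show ?thesis .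
  qed
  also have "insert (b 0) {q + 3..<n} \<union> path_vertex 3 ` {..<q} = path_vertex 3 ` {..q} \<union> {q + 3..<n}"
    unfolding b0 by (auto simp: lessThan_Suc_atMost[symmetric] lessThan_Suc)
  also have "path_vertex 3 ` {..q} = insert 0 {3..<q + 3}"
  proof -
    have "{..q} = insert 0 {1..q}" by auto
    moreover have "path_vertex 3 ` {1..q} = (\<lambda>j. j + 2) ` {1..q}"
      by (intro image_cong) (auto simp: path_vertex_def)
    moreover have "(\<lambda>j. j + 2) ` {1..q} = {1 + 2..q + 2}" by (rule image_add_atLeastAtMost')
    moreover have "{1 + 2..q + 2} = {3..<q + 3}" by auto
    moreover have "path_vertex 3 0 = 0" by (simp add: path_vertex_def)
    ultimately show ?thesis by (simp only: image_insert)
  qed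
  finally have "set_rtree T = insert 0 ({3..<q + 3} \<union> {q + 3..<n})" by simp
  also have "{3..<q + 3} \<union> {q + 3..<n} = {3..<n}" using N by (intro ivl_disj_un_two(3)) simp_all
  finally have setT: "set_rtree T = insert 0 {3..<n}" .
  have "{0..<n} = {0, 1, 2} \<union> {3..<n}" using N by auto
  then have V: "tri_verts T (Vtx 1) (Vtx 2) = {0..<n}"
    unfolding tri_verts_def setT by auto
  have "0 \<notin> set (leg_lengths N l)"
    by (auto simp: leg_lengths_def K)
  then have "nverts (stem q (legs (leg_lengths N l))) = q + Suc N"
    using sum_leg_lengths[OF l] by (simp add: nverts_legs)
  then have "nverts T = q + Suc N"
    using sh by (metis nverts_map)
  \<comment> \<open>All labels are distinct, because \<open>n\<close> labels cover \<open>n\<close>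
    vertices.\<close>
  then have "wf_tri T (Vtx 1) (Vtx 2)"
    unfolding wf_tri_iff_card V using N by simp
  moreover have "U_graph n l 3 q = tri_graph T (Vtx 1) (Vtx 2)"
    unfolding U_graph_def tri_graph_def E V ..
  ultimately show ?thesis using sh V by (auto simp: N_def)
qed

text \<open>The entries are \<open>m\<close> and \<open>m + 1\<close>, and \<open>m\<close> does
  occur. So the sum is \<open>m * l + k\<close> with \<open>k < l\<close>, which is division with
  remainder.\<close>

lemma balanced_list_count:
  fixes bs :: "nat list"
  assumes bal: "\<forall>b\<in>set bs. \<forall>c\<in>set bs. c \<le> b + 1" and l: "length bs = l" "0 < l"
  shows "count (mset bs) x =
    (if x = sum_list bs div l + 1 then sum_list bs mod l else if x = sum_list bs div l then l - sum_list bs mod l else 0)"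
proof -
  define m where "m = Min (set bs)"
  have ne: "set bs \<noteq> {}" using l by auto
  have m: "m \<in> set bs" unfolding m_def using ne by simp
  have mem: "b = m \<or> b = m + 1" if "b \<in> set bs" for b
  proof -
    have "m \<le> b" unfolding m_def using that by simp
    moreover have "b \<le> m + 1" using bal m that by blast
    ultimately show ?thesis by linarith
  qed
  define k where "k = count (mset bs) (m + 1)"
  have filt: "length (filter (\<lambda>b. b = m) bs) + length (filter (\<lambda>b. b = m + 1) bs) = length bs"
    "sum_list bs = m * length (filter (\<lambda>b. b = m) bs) + (m + 1) * length (filter (\<lambda>b. b = m + 1) bs)"
    using mem by (induction bs) force+
  have cnt: "count (mset bs) y = length (filter (\<lambda>b. b = y) bs)" for y
    by (induction bs) auto
  have km: "count (mset bs) m + k = l"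
    using filt(1) l(1) unfolding k_def cnt by simp
  have "sum_list bs = m * count (mset bs) m + (m + 1) * k"
    using filt(2) unfolding k_def cnt .
  then have sum: "sum_list bs = m * l + k"
    unfolding km[symmetric] by (simp add: algebra_simps)
  have "count (mset bs) m > 0" using m by simp
  then have "k < l" using km by linarith
  then have "sum_list bs div l = m" "sum_list bs mod l = k"
    unfolding sum using l(2) by simp_all
  moreover have "count (mset bs) x = 0" if "x \<noteq> m" "x \<noteq> m + 1"
    using mem that by (metis count_eq_zero_iff set_mset_mset)
  ultimately show ?thesis using km by (auto simp: k_def)
qed

lemma balanced_leg_lengths:
  assumes "0 < l"
  shows "\<forall>b\<in>set (leg_lengths N l). \<forall>c\<in>set (leg_lengths N l). c \<le> b + 1"
proof (intro ballI)
  fix b c assume "b \<in> set (leg_lengths N l)" "c \<in> set (leg_lengths N l)"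
  then obtain i j where ij: "i < l" "j < l" "b = (N + i) div l" "c = (N + j) div l"
    by (auto simp: leg_lengths_def)
  have "(N + j) div l \<le> (N + l) div l" using ij by (intro div_le_mono) simp
  also have "\<dots> = N div l + 1" using assms by simp
  also have "N div l \<le> (N + i) div l" by (intro div_le_mono) simp
  finally show "c \<le> b + 1" using ij by simp
qed

lemma mset_balanced:
  assumes "\<forall>b\<in>set bs. \<forall>c\<in>set bs. c \<le> b + 1" "length bs = l" "0 < l"
  shows "mset bs = mset (leg_lengths (sum_list bs) l)"
proof (rule multiset_eqI)
  fix x
  have "length (leg_lengths (sum_list bs) l) = l" by (simp add: leg_lengths_def)
  from balanced_list_count[OF balanced_leg_lengths[OF assms(3), of "sum_list bs"] this assms(3), of x]
  show "count (mset bs) x = count (mset (leg_lengths (sum_list bs) l)) x"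
    unfolding balanced_list_count[OF assms] sum_leg_lengths[OF assms(3)] by simp
qed

section \<open>Incomparability\<close>

lemma cross_hang_pow: "cross ((hang ^^ q) X) ((hang ^^ q) Y) = (tt * tt) ^ q * cross X Y"
  by (induction q) (simp_all add: cross_hang mult_ac)

lemma tt_power: "(tt * tt) ^ q = monom 1 (2 * q)"
proof -
  have "tt ^ m = monom 1 m" for m by (simp add: tt_def monom_altdef)
  moreover have "(tt * tt) ^ q = tt ^ (2 * q)" by (simp only: power_mult power2_eq_square)
  ultimately show ?thesis by simp
qed

lemma coeff_tt_mult: "coeff (tt * p) 0 = 0" "coeff (tt * p) (Suc k) = coeff p k"
  by (simp_all add: tt_def)

lemma tri_pair_coeffs: "tri_pair = ([:1, 4, 3:], [:0, 2, 6:])"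
  by (simp add: tri_pair_def tt_def one_pCons numeral_poly)

text \<open>\<open>c\<close> is the degree of the distinguished vertex: with a single edge, that
  vertex fails to be a root iff the edge ends at it and the other end is the root.\<close>

definition low_coeffs :: "ppair \<Rightarrow> real \<Rightarrow> bool" where
  "low_coeffs X c \<longleftrightarrow> coeff (fst X) 0 = 1 \<and> coeff (snd X) 0 = 0 \<and> coeff (snd X) 1 = c"

lemma coeff_mult_1: "coeff (p * q) (Suc 0) = coeff p 0 * coeff q (Suc 0) + coeff p (Suc 0) * coeff q 0"
  by (simp add: coeff_mult)

lemma low_coeffs_glue: "low_coeffs X c \<Longrightarrow> low_coeffs Y d \<Longrightarrow> low_coeffs (glue X Y) (c + d)"
  by (simp add: low_coeffs_def glue_def coeff_mult_0 coeff_mult_1)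

lemma low_coeffs_hang: "low_coeffs X c \<Longrightarrow> low_coeffs (hang X) 1"
  by (simp add: low_coeffs_def hang_def distrib_right coeff_tt_mult)

lemma low_coeffs_path: "low_coeffs (path_pair b) (of_bool (0 < b))"
proof (induction b)
  case (Suc b)
  then show ?case using low_coeffs_hang by (simp add: path_pair_Suc)
qed (simp add: low_coeffs_def)

lemma low_coeffs_legs: "0 \<notin> set bs \<Longrightarrow> low_coeffs (legs_pair bs) (length bs)"
proof (induction bs)
  case (Cons b bs)
  then show ?case using low_coeffs_glue[OF low_coeffs_path[of b]] by simp
qed (simp add: low_coeffs_def)

lemma low_coeffs_cross:
  "low_coeffs X c \<Longrightarrow> low_coeffs Y d \<Longrightarrow> coeff (cross X Y) 0 = 0 \<and> coeff (cross X Y) 1 = c - d"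
  by (simp add: low_coeffs_def cross_def coeff_mult_0 coeff_mult_1)

text \<open>Used with \<open>m\<close> the number of edges of a spanning tree. Then \<open>a\<close>
  counts spanning trees, and \<open>b\<close> is \<open>m * a\<close>, since any of the
  \<open>m\<close> other vertices may be the root.\<close>

definition top_coeffs :: "ppair \<Rightarrow> nat \<Rightarrow> real \<Rightarrow> real \<Rightarrow> bool" where
  "top_coeffs X m a b \<longleftrightarrow> degree (fst X) \<le> m \<and> degree (snd X) \<le> m \<and> coeff (fst X) m = a \<and> coeff (snd X) m = b"

lemma coeff_mult_top:
  fixes p q :: "real poly"
  assumes "degree p \<le> m" "degree q \<le> k"
  shows "coeff (p * q) (m + k) = coeff p m * coeff q k"
proof -
  have "coeff p i * coeff q (m + k - i) = 0" if "i \<le> m + k" "i \<noteq> m" for i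
    using assms that by (cases "i < m") (auto simp: coeff_eq_0)
  then have "(\<Sum>i\<le>m + k. coeff p i * coeff q (m + k - i)) = (\<Sum>i\<in>{m}. coeff p i * coeff q (m + k - i))"
    by (intro sum.mono_neutral_right) auto
  then show ?thesis by (simp add: coeff_mult)
qed

lemma degree_mult_le': "degree p \<le> m \<Longrightarrow> degree q \<le> k \<Longrightarrow> degree (p * q :: real poly) \<le> m + k"
  using degree_mult_le[of p q] by linarith

lemma top_coeffs_glue:
  "top_coeffs X m a b \<Longrightarrow> top_coeffs Y k c d \<Longrightarrow> top_coeffs (glue X Y) (m + k) (a * c) (a * d + b * c)"
  by (auto simp: top_coeffs_def glue_def coeff_mult_top intro!: degree_mult_le' degree_add_le)

lemma degree_tt_mult: "degree p \<le> m \<Longrightarrow> degree (tt * p) \<le> Suc m"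
  using degree_mult_le'[of tt 1 p m] by (simp add: tt_def)

lemma top_coeffs_hang:
  assumes "top_coeffs X m a b"
  shows "top_coeffs (hang X) (Suc m) a (a + b)"
proof -
  have "coeff (fst X) (Suc m) = 0" "coeff (snd X) (Suc m) = 0"
    using assms by (auto simp: top_coeffs_def coeff_eq_0)
  then show ?thesis
    using assms degree_tt_mult[of "fst X" m] degree_tt_mult[of "snd X" m]
    by (auto simp: top_coeffs_def hang_def distrib_right coeff_tt_mult intro!: degree_add_le)
qed

lemma top_coeffs_path: "top_coeffs (path_pair b) b 1 b"
proof (induction b)
  case (Suc b)
  then show ?case using top_coeffs_hang[of "path_pair b" b 1 b] by (simp add: path_pair_Suc add.commute)
qed (simp add: top_coeffs_def)

lemma top_coeffs_legs: "top_coeffs (legs_pair bs) (sum_list bs) 1 (sum_list bs)"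
proof (induction bs)
  case (Cons b bs)
  then show ?case using top_coeffs_glue[OF top_coeffs_path[of b] Cons.IH] by (simp add: add.commute)
qed (simp add: top_coeffs_def)

lemma top_coeffs_tri_stem: "top_coeffs (tri_stem q) (2 + q) 3 (6 + 3 * real q)"
proof (induction q)
  case 0
  then show ?case by (simp add: top_coeffs_def tri_pair_coeffs numeral_2_eq_2)
next
  case (Suc q)
  have "3 + (6 + 3 * real q) = 6 + 3 * real (Suc q)" by simp
  then show ?case using top_coeffs_hang[OF Suc.IH] by (simp only: funpow.simps o_apply add_Suc_right)
qed

lemma top_coeffs_cross:
  assumes "top_coeffs X m a b" "top_coeffs Y k c d"
  shows "degree (cross X Y) \<le> m + k \<and> coeff (cross X Y) (m + k) = b * c - a * d"
proof -
  have "coeff (fst Y * snd X) (k + m) = c * b" "coeff (fst X * snd Y) (m + k) = a * d"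
    "degree (fst Y * snd X) \<le> k + m" "degree (fst X * snd Y) \<le> m + k"
    using assms by (auto simp: top_coeffs_def coeff_mult_top intro!: degree_mult_le')
  then show ?thesis
    by (auto simp: cross_def add.commute intro!: degree_diff_le)
qed

definition U_poly :: "nat \<Rightarrow> nat \<Rightarrow> nat \<Rightarrow> real poly" where
  "U_poly n l q = tot (glue (tri_stem q) (legs_pair (leg_lengths (n - 3 - q) l)))"

text \<open>
  Going from \<open>q\<close> to \<open>q + 1\<close> takes one vertex from a longest leg and puts it on the path to the
  triangle. The lowest coefficient of the difference is positive and the highest one is negative.
\<close>

lemma U_poly_step:
  assumes l: "2 \<le> l" and q: "l * (q + 3) + Suc q + 3 \<le> n"
  shows "coeff (U_poly n l (Suc q)) (n - 2) < coeff (U_poly n l q) (n - 2)"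
    and "coeff (U_poly n l q) (2 * q + 2) < coeff (U_poly n l (Suc q)) (2 * q + 2)"
    and "k < 2 * q + 2 \<Longrightarrow> coeff (U_poly n l (Suc q)) k = coeff (U_poly n l q) k"
proof -
  define M where "M = n - 3 - Suc q"
  have M: "n - 3 - q = Suc M" "l * (q + 3) \<le> M" using q by (auto simp: M_def)
  \<comment> \<open>The shortest leg of the candidate for \<open>q + 1\<close>. By hypothesis it has
    length at least \<open>q + 3\<close>, one more than a stem of length \<open>q\<close> with its
    triangle can beat.\<close>
  define j where "j = M div l"
  have j: "q + 3 \<le> j" using M(2) l unfolding j_def by (simp add: less_eq_div_iff_mult_less_eq mult.commute)
  define rs where "rs = map (\<lambda>i. (M + i) div l) [1..<l]"
  have "[0..<l] = 0 # [1..<l]" using l by (simp add: upt_conv_Cons)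
  then have legsM: "leg_lengths M l = j # rs"
    by (simp add: leg_lengths_def rs_def j_def)
  have "leg_lengths (Suc M) l = map (\<lambda>i. (M + i) div l) (map Suc [0..<l])"
    by (simp add: leg_lengths_def o_def)
  also have "map Suc [0..<l] = [1..<l] @ [l]"
    using l by (simp add: map_Suc_upt)
  finally have legsM': "leg_lengths (Suc M) l = rs @ [Suc j]"
    using l by (simp add: rs_def j_def)
  define S where "S = legs_pair rs"
  have Uq: "U_poly n l q = tot (glue (tri_stem q) (glue S (hang (path_pair j))))"
    unfolding U_poly_def M(1) legsM' by (simp add: legs_pair_append S_def path_pair_Suc)
  have Uq': "U_poly n l (Suc q) = tot (glue (hang (tri_stem q)) (glue (path_pair j) S))"
    unfolding U_poly_def M_def[symmetric] legsM by (simp add: S_def)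
  \<comment> \<open>In both graphs one edge joins the stem of length \<open>q\<close> to a path of
    length \<open>j\<close>; the remaining legs \<open>S\<close> sit at one or the other end of this
    edge.\<close>
  have diff: "U_poly n l (Suc q) - U_poly n l q = snd S * cross (tri_stem q) (path_pair j)"
    unfolding Uq Uq' by (simp add: tot_def glue_def hang_def cross_def algebra_simps)
  have rs0: "0 \<notin> set rs"
  proof -
    have "l * 1 \<le> l * (q + 3)" by (intro mult_le_mono2) simp
    then have "l \<le> M" using M(2) by linarith
    then show ?thesis using l by (auto simp: rs_def div_eq_0_iff)
  qed
  have len: "length rs = l - 1" by (simp add: rs_def)
  have sum: "sum_list rs + j = M"
    using sum_leg_lengths[of l M] l unfolding legsM by simp
  have sum_pos: "0 < sum_list rs"
  proof -
    have "rs \<noteq> []" using len l by auto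
    with rs0 show ?thesis by (cases rs) auto
  qed
  have low: "low_coeffs S (real (l - 1))"
    unfolding S_def len[symmetric] by (rule low_coeffs_legs[OF rs0])
  have top: "top_coeffs S (sum_list rs) 1 (sum_list rs)"
    unfolding S_def by (rule top_coeffs_legs)
  have cr: "degree (cross (tri_stem q) (path_pair j)) \<le> 2 + q + j \<and>
     coeff (cross (tri_stem q) (path_pair j)) (2 + q + j) = (6 + 3 * real q) * 1 - 3 * real j"
    by (rule top_coeffs_cross[OF top_coeffs_tri_stem top_coeffs_path])
  \<comment> \<open>In degree \<open>n - 1\<close> every graph of this kind has 3 spanning trees
    with \<open>n\<close> choices of the root, so \<open>n - 2\<close> is the highest degree in
    which two of them can differ.\<close>
  have "sum_list rs + (2 + q + j) = n - 2" using sum q by (simp add: M_def)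
  then have "coeff (U_poly n l (Suc q) - U_poly n l q) (n - 2) = real (sum_list rs) * ((6 + 3 * real q) * 1 - 3 * real j)"
    unfolding diff using coeff_mult_top[of "snd S" "sum_list rs" "cross (tri_stem q) (path_pair j)" "2 + q + j"] top cr
    by (simp add: top_coeffs_def)
  moreover have "real (sum_list rs) * ((6 + 3 * real q) * 1 - 3 * real j) < 0"
    using sum_pos j by (intro mult_pos_neg) simp_all
  ultimately show "coeff (U_poly n l (Suc q)) (n - 2) < coeff (U_poly n l q) (n - 2)"
    unfolding coeff_diff by linarith
  \<comment> \<open>Removing the \<open>q\<close> common levels of stem and path yields the factor
    of degree \<open>2 * q\<close>. Then \<open>snd S\<close> starts with \<open>l - 1\<close> in
    degree 1, and \<open>cross\<close> with the difference 2 - 1 of the degrees at the two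
    roots.\<close>
  define R where "R = snd S * cross tri_pair (path_pair (j - q))"
  have "path_pair j = (hang ^^ q) (path_pair (j - q))"
    using j unfolding path_pair_def by (simp flip: funpow_add[THEN fun_cong, unfolded o_apply])
  then have diff': "U_poly n l (Suc q) - U_poly n l q = monom 1 (2 * q) * R"
    unfolding diff R_def by (simp add: cross_hang_pow tt_power mult_ac)
  have "low_coeffs tri_pair 2" by (simp add: low_coeffs_def tri_pair_coeffs)
  from low_coeffs_cross[OF this low_coeffs_path[of "j - q"]]
  have cr1: "coeff (cross tri_pair (path_pair (j - q))) 0 = 0" "coeff (cross tri_pair (path_pair (j - q))) (Suc 0) = 1"
    using j by simp_all
  have R: "coeff R 0 = 0" "coeff R (Suc 0) = 0" "coeff R (Suc (Suc 0)) = real (l - 1)"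
    using low cr1 by (simp_all add: R_def coeff_mult low_coeffs_def)
  have "coeff (U_poly n l (Suc q) - U_poly n l q) (2 * q + 2) = real (l - 1)"
    unfolding diff' using R by (simp add: coeff_monom_mult numeral_2_eq_2)
  then show "coeff (U_poly n l q) (2 * q + 2) < coeff (U_poly n l (Suc q)) (2 * q + 2)"
    using l by simp
  assume k: "k < 2 * q + 2"
  have "coeff (U_poly n l (Suc q) - U_poly n l q) k = 0"
  proof (cases "k < 2 * q")
    case False
    with k have "k - 2 * q = 0 \<or> k - 2 * q = Suc 0" by linarith
    then show ?thesis unfolding diff' using R by (auto simp: coeff_monom_mult)
  qed (simp add: diff' coeff_monom_mult)
  then show "coeff (U_poly n l (Suc q)) k = coeff (U_poly n l q) k" by simp
qed

text \<open>Telescoping over the single steps: the coefficient in degree \<open>n - 2\<close> falls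
  each time, while the one in degree \<open>2 * q + 2\<close> rises at the first step and lies below
  the reach of all later ones.\<close>

lemma U_poly_incomparable:
  assumes l: "2 \<le> l" and r: "(l + 1) * r + 3 + 2 * l \<le> n" and q: "q < r"
  shows "coeff (U_poly n l r) (n - 2) < coeff (U_poly n l q) (n - 2)"
    "coeff (U_poly n l q) (2 * q + 2) < coeff (U_poly n l r) (2 * q + 2)"
proof -
  have bound: "l * (s + 3) + Suc s + 3 \<le> n" if "s < r" for s
  proof -
    have "(l + 1) * Suc s \<le> (l + 1) * r" using that by (intro mult_le_mono2) simp
    then show ?thesis using r by (simp add: algebra_simps)
  qed
  have "q + Suc d \<le> r \<Longrightarrow> coeff (U_poly n l (q + Suc d)) (n - 2) < coeff (U_poly n l q) (n - 2) \<and>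
    coeff (U_poly n l q) (2 * q + 2) < coeff (U_poly n l (q + Suc d)) (2 * q + 2)" for d
  proof (induction d)
    case 0
    then have "q < r" by simp
    from U_poly_step(1,2)[OF l bound[OF this]] show ?case by simp
  next
    case (Suc d)
    then have less: "q + Suc d < r" by simp
    have "2 * q + 2 < 2 * (q + Suc d) + 2" by simp
    from U_poly_step(1)[OF l bound[OF less]] U_poly_step(3)[OF l bound[OF less] this] Suc
    show ?case by simp
  qed
  from this[of "r - Suc q"] q show "coeff (U_poly n l r) (n - 2) < coeff (U_poly n l q) (n - 2)"
    "coeff (U_poly n l q) (2 * q + 2) < coeff (U_poly n l r) (2 * q + 2)"
    by simp_all
qed

section \<open>The minimal elements\<close>

lemma U_graph_class:
  assumes l: "0 < l" and n: "3 + q + l \<le> n"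
  shows "U_graph n l 3 q \<in> unicyclic_graphs n l 3"
    and "k \<le> n \<Longrightarrow> real_of_int (lap_coeff (U_graph n l 3 q) k) = coeff (U_poly n l q) k"
proof -
  obtain T where T: "shape T = stem q (legs (leg_lengths (n - 3 - q) l))" "wf_tri T (Vtx 1) (Vtx 2)"
    "tri_verts T (Vtx 1) (Vtx 2) = {0..<n}" "U_graph n l 3 q = tri_graph T (Vtx 1) (Vtx 2)"
    using U_graph_tri_graph[OF assms] by blast
  define bs where "bs = leg_lengths (n - 3 - q) l"
  have len: "length bs = l" by (simp add: bs_def leg_lengths_def)
  have nz: "0 \<notin> set bs" using assms by (auto simp: bs_def leg_lengths_def div_eq_0_iff)
  have ne: "legs bs \<noteq> pt" using nleaves_legs[of bs] len l by (metis nleaves_eq_0_unit less_irrefl)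
  have "nleaves T = nleaves (stem q (legs bs))" using T(1) unfolding bs_def by (metis nleaves_map)
  then have leaves: "nleaves T = l" using ne len by (simp add: nleaves_legs)
  show "U_graph n l 3 q \<in> unicyclic_graphs n l 3"
    unfolding T(4) by (rule tri_graph_in_class[OF T(2,3)]) (simp add: leaves)
  assume k: "k \<le> n"
  have "pair_of T = pair_of (stem q (legs bs))" using T(1) unfolding bs_def by (metis pair_of_map)
  then have "tri_total (pair_of T) (pair_of (Vtx 1)) (pair_of (Vtx 2)) = U_poly n l q"
    using nz unfolding U_poly_def bs_def[symmetric]
    by (simp add: tri_total_unit pair_of_legs tot_glue_hang_pow)
  then show "real_of_int (lap_coeff (U_graph n l 3 q) k) = coeff (U_poly n l q) k"
    unfolding T(4) lap_coeff_tri_graph[OF T(2,3) k] by simp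
qed

lemma better_imp_lap_less:
  assumes wf: "wf_tri T1 T2 T3" "tri_verts T1 T2 T3 = {0..<n}"
    and better: "better R1 R2 R3 (shape T1) (shape T2) (shape T3)"
    and l: "nleaves T1 + nleaves T2 + nleaves T3 = l"
  shows "\<exists>H\<in>unicyclic_graphs n l 3. lap_less H (tri_graph T1 T2 T3)"
proof -
  have "nverts T1 + nverts T2 + nverts T3 = n"
    using wf unfolding wf_tri_iff_card by simp
  then have "nverts R1 + nverts R2 + nverts R3 = n"
    using better by (simp add: better_def)
  from labelled_triple_exists[OF this] obtain S1 S2 S3 where
    S: "shape S1 = R1" "shape S2 = R2" "shape S3 = R3" "wf_tri S1 S2 S3" "tri_verts S1 S2 S3 = {0..<n}"
    by blast
  have pairs: "pair_of R1 = pair_of S1" "pair_of R2 = pair_of S2" "pair_of R3 = pair_of S3"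
    using S(1-3) by (metis pair_of_map)+
  have "nleaves S1 + nleaves S2 + nleaves S3 = l"
    using better l S(1-3) unfolding better_def by (metis nleaves_map)
  then have cls: "tri_graph S1 S2 S3 \<in> unicyclic_graphs n l 3"
    by (rule tri_graph_in_class[OF S(4,5)])
  define p q where "p = tri_total (pair_of T1) (pair_of T2) (pair_of T3)"
    "q = tri_total (pair_of S1) (pair_of S2) (pair_of S3)"
  have pos: "positive_poly (p - q)" using better by (simp add: better_def pairs p_q_def)
  then have le: "coeff q k \<le> coeff p k" for k
    by (simp add: positive_poly_def nonneg_poly_def)
  obtain k where k: "coeff (p - q) k \<noteq> 0"
    using pos by (auto simp: positive_poly_def poly_eq_iff)
  have "k \<le> n"
    using k coeff_tri_total_eq_0[OF wf, of k] coeff_tri_total_eq_0[OF S(4,5), of k]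
    by (cases "n < k") (auto simp: p_q_def)
  have "coeff q k < coeff p k" using k le[of k] by simp
  have cT: "real_of_int (lap_coeff (tri_graph T1 T2 T3) k) = coeff p k" if "k \<le> n" for k
    unfolding p_q_def by (rule lap_coeff_tri_graph[OF wf that])
  have cS: "real_of_int (lap_coeff (tri_graph S1 S2 S3) k) = coeff q k" if "k \<le> n" for k
    unfolding p_q_def by (rule lap_coeff_tri_graph[OF S(4,5) that])
  have card: "card (pverts (tri_graph S1 S2 S3)) = n" "card (pverts (tri_graph T1 T2 T3)) = n"
    using wf S by (simp_all add: tri_graph_def)
  have "lap_le (tri_graph S1 S2 S3) (tri_graph T1 T2 T3)"
    unfolding lap_le_def card
  proof (intro conjI allI impI refl)
    fix k assume "k \<le> n"
    then show "lap_coeff (tri_graph S1 S2 S3) k \<le> lap_coeff (tri_graph T1 T2 T3) k"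
      using le[of k] cT[of k] cS[of k] by linarith
  qed
  moreover have "lap_coeff (tri_graph S1 S2 S3) k < lap_coeff (tri_graph T1 T2 T3) k"
    using \<open>k \<le> n\<close> \<open>coeff q k < coeff p k\<close> cT[of k] cS[of k] by linarith
  ultimately have "lap_less (tri_graph S1 S2 S3) (tri_graph T1 T2 T3)"
    using \<open>k \<le> n\<close> card unfolding lap_less_def by metis
  with cls show ?thesis by blast
qed

text \<open>Legs of length at least \<open>s + 2\<close> use at least \<open>l * (s + 2)\<close>
  vertices, and \<open>s + 3\<close> others belong to the stem and the triangle, which gives the
  bound for \<open>s > 0\<close>. Balanced legs are a permutation of \<open>leg_lengths\<close>, so
  the spider is the candidate for \<open>s\<close>.\<close>

lemma optimal_spider_iso:
  assumes wf: "wf_tri T1 T2 T3" "tri_verts T1 T2 T3 = {0..<n}"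
    and shape: "shape T1 = stem s (legs bs)" "shape T2 = pt" "shape T3 = pt"
    and opt: "optimal_spider s bs" and l: "length bs = l" "2 \<le> l" and n: "3 + 2 * l \<le> n"
  shows "(l + 1) * s + 3 + 2 * l \<le> n" "(tri_graph T1 T2 T3, U_graph n l 3 s) \<in> graph_iso"
    "k \<le> n \<Longrightarrow> real_of_int (lap_coeff (tri_graph T1 T2 T3) k) = coeff (U_poly n l s) k"
proof -
  have nz: "0 \<notin> set bs" and bal: "\<forall>b\<in>set bs. \<forall>c\<in>set bs. c \<le> b + 1"
    and long: "s = 0 \<or> (\<forall>b\<in>set bs. s + 2 \<le> b)"
    using opt by (auto simp: optimal_spider_def)
  have nv: "nverts T1 = s + Suc (sum_list bs)" "nverts T2 = 1" "nverts T3 = 1"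
    using shape nz nverts_map[of "\<lambda>_. ()" T1] nverts_map[of "\<lambda>_. ()" T2] nverts_map[of "\<lambda>_. ()" T3]
    by (simp_all add: nverts_legs)
  have sum: "n = s + 3 + sum_list bs"
    using wf nv unfolding wf_tri_iff_card by simp
  have "length bs * (s + 2) \<le> sum_list bs" if "\<forall>b\<in>set bs. s + 2 \<le> b"
    using that by (induction bs) auto
  then show bound: "(l + 1) * s + 3 + 2 * l \<le> n"
    using long n l(1) sum by (auto simp: algebra_simps)
  then have bound': "3 + s + l \<le> n" by simp
  have "n - 3 - s = sum_list bs" using sum by simp
  then have ms: "mset bs = mset (leg_lengths (n - 3 - s) l)"
    using mset_balanced[OF bal l(1)] l(2) by simp
  from permute_legs[OF shape(1) ms] obtain S where
    S: "shape S = stem s (legs (leg_lengths (n - 3 - s) l))" "edges S = edges T1" "set_rtree S = set_rtree T1" "root_of S = root_of T1"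
    by blast
  have G: "tri_graph S T2 T3 = tri_graph T1 T2 T3" "tri_verts S T2 T3 = tri_verts T1 T2 T3"
    using S by (simp_all add: tri_graph_def tri_verts_def tri_edges_def)
  have nz': "0 \<notin> set (leg_lengths (n - 3 - s) l)"
    using nz ms by (metis set_mset_mset)
  have "nverts S = s + Suc (sum_list (leg_lengths (n - 3 - s) l))"
    using S(1) nverts_map[of "\<lambda>_. ()" S] nz' by (simp add: nverts_legs)
  also have "sum_list (leg_lengths (n - 3 - s) l) = sum_list bs"
    using ms by (metis sum_mset_sum_list)
  finally have wfS: "wf_tri S T2 T3" using wf(1) nv unfolding wf_tri_iff_card G by simp
  obtain U where U: "shape U = stem s (legs (leg_lengths (n - 3 - s) l))" "wf_tri U (Vtx 1) (Vtx 2)"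
    "tri_verts U (Vtx 1) (Vtx 2) = {0..<n}" "U_graph n l 3 s = tri_graph U (Vtx 1) (Vtx 2)"
    using U_graph_tri_graph[of l s n] bound' l by auto
  have sh: "shape S = shape U" "shape T2 = shape (Vtx 1)" "shape T3 = shape (Vtx 2)"
    using S U shape by simp_all
  show iso: "(tri_graph T1 T2 T3, U_graph n l 3 s) \<in> graph_iso"
    unfolding U(4) G(1)[symmetric] by (rule same_shape_graph_iso[OF wfS U(2) sh])
  assume k: "k \<le> n"
  have "lap_coeff (U_graph n l 3 s) k = lap_coeff (tri_graph T1 T2 T3) k"
    by (rule graph_iso_lap_coeff[OF wf iso _ k]) (simp add: U_graph_def)
  then show "real_of_int (lap_coeff (tri_graph T1 T2 T3) k) = coeff (U_poly n l s) k"
    using U_graph_class(2)[OF _ bound' k] l by simp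
qed

lemma improvable_or_U_graph:
  assumes G: "G \<in> unicyclic_graphs n l 3" and l: "2 \<le> l" and n: "3 + 2 * l \<le> n"
  shows "(\<exists>H\<in>unicyclic_graphs n l 3. lap_less H G) \<or>
    (\<exists>q. (l + 1) * q + 3 + 2 * l \<le> n \<and> (G, U_graph n l 3 q) \<in> graph_iso \<and>
       (\<forall>k\<le>n. real_of_int (lap_coeff G k) = coeff (U_poly n l q) k))"
proof -
  obtain T1 T2 T3 where wf: "wf_tri T1 T2 T3" "tri_verts T1 T2 T3 = {0..<n}" and G_eq: "G = tri_graph T1 T2 T3"
    using unicyclic_triangle_is_tri_graph[OF G] by blast
  have leaves: "nleaves T1 + nleaves T2 + nleaves T3 = l"
    using G card_leaves_tri_graph[OF wf(1)] by (simp add: unicyclic_graphs_def G_eq)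
  have spider: ?thesis
    if "wf_tri S1 S2 S3" "tri_verts S1 S2 S3 = {0..<n}" "G = tri_graph S1 S2 S3"
      "shape S1 = stem s (legs bs)" "shape S2 = pt" "shape S3 = pt" "optimal_spider s bs"
      "nleaves S1 + nleaves S2 + nleaves S3 = l" for S1 S2 S3 s bs
  proof -
    have "nleaves S2 = 0" "nleaves S3 = 0"
      using that(5,6) nleaves_map[of "\<lambda>_. ()" S2] nleaves_map[of "\<lambda>_. ()" S3] by simp_all
    then have S1: "nleaves (stem s (legs bs)) = l"
      using that(4,8) nleaves_map[of "\<lambda>_. ()" S1] by simp
    have "legs bs \<noteq> pt"
    proof
      assume "legs bs = pt"
      then have "nleaves (stem s (legs bs)) \<le> 1" by (simp add: nleaves_path)
      with S1 l show False by simp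
    qed
    with S1 have "length bs = l" by (simp add: nleaves_legs)
    from optimal_spider_iso[OF that(1,2,4,5,6,7) this l n] show ?thesis
      unfolding that(3) by blast
  qed
  have "2 \<le> nleaves (shape T1) + nleaves (shape T2) + nleaves (shape T3)" using leaves l by simp
  from improvable_or_spider[OF this] show ?thesis
  proof
    assume "\<exists>R1 R2 R3. better R1 R2 R3 (shape T1) (shape T2) (shape T3)"
    then show ?thesis
      using better_imp_lap_less[OF wf _ leaves] unfolding G_eq by blast
  next
    assume "\<exists>s bs. (shape T1, shape T2, shape T3) \<in>
      {(stem s (legs bs), pt, pt), (pt, stem s (legs bs), pt), (pt, pt, stem s (legs bs))} \<and> optimal_spider s bs"
    then obtain s bs where opt: "optimal_spider s bs" and
      "(shape T1, shape T2, shape T3) \<in>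
        {(stem s (legs bs), pt, pt), (pt, stem s (legs bs), pt), (pt, pt, stem s (legs bs))}" by blast
    then consider
      "shape T1 = stem s (legs bs)" "shape T2 = pt" "shape T3 = pt"
      | "shape T2 = stem s (legs bs)" "shape T3 = pt" "shape T1 = pt"
      | "shape T3 = stem s (legs bs)" "shape T1 = pt" "shape T2 = pt"
      by auto
    then show ?thesis
    proof cases
      case 1
      show ?thesis by (rule spider[OF wf G_eq 1 opt leaves])
    next
      case 2
      have "wf_tri T2 T3 T1" "tri_verts T2 T3 T1 = {0..<n}" "G = tri_graph T2 T3 T1"
        "nleaves T2 + nleaves T3 + nleaves T1 = l"
        using wf leaves unfolding G_eq wf_tri_rotate[of T2 T3 T1] tri_verts_rotate[of T2 T3 T1]
          tri_graph_rotate[of T2 T3 T1] by simp_all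
      then show ?thesis using spider[OF _ _ _ 2 opt] by blast
    next
      case 3
      have "wf_tri T3 T1 T2" "tri_verts T3 T1 T2 = {0..<n}" "G = tri_graph T3 T1 T2"
        "nleaves T3 + nleaves T1 + nleaves T2 = l"
        using wf leaves unfolding G_eq wf_tri_rotate[of T1 T2 T3, symmetric] tri_verts_rotate[of T1 T2 T3, symmetric]
          tri_graph_rotate[of T1 T2 T3, symmetric] by simp_all
      then show ?thesis using spider[OF _ _ _ 3 opt] by blast
    qed
  qed
qed

lemma nonneg_tri_total:
  assumes "good X" "good Y" "good Z"
  shows "nonneg_poly (tri_total X Y Z)"
  using assms unfolding tri_total_def tot_def good_def
  by (auto intro!: nonneg_poly_add nonneg_poly_mult simp: positive_poly_imp_nonneg)

lemma lap_coeff_nonneg: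
  assumes G: "G \<in> unicyclic_graphs n l 3" and k: "k \<le> n"
  shows "0 \<le> lap_coeff G k"
proof -
  obtain T1 T2 T3 where wf: "wf_tri T1 T2 T3" "tri_verts T1 T2 T3 = {0..<n}" and G_eq: "G = tri_graph T1 T2 T3"
    using unicyclic_triangle_is_tri_graph[OF G] by blast
  have "0 \<le> coeff (tri_total (pair_of T1) (pair_of T2) (pair_of T3)) k"
    using nonneg_tri_total[of "pair_of T1" "pair_of T2" "pair_of T3"] by (simp add: nonneg_poly_def)
  then show ?thesis
    unfolding lap_coeff_tri_graph[OF wf k, symmetric] G_eq by simp
qed

lemma lap_le_trans: "lap_le G H \<Longrightarrow> lap_le H K \<Longrightarrow> lap_le G K"
  unfolding lap_le_def by (metis order_trans)

text \<open>The sum of all coefficients is a nonnegative integer that drops strictly along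
  \<open>lap_less\<close>.\<close>

lemma minimal_below:
  assumes "G \<in> unicyclic_graphs n l 3"
  shows "\<exists>M\<in>minimal_graphs (unicyclic_graphs n l 3). lap_le M G"
  using assms
proof (induction "nat (\<Sum>k\<le>n. lap_coeff G k)" arbitrary: G rule: less_induct)
  case less
  show ?case
  proof (cases "G \<in> minimal_graphs (unicyclic_graphs n l 3)")
    case True
    then show ?thesis by (intro bexI[of _ G]) (simp_all add: lap_le_def)
  next
    case False
    with less.prems obtain H where H: "H \<in> unicyclic_graphs n l 3" "lap_less H G"
      by (auto simp: minimal_graphs_def)
    have card: "card (pverts H) = n" "card (pverts G) = n"
      using H(1) less.prems by (auto simp: unicyclic_graphs_def graph_of_order_def)
    have le: "\<And>k. k \<le> n \<Longrightarrow> lap_coeff H k \<le> lap_coeff G k" and "\<exists>k\<le>n. lap_coeff H k < lap_coeff G k"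
      using H(2) unfolding lap_less_def lap_le_def card by auto
    then have "(\<Sum>k\<le>n. lap_coeff H k) < (\<Sum>k\<le>n. lap_coeff G k)"
      by (intro sum_strict_mono_ex1) auto
    moreover have "0 \<le> (\<Sum>k\<le>n. lap_coeff H k)"
      using lap_coeff_nonneg[OF H(1)] by (intro sum_nonneg) simp
    ultimately have "nat (\<Sum>k\<le>n. lap_coeff H k) < nat (\<Sum>k\<le>n. lap_coeff G k)" by simp
    from less.hyps[OF this H(1)] obtain M where "M \<in> minimal_graphs (unicyclic_graphs n l 3)" "lap_le M H" by blast
    with H(2) show ?thesis unfolding lap_less_def using lap_le_trans by blast
  qed
qed

theorem theorem4p3:
  fixes n l p :: nat
  assumes "2 \<le> l"
    and "int p = \<lfloor>(real n - 3 - 2 * real l) / (real l + 1)\<rfloor>"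
  shows "minimal_graphs (unicyclic_graphs n l 3) // graph_iso
           = (\<lambda>q. graph_iso `` {U_graph n l 3 q}) ` {0..p}
       \<and> card (minimal_graphs (unicyclic_graphs n l 3) // graph_iso) = p + 1"
proof -
  define S where "S = unicyclic_graphs n l 3"
  define U where "U = U_graph n l 3"
  have le_p: "q \<le> p \<longleftrightarrow> (l + 1) * q + 3 + 2 * l \<le> n" for q
  proof -
    have "q \<le> p \<longleftrightarrow> int q \<le> \<lfloor>(real n - 3 - 2 * real l) / (real l + 1)\<rfloor>"
      unfolding assms(2)[symmetric] by simp
    also have "\<dots> \<longleftrightarrow> real q \<le> (real n - 3 - 2 * real l) / (real l + 1)"
      by (simp add: le_floor_iff)
    also have "\<dots> \<longleftrightarrow> real q * (real l + 1) \<le> real n - 3 - 2 * real l"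
      by (simp add: pos_le_divide_eq)
    also have "\<dots> \<longleftrightarrow> real ((l + 1) * q + 3 + 2 * l) \<le> real n"
      by (simp add: algebra_simps)
    finally show ?thesis by (simp only: of_nat_le_iff)
  qed
  \<comment> \<open>\<open>p\<close> is a natural number, so the floor is nonnegative; this is its
    content for \<open>q = 0\<close>.\<close>
  have n: "3 + 2 * l \<le> n" using le_p[of 0] by simp
  have bound: "3 + q + l \<le> n" if "q \<le> p" for q
    using that unfolding le_p by simp
  have l: "0 < l" using assms(1) by simp
  have U_in: "U q \<in> S" if "q \<le> p" for q
    unfolding U_def S_def using U_graph_class(1)[OF l bound[OF that]] .
  have U_coeff: "real_of_int (lap_coeff (U q) k) = coeff (U_poly n l q) k" if "q \<le> p" "k \<le> n" for q k
    unfolding U_def using U_graph_class(2)[OF l bound[OF that(1)] that(2)] .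
  have incomparable: "\<exists>k\<le>n. coeff (U_poly n l r) k < coeff (U_poly n l q) k" if "q \<le> p" "r \<le> p" "q \<noteq> r" for q r
  proof (cases "q < r")
    case True
    with U_poly_incomparable(1)[OF assms(1) _ True, of n] that(2) le_p show ?thesis
      by (intro exI[of _ "n - 2"]) simp
  next
    case False
    with that have less: "r < q" by simp
    \<comment> \<open>Keeps the separating index \<open>2 * r + 2\<close> within the range
      \<open>k \<le> n\<close>.\<close>
    have "3 * r \<le> (l + 1) * r" using assms(1) by (intro mult_le_mono1) simp
    then have "2 * r + 2 \<le> n" using that(2)[unfolded le_p] by linarith
    with U_poly_incomparable(2)[OF assms(1) _ less, of n] that(1) le_p show ?thesis
      by (intro exI[of _ "2 * r + 2"]) simp
  qed
  have char: "\<exists>q\<le>p. (G, U q) \<in> graph_iso \<and> (\<forall>k\<le>n. real_of_int (lap_coeff G k) = coeff (U_poly n l q) k)"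
    if "G \<in> minimal_graphs S" for G
  proof -
    have "G \<in> unicyclic_graphs n l 3" "\<not> (\<exists>H\<in>unicyclic_graphs n l 3. lap_less H G)"
      using that by (auto simp: minimal_graphs_def S_def)
    with improvable_or_U_graph[OF _ assms(1) n, of G] show ?thesis
      unfolding le_p U_def by blast
  qed
  have order: "card (pverts G) = n" if "G \<in> S" for G
    using that by (auto simp: S_def unicyclic_graphs_def graph_of_order_def)
  \<comment> \<open>A graph below \<open>U q\<close> lies above a minimal one, which has the
    coefficients of some \<open>U r\<close>. So \<open>U r\<close> would be below
    \<open>U q\<close>, strictly at some index, against incomparability.\<close>
  have U_min: "U q \<in> minimal_graphs S" if q: "q \<le> p" for q
  proof (rule ccontr)
    assume "U q \<notin> minimal_graphs S"
    then obtain H where H: "H \<in> S" "lap_less H (U q)" using U_in[OF q] by (auto simp: minimal_graphs_def)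
    from minimal_below[of H n l] H(1) obtain M where M: "M \<in> minimal_graphs S" "lap_le M H"
      unfolding S_def by blast
    from char[OF M(1)] obtain r where r: "r \<le> p"
      "\<And>k. k \<le> n \<Longrightarrow> real_of_int (lap_coeff M k) = coeff (U_poly n l r) k" by blast
    have cards: "card (pverts H) = n" "card (pverts M) = n" using order H(1) M(1) by (auto simp: minimal_graphs_def)
    have MH: "lap_coeff M k \<le> lap_coeff H k" if "k \<le> n" for k
      using M(2) that unfolding lap_le_def cards by blast
    have HU: "lap_coeff H k \<le> lap_coeff (U q) k" if "k \<le> n" for k
      using H(2) that unfolding lap_less_def lap_le_def cards by blast
    obtain k0 where k0: "k0 \<le> n" "lap_coeff H k0 < lap_coeff (U q) k0"
      using H(2) unfolding lap_less_def cards by blast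
    have le: "coeff (U_poly n l r) k \<le> coeff (U_poly n l q) k" if "k \<le> n" for k
      using MH[OF that] HU[OF that] r(2)[OF that] U_coeff[OF q that] by linarith
    have "coeff (U_poly n l r) k0 < coeff (U_poly n l q) k0"
      using MH[OF k0(1)] k0(2) r(2)[OF k0(1)] U_coeff[OF q k0(1)] by linarith
    then have "q \<noteq> r" by auto
    with incomparable[OF r(1) q] le show False by (metis not_less)
  qed
  have repr: "\<exists>T1 T2 T3. wf_tri T1 T2 T3 \<and> tri_verts T1 T2 T3 = {0..<n} \<and> G = tri_graph T1 T2 T3" if "G \<in> S" for G
    using unicyclic_triangle_is_tri_graph that by (simp add: S_def)
  have quot: "minimal_graphs S // graph_iso = (\<lambda>q. graph_iso `` {U q}) ` {0..p}"
  proof (intro equalityI subsetI)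
    fix X assume "X \<in> minimal_graphs S // graph_iso"
    then obtain G where G: "G \<in> minimal_graphs S" "X = graph_iso `` {G}" by (auto elim: quotientE)
    from char[OF G(1)] obtain q where q: "q \<le> p" "(G, U q) \<in> graph_iso" by blast
    from repr[of G] G(1) obtain T1 T2 T3 where "wf_tri T1 T2 T3" "G = tri_graph T1 T2 T3"
      by (auto simp: minimal_graphs_def)
    with graph_iso_class q(2) have "graph_iso `` {G} = graph_iso `` {U q}" by blast
    with G(2) q(1) show "X \<in> (\<lambda>q. graph_iso `` {U q}) ` {0..p}" by auto
  next
    fix X assume "X \<in> (\<lambda>q. graph_iso `` {U q}) ` {0..p}"
    then obtain q where "q \<le> p" "X = graph_iso `` {U q}" by auto
    with U_min show "X \<in> minimal_graphs S // graph_iso" by (auto intro: quotientI)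
  qed
  \<comment> \<open>Isomorphic candidates would have equal coefficients, which incomparability also
    rules out.\<close>
  have "inj_on (\<lambda>q. graph_iso `` {U q}) {0..p}"
  proof (rule inj_onI, rule ccontr)
    fix q r assume q: "q \<in> {0..p}" and r: "r \<in> {0..p}" and eq: "graph_iso `` {U q} = graph_iso `` {U r}" and ne: "q \<noteq> r"
    from repr[OF U_in[of q]] q obtain T1 T2 T3 where
      T: "wf_tri T1 T2 T3" "tri_verts T1 T2 T3 = {0..<n}" "U q = tri_graph T1 T2 T3" by auto
    from repr[OF U_in[of r]] r obtain R1 R2 R3 where "wf_tri R1 R2 R3" "U r = tri_graph R1 R2 R3" by auto
    then have "(U r, U r) \<in> graph_iso" using same_shape_graph_iso[of R1 R2 R3 R1 R2 R3] by simp
    with eq have "(tri_graph T1 T2 T3, U r) \<in> graph_iso" unfolding T(3) by blast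
    moreover have "pverts (U r) = {0..<n}" by (simp add: U_def U_graph_def)
    ultimately have "lap_coeff (U r) k = lap_coeff (U q) k" if "k \<le> n" for k
      unfolding T(3) by (rule graph_iso_lap_coeff[OF T(1,2) _ _ that])
    then have "coeff (U_poly n l r) k = coeff (U_poly n l q) k" if "k \<le> n" for k
      using that U_coeff[of q k] U_coeff[of r k] q r by simp
    with incomparable[of q r] q r ne show False by (metis atLeastAtMost_iff less_irrefl)
  qed
  then have "card ((\<lambda>q. graph_iso `` {U q}) ` {0..p}) = p + 1"
    by (simp add: card_image)
  then show ?thesis
    using quot unfolding S_def U_def by simp
qed

end
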